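(* Let $\mathfrak g$ be a symmetrizable Kac-Moody Lie algebra with Coxeter quiver $Q(\mathfrak g)$ with exchange matrix $(\varepsilon_{st})_{s,t\in S}$, let $m\ge2$, and consider seeds $(Q_m(\mathfrak g),\mathbf X,\mathbf A)$ with variables $X_i^s,A_i^s$ at the vertex $v_i^s$ ($s\in S$, $i\in\mathbb Z_m$). (1) For each $s\in S$ the action of $R(s,i)$ on the seed is independent of $i\in\mathbb Z_m$; denoting it by $R(s)$, it is given on $A$-variables by $$R(s)^*(A_j^t)=\begin{cases}f_A(s)A_j^s& t=s\\ A_j^t&\text{otherwise}\end{cases},\qquad f_A(s)=\sum_{i\in\mathbb Z_m}\frac1{A_i^sA_{i+1}^s}\prod_{t\in s^+}(A_i^t)^{-\varepsilon_{st}}\prod_{t\in s^-}(A_{i+1}^t)^{\varepsilon_{st}},$$ and on $X$-variables by $$R(s)^*(X_j^t)=\begin{cases}\dfrac{f_X(s,j)}{X_{j-1}^sf_X(s,j-2)}&t=s\\[2mm] X_j^t\left(\dfrac{X_{j-1}^sf_X(s,j-2)}{f_X(s,j-1)}\right)^{-\varepsilon_{ts}}&t\in s^-\\[2mm] X_j^t\left(\dfrac{X_j^sf_X(s,j-1)}{f_X(s,j)}\right)^{\varepsilon_{ts}}&t\in s^+\\[2mm] X_j^t&\text{otherwise}\end{cases}\qquad f_X(s,i)=1+\sum_{k=0}^{m-2}X_i^sX_{i-1}^s\cdots X_{i-k}^s .$$ (2) The operators $R(s)$ ($s\in S$) generate an action of the Weyl group $W(\mathfrak g)$ on the seed, i.e.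 $(R(s)R(t))^{m_{st}}=1$ for all $s,t\in S$, where $m_{ss}=1$ and for $s\ne t$, $m_{st}=2,3,4,6,\infty$ according as $C_{st}C_{ts}=0,1,2,3,\ge4$ (no relation if $m_{st}=\infty$).
   Context: Cluster conventions. A weighted quiver $Q$ with finite vertex set $I$ consists of positive integers $d_i$ and an integral skew-symmetric matrix $\sigma_{ij}=\#\{i\to j\}-\#\{j\to i\}$; its exchange matrix is $\varepsilon_{ij}=\sigma_{ij}d_i/\gcd(d_i,d_j)$. A seed is $(Q,\mathbf X,\mathbf A)$ with $\mathbf X,\mathbf A$ tuples of algebraically independent elements of a field of rational functions, indexed by $I$. Mutation $\mu_k$: $d'=d$; $\varepsilon'_{ij}=-\varepsilon_{ij}$ if $k\in\{i,j\}$, $\varepsilon'_{ij}=\varepsilon_{ij}+\frac{|\varepsilon_{ik}|\varepsilon_{kj}+\varepsilon_{ik}|\varepsilon_{kj}|}{2}$ otherwise; $X'_k=X_k^{-1}$, $X'_i=X_i(1+X_k^{-\mathrm{sgn}(\varepsilon_{ik})})^{-\varepsilon_{ik}}$ for $i\ne k$; $A'_k=A_k^{-1}(\prod_{\varepsilon_{kj}>0}A_j^{\varepsilon_{kj}}+\prod_{\varepsilon_{kj}<0}A_j^{-\varepsilon_{kj}})$, $A'_i=A_i$ for $i\ne k$. A seed permutation $\pi$ sends $(\varepsilon_{ij},d_i,X_i,A_i)$ to $(\varepsilon_{\pi^{-1}(i)\pi^{-1}(j)},d_{\pi^{-1}(i)},X_{\pi^{-1}(i)},A_{\pi^{-1}(i)})$.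 Compositions are applied right to left. If a mutation sequence $\phi$ satisfies $\phi(Q,\mathbf X,\mathbf A)=(Q,\mathbf X',\mathbf A')$, write $\phi^*X_i=X'_i$, $\phi^*A_i=A'_i$. Kac-Moody data. $C=(C_{st})_{s,t\in S}$ is a generalized Cartan matrix, symmetrizable by positive integers $d_s$, $\gcd(d_s)=1$, $d_sC_{st}=d_tC_{ts}$. A Coxeter quiver $Q(\mathfrak g)$ is a weighted quiver with vertex set $S$, weights $d_s$, and exchange matrix with $|\varepsilon_{st}|=-C_{ts}$ for $s\ne t$; $\sigma_{st}$ are its signed arrow numbers. For $s\in S$, $s^+$ (resp. $s^-$) is the set of $t\in S$ with an arrow $t\to s$ (resp. $s\to t$) in $Q(\mathfrak g)$. $Q_m(\mathfrak g)$ has vertices $v_i^s$ ($s\in S$, $i\in\mathbb Z_m=\mathbb Z/m\mathbb Z$) of weight $d_s$, an arrow $v_i^s\to v_{i+1}^s$ for all $s,i$ (for $m=2$ these cancel), and, whenever $\sigma_{st}\ge1$, $\sigma_{st}$ arrows $v_i^s\to v_i^t$ and $\sigma_{st}$ arrows $v_{i+1}^t\to v_i^s$ for all $i$. With $\mu_i^s$ the mutation at $v_i^s$ and $(v,v')$ a transposition, $R(s,i)=(M_i^s)^{-1}\circ(v^s_{m+i-2},v^s_{m+i-1})\circ\mu^s_{m+i-1}\mu^s_{m+i-2}\circ M_i^s$, where $M_i^s=\mu^s_{m+i-3}\mu^s_{m+i-4}\cdots\mu^s_{i+1}\mu^s_i$ (empty for $m=2$). It preserves the quiver $Q_m(\mathfrak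 g)$. *)

theory Defs
  imports
    "Berlekamp_Zassenhaus.Finite_Field"
    "HOL-Combinatorics.Transposition"
    "HOL-Library.Poly_Mapping"
    "HOL-Library.Extended_Nat"
begin

section \<open>Weighted quivers and seeds\<close>

definition skew_symmetric :: "('v \<Rightarrow> 'v \<Rightarrow> int) \<Rightarrow> bool" where
  "skew_symmetric \<sigma> \<longleftrightarrow> (\<forall>i j. \<sigma> i j = - \<sigma> j i)"

definition exchange_matrix :: "('v \<Rightarrow> nat) \<Rightarrow> ('v \<Rightarrow> 'v \<Rightarrow> int) \<Rightarrow> 'v \<Rightarrow> 'v \<Rightarrow> int" where
  "exchange_matrix d \<sigma> i j = \<sigma> i j * int (d i div gcd (d i) (d j))"

text \<open>
  The vertex set is the whole (finite) type. A weighted quiver is stored as its weights together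
  with its exchange matrix; since weights are positive, the signed arrow numbers \<open>\<sigma>\<close> are
  determined by these data.
\<close>

record 'v weighted_quiver =
  weight :: "'v \<Rightarrow> nat"
  exch :: "'v \<Rightarrow> 'v \<Rightarrow> int"

definition quiver_of :: "('v \<Rightarrow> nat) \<Rightarrow> ('v \<Rightarrow> 'v \<Rightarrow> int) \<Rightarrow> 'v weighted_quiver" where
  "quiver_of d \<sigma> = \<lparr>weight = d, exch = exchange_matrix d \<sigma>\<rparr>"

definition is_weighted_quiver :: "'v weighted_quiver \<Rightarrow> bool" where
  "is_weighted_quiver Q \<longleftrightarrow>
     (\<exists>d \<sigma>. (\<forall>i. d i > 0) \<and> skew_symmetric \<sigma> \<and> Q = quiver_of d \<sigma>)"

text \<open>
  Polynomials over the rationals in variables \<open>'v\<close> are finitely supported maps from exponent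
  vectors to coefficients. Independence over the rationals is the weakest form of algebraic
  independence in characteristic 0: it is implied by independence over any larger ground field.
\<close>

definition eval_mpoly :: "('v \<Rightarrow> 'f::field_char_0) \<Rightarrow> (('v \<Rightarrow>\<^sub>0 nat) \<Rightarrow>\<^sub>0 rat) \<Rightarrow> 'f" where
  "eval_mpoly x p =
     (\<Sum>e \<in> Poly_Mapping.keys p. of_rat (Poly_Mapping.lookup p e)
        * (\<Prod>v \<in> Poly_Mapping.keys e. x v ^ Poly_Mapping.lookup e v))"

definition algebraically_independent :: "('v \<Rightarrow> 'f::field_char_0) \<Rightarrow> bool" where
  "algebraically_independent x \<longleftrightarrow> (\<forall>p. eval_mpoly x p = 0 \<longrightarrow> p = 0)"

text \<open>
  The \<open>X\<close>- and the \<open>A\<close>-variables may live in different ambient fields (or in the same one), and no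
  independence between the two families is required.
\<close>

record ('v, 'f, 'g) seed =
  quiver :: "'v weighted_quiver"
  xvar :: "'v \<Rightarrow> 'f"
  avar :: "'v \<Rightarrow> 'g"

definition is_seed :: "('v::finite, 'f::field_char_0, 'g::field_char_0) seed \<Rightarrow> bool" where
  "is_seed S \<longleftrightarrow> is_weighted_quiver (quiver S)
     \<and> algebraically_independent (xvar S) \<and> algebraically_independent (avar S)"

section \<open>Mutations and seed permutations\<close>

text \<open>The division by 2 is exact: the numerator is \<open>0\<close> or \<open>\<plusminus> 2 * \<epsilon> i k * \<epsilon> k j\<close>.\<close>

definition mutate_matrix :: "'v \<Rightarrow> ('v \<Rightarrow> 'v \<Rightarrow> int) \<Rightarrow> 'v \<Rightarrow> 'v \<Rightarrow> int" where
  "mutate_matrix k \<epsilon> i j =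
     (if k = i \<or> k = j then - \<epsilon> i j
      else \<epsilon> i j + (\<bar>\<epsilon> i k\<bar> * \<epsilon> k j + \<epsilon> i k * \<bar>\<epsilon> k j\<bar>) div 2)"

definition mutate_X ::
    "'v \<Rightarrow> ('v \<Rightarrow> 'v \<Rightarrow> int) \<Rightarrow> ('v \<Rightarrow> 'f::field_char_0) \<Rightarrow> 'v \<Rightarrow> 'f" where
  "mutate_X k \<epsilon> X i =
     (if i = k then inverse (X k)
      else X i * (1 + X k powi (- sgn (\<epsilon> i k))) powi (- \<epsilon> i k))"

definition mutate_A ::
    "'v::finite \<Rightarrow> ('v \<Rightarrow> 'v \<Rightarrow> int) \<Rightarrow> ('v \<Rightarrow> 'g::field_char_0) \<Rightarrow> 'v \<Rightarrow> 'g" where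
  "mutate_A k \<epsilon> A i =
     (if i = k then
        inverse (A k) * ((\<Prod>j | \<epsilon> k j > 0. A j powi \<epsilon> k j) + (\<Prod>j | \<epsilon> k j < 0. A j powi (- \<epsilon> k j)))
      else A i)"

definition mutate ::
    "'v::finite \<Rightarrow> ('v, 'f::field_char_0, 'g::field_char_0) seed \<Rightarrow> ('v, 'f, 'g) seed" where
  "mutate k S = \<lparr>
     quiver = \<lparr>weight = weight (quiver S), exch = mutate_matrix k (exch (quiver S))\<rparr>,
     xvar = mutate_X k (exch (quiver S)) (xvar S),
     avar = mutate_A k (exch (quiver S)) (avar S)\<rparr>"

definition permute :: "('v \<Rightarrow> 'v) \<Rightarrow> ('v, 'f, 'g) seed \<Rightarrow> ('v, 'f, 'g) seed" where
  "permute \<pi> S = \<lparr>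
     quiver = \<lparr>weight = (\<lambda>i. weight (quiver S) (inv_into UNIV \<pi> i)),
               exch = (\<lambda>i j. exch (quiver S) (inv_into UNIV \<pi> i) (inv_into UNIV \<pi> j))\<rparr>,
     xvar = (\<lambda>i. xvar S (inv_into UNIV \<pi> i)),
     avar = (\<lambda>i. avar S (inv_into UNIV \<pi> i))\<rparr>"

text \<open>
  Mutations are involutions, so the inverse of a sequence of mutations is the reversed sequence.
  The nonvanishing conditions hold when the variables are algebraically independent.
\<close>

lemma mutate_matrix_involution:
  assumes "\<And>i. \<epsilon> i i = 0"
  shows "mutate_matrix k (mutate_matrix k \<epsilon>) = \<epsilon>"
proof (intro ext)
  fix i j
  have ev: "(\<bar>- a\<bar> * - b + - a * \<bar>- b\<bar>) div 2 = - ((\<bar>a\<bar> * b + a * \<bar>b\<bar>) div 2)" for a b :: int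
    by (cases "a \<ge> 0"; cases "b \<ge> 0") (auto simp: abs_if)
  show "mutate_matrix k (mutate_matrix k \<epsilon>) i j = \<epsilon> i j"
    using ev[of "\<epsilon> i k" "\<epsilon> k j"] by (simp add: mutate_matrix_def)
qed

lemma mutate_involution:
  fixes S :: "('v::finite, 'f::field_char_0, 'g::field_char_0) seed"
  defines "\<epsilon> \<equiv> exch (quiver S)"
  assumes diag: "\<And>i. \<epsilon> i i = 0"
    and X: "xvar S k \<noteq> 0" "1 + xvar S k \<noteq> 0"
    and A: "avar S k \<noteq> 0" "mutate_A k \<epsilon> (avar S) k \<noteq> 0"
  shows "mutate k (mutate k S) = S"
proof -
  let ?e = "mutate_matrix k \<epsilon>"
  have "mutate_X k ?e (mutate_X k \<epsilon> (xvar S)) i = xvar S i" for i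
  proof (cases "i = k")
    case False
    have nz: "1 + xvar S k powi (- sgn (\<epsilon> i k)) \<noteq> 0"
      using X by (cases "\<epsilon> i k > 0"; cases "\<epsilon> i k = 0") (auto simp: sgn_if field_simps)
    have "?e i k = - \<epsilon> i k" by (simp add: mutate_matrix_def)
    moreover have "inverse (xvar S k) powi sgn (\<epsilon> i k) = xvar S k powi (- sgn (\<epsilon> i k))"
      by (simp add: power_int_minus power_int_inverse)
    ultimately show ?thesis
      using False nz by (simp add: mutate_X_def sgn_minus power_int_minus)
  qed (simp add: mutate_X_def)
  moreover have "mutate_A k ?e (mutate_A k \<epsilon> (avar S)) i = avar S i" for i
  proof (cases "i = k")
    case True
    have e: "?e k j = - \<epsilon> k j" for j by (simp add: mutate_matrix_def)
    have "(\<Prod>j | \<epsilon> k j < 0. mutate_A k \<epsilon> (avar S) j powi (- \<epsilon> k j))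
        = (\<Prod>j | \<epsilon> k j < 0. avar S j powi (- \<epsilon> k j))"
      "(\<Prod>j | \<epsilon> k j > 0. mutate_A k \<epsilon> (avar S) j powi \<epsilon> k j)
        = (\<Prod>j | \<epsilon> k j > 0. avar S j powi \<epsilon> k j)"
      using diag by (auto intro!: prod.cong simp: mutate_A_def)
    then show ?thesis
      using A True unfolding mutate_A_def[of k ?e]
      by (simp add: e) (simp add: mutate_A_def add.commute)
  qed (simp add: mutate_A_def)
  ultimately show ?thesis
    using mutate_matrix_involution[of \<epsilon> k, OF diag]
    by (simp add: mutate_def \<epsilon>_def fun_eq_iff)
qed

section \<open>Kac-Moody data\<close>

definition generalized_cartan_matrix :: "('s \<Rightarrow> 's \<Rightarrow> int) \<Rightarrow> bool" where
  "generalized_cartan_matrix C \<longleftrightarrow>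
     (\<forall>s. C s s = 2) \<and> (\<forall>s t. s \<noteq> t \<longrightarrow> C s t \<le> 0) \<and> (\<forall>s t. C s t = 0 \<longleftrightarrow> C t s = 0)"

definition symmetrizer :: "('s \<Rightarrow> 's \<Rightarrow> int) \<Rightarrow> ('s \<Rightarrow> nat) \<Rightarrow> bool" where
  "symmetrizer C d \<longleftrightarrow>
     (\<forall>s. d s > 0) \<and> Gcd (range d) = 1 \<and> (\<forall>s t. int (d s) * C s t = int (d t) * C t s)"

definition coxeter_quiver ::
    "('s \<Rightarrow> 's \<Rightarrow> int) \<Rightarrow> ('s \<Rightarrow> nat) \<Rightarrow> ('s \<Rightarrow> 's \<Rightarrow> int) \<Rightarrow> bool" where
  "coxeter_quiver C d \<sigma> \<longleftrightarrow>
     skew_symmetric \<sigma> \<and> (\<forall>s t. s \<noteq> t \<longrightarrow> \<bar>exchange_matrix d \<sigma> s t\<bar> = - C t s)"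

definition in_nbrs :: "('s \<Rightarrow> 's \<Rightarrow> int) \<Rightarrow> 's \<Rightarrow> 's set" where
  "in_nbrs \<sigma> s = {t. \<sigma> t s \<ge> 1}"

definition out_nbrs :: "('s \<Rightarrow> 's \<Rightarrow> int) \<Rightarrow> 's \<Rightarrow> 's set" where
  "out_nbrs \<sigma> s = {t. \<sigma> s t \<ge> 1}"

definition coxeter_number :: "('s \<Rightarrow> 's \<Rightarrow> int) \<Rightarrow> 's \<Rightarrow> 's \<Rightarrow> enat" where
  "coxeter_number C s t =
     (if s = t then 1
      else if C s t * C t s = 0 then 2
      else if C s t * C t s = 1 then 3
      else if C s t * C t s = 2 then 4
      else if C s t * C t s = 3 then 6
      else \<infinity>)"

section \<open>The quiver \<open>Q\<^sub>m\<close> and the operators \<open>R(s,i)\<close>\<close>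

text \<open>
  The ring of integers modulo \<open>m\<close> is \<open>'m mod_ring\<close> with \<open>m = CARD('m)\<close>; the class \<open>nontriv\<close> says
  precisely \<open>CARD('m) \<ge> 2\<close>. The vertex \<open>v\<^sub>i\<^sup>s\<close> is the pair \<open>(s, i)\<close>.
  The third summand below counts the arrows from \<open>(s, j + 1)\<close> to \<open>(t, j)\<close>, of which there are
  \<open>\<sigma> t s\<close> when this is positive.
\<close>

fun Qm_arrows ::
    "('s \<Rightarrow> 's \<Rightarrow> int) \<Rightarrow> 's \<times> 'm::nontriv mod_ring \<Rightarrow> 's \<times> 'm mod_ring \<Rightarrow> int" where
  "Qm_arrows \<sigma> (s, i) (t, j) =
     (if s = t \<and> j = i + 1 then 1 else 0)
     + (if \<sigma> s t \<ge> 1 \<and> j = i then \<sigma> s t else 0)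
     + (if \<sigma> t s \<ge> 1 \<and> i = j + 1 then \<sigma> t s else 0)"

definition Qm ::
    "('s \<Rightarrow> nat) \<Rightarrow> ('s \<Rightarrow> 's \<Rightarrow> int) \<Rightarrow> ('s \<times> 'm::nontriv mod_ring) weighted_quiver" where
  "Qm d \<sigma> = quiver_of (\<lambda>v. d (fst v)) (\<lambda>v w. Qm_arrows \<sigma> v w - Qm_arrows \<sigma> w v)"

type_synonym ('s, 'm, 'f, 'g) Qm_seed = "('s \<times> 'm mod_ring, 'f, 'g) seed"

text \<open>
  \<open>mutate_seq s i ks\<close> mutates at \<open>(s, i + k)\<close> for the successive entries \<open>k\<close> of \<open>ks\<close>, the head of
  the list first. Accordingly \<open>M\<^sub>i\<^sup>s\<close> belongs to the list \<open>[0, ..., m - 3]\<close>, and its inverse to the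
  reversed list.
\<close>

definition mutate_seq ::
    "'s::finite \<Rightarrow> 'm mod_ring \<Rightarrow> nat list
      \<Rightarrow> ('s, 'm::nontriv, 'f::field_char_0, 'g::field_char_0) Qm_seed \<Rightarrow> ('s, 'm, 'f, 'g) Qm_seed"
  where "mutate_seq s i ks = fold (\<lambda>k. mutate (s, i + of_nat k)) ks"

definition R_at ::
    "'s::finite \<Rightarrow> 'm mod_ring
      \<Rightarrow> ('s, 'm::nontriv, 'f::field_char_0, 'g::field_char_0) Qm_seed \<Rightarrow> ('s, 'm, 'f, 'g) Qm_seed"
  where
  "R_at s i =
     mutate_seq s i (rev [0..<CARD('m) - 2])
     \<circ> permute (Transposition.transpose (s, of_nat CARD('m) + i - 2) (s, of_nat CARD('m) + i - 1))
     \<circ> mutate (s, of_nat CARD('m) + i - 1) \<circ> mutate (s, of_nat CARD('m) + i - 2)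
     \<circ> mutate_seq s i [0..<CARD('m) - 2]"

text \<open>On seeds with quiver \<open>Qm d \<sigma>\<close> the choice of base point \<open>0\<close> turns out to be immaterial.\<close>

definition R ::
    "'s::finite \<Rightarrow> ('s, 'm::nontriv, 'f::field_char_0, 'g::field_char_0) Qm_seed
      \<Rightarrow> ('s, 'm, 'f, 'g) Qm_seed" where
  "R s = R_at s 0"

definition f_A ::
    "('s::finite \<Rightarrow> nat) \<Rightarrow> ('s \<Rightarrow> 's \<Rightarrow> int)
      \<Rightarrow> ('s \<times> 'm::nontriv mod_ring \<Rightarrow> 'g::field_char_0) \<Rightarrow> 's \<Rightarrow> 'g" where
  "f_A d \<sigma> A s =
     (\<Sum>i\<in>UNIV. 1 / (A (s, i) * A (s, i + 1))
        * (\<Prod>t\<in>in_nbrs \<sigma> s. A (t, i) powi (- exchange_matrix d \<sigma> s t))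
        * (\<Prod>t\<in>out_nbrs \<sigma> s. A (t, i + 1) powi exchange_matrix d \<sigma> s t))"

definition f_X ::
    "('s \<times> 'm::nontriv mod_ring \<Rightarrow> 'f::field_char_0) \<Rightarrow> 's \<Rightarrow> 'm mod_ring \<Rightarrow> 'f" where
  "f_X X s i = 1 + (\<Sum>k = 0..CARD('m) - 2. \<Prod>l = 0..k. X (s, i - of_nat l))"

end

theory Submission
  imports Defs
begin

text \<open>
  On the \<open>A\<close>-side, \<open>R(s)\<close> multiplies the \<open>A\<^sub>j\<^sup>s\<close> by \<open>f\<^sub>A(s)\<close>, and it multiplies \<open>f\<^sub>A(t)\<close> by \<open>f\<^sub>A(s)\<close> to the power
  \<open>- C\<^sub>s\<^sub>t\<close>: the \<open>f\<^sub>A\<close> transform like simple roots, so the relations are those of a linear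
  representation of the Weyl group.

  On the \<open>X\<close>-side this fails, because the product \<open>u\<close> of the \<open>X\<^sub>j\<^sup>s\<close> over \<open>j\<close> need not be \<open>1\<close>. There
  \<open>R(s)\<close> is governed by the gauge factors \<open>g\<^sub>j = X\<^sub>j f(j - 1) / f(j)\<close>: it replaces \<open>X\<^sub>j\<close> by
  \<open>X\<^sub>j / (g\<^sub>j g\<^sub>j\<^sub>-\<^sub>1)\<close> and multiplies the neighbouring variables by powers of \<open>g\<^sub>j\<close> or \<open>g\<^sub>j\<^sub>-\<^sub>1\<close>. If \<open>u \<noteq> 1\<close>, then
  \<open>g\<close> is the only solution without an entry \<open>1\<close> of the Riccati equation
  \<open>X\<^sub>j (1 - g\<^sub>j) = g\<^sub>j (1 - g\<^sub>j\<^sub>-\<^sub>1)\<close>. Uniqueness shows that \<open>R(s)\<close> inverts its own gauge factors, and it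
  yields the braid relation of type \<open>A\<^sub>2\<close>. The relations of type \<open>B\<^sub>2\<close> and \<open>G\<^sub>2\<close> follow by folding
  \<open>A\<^sub>3\<close> and \<open>D\<^sub>4\<close>.

  For the formula for \<open>R(s, i)\<close>, let \<open>S'\<close> be the seed that it is claimed to produce from \<open>S\<close>. Mutating along
  \<open>M\<^sub>i\<^sup>s\<close> shortens the cycle at \<open>s\<close> until two vertices with opposite rows are left, and one checks that the
  middle part of \<open>R(s, i)\<close> sends \<open>M\<^sub>i\<^sup>s S\<close> to \<open>M\<^sub>i\<^sup>s S'\<close>.
\<close>

section \<open>Subtraction-free expressions\<close>

text \<open>The Riccati equation comes from a linear one. Passing from \<open>f(j - 1)\<close> to
  \<open>f(j)\<close> gives \<open>f(j) = 1 - u + X j * f(j - 1)\<close>, hence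
  \<open>1 - g j = (1 - u) / f(j)\<close>, and eliminating \<open>f\<close> leaves the equation for
  \<open>g\<close>. At \<open>u = 1\<close> all gauge factors are 1 and uniqueness is lost, so the
  obstacle is to keep \<open>u\<close> away from 1 at every node reflected along a word. The product
  of \<open>g\<close> around the cycle is again \<open>u\<close>; therefore reflections move the
  products \<open>u\<close> of the nodes as Weyl group elements move exponentials of roots. It is
  enough that no positive root gives the value 1 at the start, which algebraic independence of the
  initial variables provides. Along the orbit only positivity and this genericity are carried.
  Folding works because equal leaves of a star do not interact: reflecting \<open>r\<close> copies
  in turn is one reflection whose effect on the centre has multiplicity \<open>r\<close>. The return
  path in \<open>R(s, i)\<close> is never computed: mutation is an involution on seeds with positive
  variables, so reaching the image of \<open>S'\<close> under \<open>M\<close> is enough.\<close>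

text \<open>
  All denominators below are values of subtraction-free expressions. By algebraic independence such
  values form a set \<open>P\<close> closed under these operations and avoiding \<open>0\<close>.
\<close>

locale positive_part =
  fixes P :: "'a::field_char_0 set"
  assumes one [simp, intro]: "1 \<in> P"
    and add [simp, intro]: "x \<in> P \<Longrightarrow> y \<in> P \<Longrightarrow> x + y \<in> P"
    and mult [simp, intro]: "x \<in> P \<Longrightarrow> y \<in> P \<Longrightarrow> x * y \<in> P"
    and inverse [simp, intro]: "x \<in> P \<Longrightarrow> inverse x \<in> P"
    and zero: "0 \<notin> P"
begin

lemma nz: "x \<in> P \<Longrightarrow> x \<noteq> 0"
  using zero by auto

lemma divide [simp, intro]: "x \<in> P \<Longrightarrow> y \<in> P \<Longrightarrow> x / y \<in> P"
  by (simp add: divide_inverse)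

lemma power [simp, intro]: "x \<in> P \<Longrightarrow> x ^ n \<in> P"
  by (induction n) auto

lemma powi [simp, intro]: "x \<in> P \<Longrightarrow> x powi n \<in> P"
  by (simp add: power_int_def)

lemma prod [intro]: "(\<And>x. x \<in> A \<Longrightarrow> f x \<in> P) \<Longrightarrow> prod f A \<in> P"
  by (induction A rule: infinite_finite_induct) auto

lemma sum [intro]: "finite A \<Longrightarrow> A \<noteq> {} \<Longrightarrow> (\<And>x. x \<in> A \<Longrightarrow> f x \<in> P) \<Longrightarrow> sum f A \<in> P"
  by (induction A rule: finite_ne_induct) auto

end

section \<open>Polynomials with positive coefficients and their quotients\<close>

definition monom_eval :: "('v::finite \<Rightarrow> 'f::field_char_0) \<Rightarrow> ('v \<Rightarrow> nat) \<Rightarrow> 'f" where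
  "monom_eval x e = (\<Prod>v\<in>UNIV. x v ^ e v)"

lemma monom_eval_0: "monom_eval x (\<lambda>_. 0) = 1"
  by (simp add: monom_eval_def)

lemma monom_eval_mult: "monom_eval x e * monom_eval x e' = monom_eval x (\<lambda>v. e v + e' v)"
  by (simp add: monom_eval_def power_add prod.distrib)

lemma lookup_Abs_finite:
  "Poly_Mapping.lookup (Abs_poly_mapping f) = f" for f :: "'v::finite \<Rightarrow> nat"
  by (rule Abs_poly_mapping_inverse) simp

lemma eval_mpoly_single_Abs:
  fixes x :: "'v::finite \<Rightarrow> 'f::field_char_0"
  shows "eval_mpoly x (Poly_Mapping.single (Abs_poly_mapping e) c) = of_rat c * monom_eval x e"
proof -
  have "(\<Prod>v\<in>Poly_Mapping.keys (Abs_poly_mapping e). x v ^ e v) = monom_eval x e"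
    unfolding monom_eval_def
    by (rule prod.mono_neutral_left) (auto simp: in_keys_iff lookup_Abs_finite)
  then show ?thesis
    by (cases "c = 0") (simp_all add: eval_mpoly_def lookup_Abs_finite)
qed

lemma eval_mpoly_superset:
  fixes x :: "'v \<Rightarrow> 'f::field_char_0"
  assumes "finite A" "Poly_Mapping.keys p \<subseteq> A"
  shows "eval_mpoly x p = (\<Sum>e\<in>A. of_rat (Poly_Mapping.lookup p e)
        * (\<Prod>v \<in> Poly_Mapping.keys e. x v ^ Poly_Mapping.lookup e v))"
  unfolding eval_mpoly_def
  by (rule sum.mono_neutral_left) (use assms in \<open>auto simp: in_keys_iff\<close>)

lemma eval_mpoly_add:
  fixes x :: "'v \<Rightarrow> 'f::field_char_0"
  shows "eval_mpoly x (p + q) = eval_mpoly x p + eval_mpoly x q"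
proof -
  let ?A = "Poly_Mapping.keys p \<union> Poly_Mapping.keys q"
  have "Poly_Mapping.keys (p + q) \<subseteq> ?A"
    by (rule Poly_Mapping.keys_add)
  then show ?thesis
    by (simp add: eval_mpoly_superset[of ?A] lookup_add of_rat_add algebra_simps sum.distrib)
qed

text \<open>A list of exponent vectors may repeat entries, so it encodes positive integer
  coefficients; nonemptiness excludes the zero polynomial.\<close>

definition pos_polys :: "('v::finite \<Rightarrow> 'f::field_char_0) \<Rightarrow> 'f set" where
  "pos_polys x = {(\<Sum>e\<leftarrow>L. monom_eval x e) | L. L \<noteq> []}"

definition pos_ratfuns :: "('v::finite \<Rightarrow> 'f::field_char_0) \<Rightarrow> 'f set" where
  "pos_ratfuns x = {a / b | a b. a \<in> pos_polys x \<and> b \<in> pos_polys x}"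

lemma pos_polysI: "L \<noteq> [] \<Longrightarrow> a = (\<Sum>e\<leftarrow>L. monom_eval x e) \<Longrightarrow> a \<in> pos_polys x"
  by (auto simp: pos_polys_def)

lemma pos_ratfunsI: "c = a / b \<Longrightarrow> a \<in> pos_polys x \<Longrightarrow> b \<in> pos_polys x \<Longrightarrow> c \<in> pos_ratfuns x"
  by (auto simp: pos_ratfuns_def)

lemma pos_polys_monom: "monom_eval x e \<in> pos_polys x"
  by (rule pos_polysI[of "[e]"]) auto

lemma one_in_pos_polys: "1 \<in> pos_polys x"
  using pos_polys_monom[of x "\<lambda>_. 0"] by (simp add: monom_eval_0)

lemma pos_polys_add: "a \<in> pos_polys x \<Longrightarrow> b \<in> pos_polys x \<Longrightarrow> a + b \<in> pos_polys x"
proof -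
  assume "a \<in> pos_polys x" "b \<in> pos_polys x"
  then obtain K L where "K \<noteq> []" "a = (\<Sum>e\<leftarrow>K. monom_eval x e)" "b = (\<Sum>e\<leftarrow>L. monom_eval x e)"
    by (auto simp: pos_polys_def)
  then show ?thesis
    by (intro pos_polysI[of "K @ L"]) auto
qed

lemma pos_polys_mult:
  assumes "a \<in> pos_polys x" "b \<in> pos_polys x"
  shows "a * b \<in> pos_polys x"
proof -
  obtain K L where K: "K \<noteq> []" "a = (\<Sum>e\<leftarrow>K. monom_eval x e)"
    and L: "L \<noteq> []" "b = (\<Sum>e\<leftarrow>L. monom_eval x e)"
    using assms by (auto simp: pos_polys_def)
  have mono: "monom_eval x e * (\<Sum>e\<leftarrow>L. monom_eval x e)
      = (\<Sum>e'\<leftarrow>map (\<lambda>e' v. e v + e' v) L. monom_eval x e')" for e L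
    by (induction L) (auto simp: algebra_simps monom_eval_mult)
  have "(\<Sum>e\<leftarrow>K. monom_eval x e) * (\<Sum>e\<leftarrow>L. monom_eval x e) \<in> pos_polys x"
    using K(1)
  proof (induction K rule: list_nonempty_induct)
    case (single e)
    show ?case
      using L(1) by (simp add: mono del: map_map) (rule pos_polysI[OF _ refl], simp)
  next
    case (cons e K)
    have "monom_eval x e * (\<Sum>e\<leftarrow>L. monom_eval x e) \<in> pos_polys x"
      using L(1) unfolding mono by (intro pos_polysI[OF _ refl]) simp
    with cons show ?case
      by (simp add: algebra_simps pos_polys_add)
  qed
  with K L show ?thesis by simp
qed

text \<open>No cancellation can occur: all coefficients of the formal polynomial are nonnegative and
  the one at the head of the list is positive, so independence forbids the value 0.\<close>

lemma zero_notin_pos_polys: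
  assumes "algebraically_independent x"
  shows "0 \<notin> pos_polys x"
proof
  assume "0 \<in> pos_polys x"
  then obtain L where L: "L \<noteq> []" "(\<Sum>e\<leftarrow>L. monom_eval x e) = 0"
    by (auto simp: pos_polys_def)
  define p where "p L = (\<Sum>e\<leftarrow>L. Poly_Mapping.single (Abs_poly_mapping e) (1::rat))" for L :: "('a \<Rightarrow> nat) list"
  have "eval_mpoly x (p L) = (\<Sum>e\<leftarrow>L. monom_eval x e)" for L
    by (induction L) (simp_all add: p_def eval_mpoly_add eval_mpoly_single_Abs, simp add: eval_mpoly_def)
  with L assms have "p L = 0"
    by (simp add: algebraically_independent_def)
  moreover have nonneg: "Poly_Mapping.lookup (p L) e \<ge> 0" for L e
    by (induction L) (simp_all add: p_def lookup_add lookup_single when_def)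
  have "Poly_Mapping.lookup (p L) (Abs_poly_mapping (hd L)) > 0"
    using L(1) nonneg[of "tl L" "Abs_poly_mapping (hd L)"]
    by (cases L) (simp_all add: p_def lookup_add)
  ultimately show False by simp
qed

lemma positive_part_pos_ratfuns:
  assumes "algebraically_independent x"
  shows "positive_part (pos_ratfuns x)"
proof -
  note z = zero_notin_pos_polys[OF assms]
  show ?thesis
  proof
    show "1 \<in> pos_ratfuns x"
      by (rule pos_ratfunsI[of _ 1 1]) (simp_all add: one_in_pos_polys)
    show "0 \<notin> pos_ratfuns x"
      using z by (auto simp: pos_ratfuns_def)
  next
    fix c assume "c \<in> pos_ratfuns x"
    then obtain a b where "c = a / b" "a \<in> pos_polys x" "b \<in> pos_polys x"
      by (auto simp: pos_ratfuns_def)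
    then show "inverse c \<in> pos_ratfuns x"
      by (intro pos_ratfunsI[of _ b a]) simp_all
  next
    fix c c' assume "c \<in> pos_ratfuns x" "c' \<in> pos_ratfuns x"
    then obtain a b a' b' where *: "a \<in> pos_polys x" "b \<in> pos_polys x" "a' \<in> pos_polys x"
      "b' \<in> pos_polys x" and c: "c = a / b" "c' = a' / b'"
      by (auto simp: pos_ratfuns_def)
    have nz: "b \<noteq> 0" "b' \<noteq> 0" using * z by auto
    have "c * c' = (a * a') / (b * b')" "c + c' = (a * b' + a' * b) / (b * b')"
      using nz by (simp_all add: c field_simps)
    then show "c * c' \<in> pos_ratfuns x" "c + c' \<in> pos_ratfuns x"
      using * by (metis pos_ratfunsI pos_polys_mult pos_polys_add)+
  qed
qed

lemma variable_in_pos_ratfuns: "x v \<in> pos_ratfuns x"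
proof -
  have "monom_eval x (\<lambda>w. if w = v then 1 else 0) = x v"
    by (simp add: monom_eval_def if_distrib[of "\<lambda>n. _ ^ n"] cong: if_cong)
  then have "x v \<in> pos_polys x"
    using pos_polys_monom by metis
  then show ?thesis
    by (intro pos_ratfunsI[of _ "x v" 1]) (simp_all add: one_in_pos_polys)
qed

text \<open>Positivity cannot exclude the value 1, since a monomial minus 1 has a negative
  coefficient; independence is applied to that polynomial directly. The genericity of the holonomies
  rests on this.\<close>

lemma monom_eval_neq_1:
  assumes "algebraically_independent x" "e v \<noteq> 0"
  shows "monom_eval x e \<noteq> 1"
proof
  assume e: "monom_eval x e = 1"
  let ?p = "Poly_Mapping.single (Abs_poly_mapping e) (1::rat)
    + Poly_Mapping.single (Abs_poly_mapping (\<lambda>_. 0)) (- 1)"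
  have "eval_mpoly x ?p = 0"
    by (simp only: eval_mpoly_add eval_mpoly_single_Abs) (simp add: e monom_eval_0)
  then have "?p = 0"
    using assms by (simp add: algebraically_independent_def)
  then have "Poly_Mapping.lookup ?p (Abs_poly_mapping e) = 0" by simp
  moreover have "Abs_poly_mapping (\<lambda>_. 0) \<noteq> Abs_poly_mapping e"
    using assms(2) lookup_Abs_finite[of e] lookup_Abs_finite[of "\<lambda>_. 0"] by metis
  ultimately show False
    by (simp add: lookup_add lookup_single)
qed

section \<open>Gauge factors\<close>

lemma of_nat_mod_ring_eq_iff:
  "(of_nat a :: 'm::nontriv mod_ring) = of_nat b \<longleftrightarrow> a mod CARD('m) = b mod CARD('m)"
proof -
  have "of_nat a = (of_nat b :: 'm mod_ring) \<longleftrightarrow> int a mod int CARD('m) = int b mod int CARD('m)"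
    unfolding of_nat_of_int_mod_ring by transfer simp
  then show ?thesis
    by (metis of_nat_eq_iff zmod_int)
qed

lemma bij_of_nat_mod_ring: "bij_betw (\<lambda>k. i + of_nat k) {..<CARD('m)} (UNIV :: 'm::nontriv mod_ring set)"
proof (rule bij_betw_imageI)
  show inj: "inj_on (\<lambda>k. i + of_nat k :: 'm mod_ring) {..<CARD('m)}"
    by (auto simp: inj_on_def of_nat_mod_ring_eq_iff)
  show "(\<lambda>k. i + of_nat k :: 'm mod_ring) ` {..<CARD('m)} = UNIV"
    by (rule card_subset_eq) (simp_all add: card_image[OF inj])
qed

lemma mod_ring_index:
  fixes i j :: "'m::nontriv mod_ring"
  obtains k where "k < CARD('m)" "j = i + of_nat k"
  using bij_of_nat_mod_ring[of i] by (metis UNIV_I bij_betw_def imageE lessThan_iff)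

lemma prod_mod_ring: "(\<Prod>j\<in>UNIV. h (j :: 'm::nontriv mod_ring)) = (\<Prod>k<CARD('m). h (i + of_nat k))"
  by (rule prod.reindex_bij_betw[OF bij_of_nat_mod_ring, symmetric])

lemma sum_mod_ring: "(\<Sum>j\<in>UNIV. h (j :: 'm::nontriv mod_ring)) = (\<Sum>k<CARD('m). h (i + of_nat k))"
  by (rule sum.reindex_bij_betw[OF bij_of_nat_mod_ring, symmetric])

lemma prod_mod_ring_shift: "(\<Prod>j\<in>UNIV. h (j - c :: 'm::nontriv mod_ring)) = (\<Prod>j\<in>UNIV. h j)"
  by (rule prod.reindex_bij_witness[of _ "\<lambda>j. j + c" "\<lambda>j. j - c"]) auto

lemma card_nontriv_ge_2: "CARD('m::nontriv) \<ge> 2"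
  using nontriv[where 'a = 'm] by simp

text \<open>\<open>f_X\<close> along one cycle: products over chains that start at \<open>i\<close>
  and run backwards, of lengths 0 to \<open>m - 1\<close>. The chain of length \<open>m\<close>,
  which is left out, would give the \<open>holonomy\<close>.\<close>

definition wsum :: "('m::nontriv mod_ring \<Rightarrow> 'f::field_char_0) \<Rightarrow> 'm mod_ring \<Rightarrow> 'f" where
  "wsum x i = 1 + (\<Sum>k = 0..CARD('m) - 2. \<Prod>l = 0..k. x (i - of_nat l))"

definition holonomy :: "('m::nontriv mod_ring \<Rightarrow> 'f::field_char_0) \<Rightarrow> 'f" where
  "holonomy x = (\<Prod>j\<in>UNIV. x j)"

definition gauge :: "('m::nontriv mod_ring \<Rightarrow> 'f::field_char_0) \<Rightarrow> 'm mod_ring \<Rightarrow> 'f" where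
  "gauge x i = x i * wsum x (i - 1) / wsum x i"

lemma f_X_eq_wsum: "f_X X s = wsum (\<lambda>j. X (s, j))"
  by (simp add: fun_eq_iff f_X_def wsum_def)

text \<open>Multiplication by \<open>x i\<close> prolongs each chain of \<open>i - 1\<close> by one
  vertex: the empty chain disappears and the full circle \<open>holonomy x\<close> is
  gained.\<close>

lemma wsum_rec:
  fixes x :: "'m::nontriv mod_ring \<Rightarrow> 'f::field_char_0"
  shows "wsum x i = 1 - holonomy x + x i * wsum x (i - 1)"
proof -
  let ?N = "CARD('m)"
  obtain M where M: "?N = Suc (Suc M)"
    using card_nontriv_ge_2[where 'm='m] that[of "?N - 2"] by simp
  define p where "p k = (\<Prod>l<k. x (i - of_nat l))" for k
  have p: "x i * (\<Prod>l = 0..k. x (i - 1 - of_nat l)) = p (Suc (Suc k))" for k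
    unfolding p_def lessThan_Suc_atMost atLeast0AtMost[symmetric]
    by (subst prod.atLeast0_atMost_Suc_shift) (simp add: algebra_simps)
  have "holonomy x = (\<Prod>j\<in>UNIV. x (i - j))"
    unfolding holonomy_def by (rule prod.reindex_bij_witness[of _ "\<lambda>j. i - j" "\<lambda>j. i - j"]) auto
  also have "\<dots> = p ?N"
    unfolding p_def by (subst prod_mod_ring[of _ 0]) simp
  finally have h: "holonomy x = p (Suc (Suc M))" using M by simp
  have w: "wsum x i = 1 + (\<Sum>k\<le>M. p (Suc k))"
    by (simp add: wsum_def M p_def atLeast0AtMost lessThan_Suc_atMost)
  have "x i * wsum x (i - 1) = p (Suc 0) + (\<Sum>k\<le>M. p (Suc (Suc k)))"
    by (simp add: wsum_def M algebra_simps sum_distrib_left flip: p) (simp add: p_def atLeast0AtMost)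
  also have "\<dots> = (\<Sum>k\<le>M. p (Suc k)) + p (Suc (Suc M))"
    using sum.atMost_Suc_shift[of "\<lambda>k. p (Suc k)" M] by simp
  finally show ?thesis by (simp add: w h)
qed

text \<open>Following the recurrence once around the cycle returns \<open>D i\<close> multiplied by
  \<open>holonomy x\<close>.\<close>

lemma cyclic_unique:
  fixes x :: "'m::nontriv mod_ring \<Rightarrow> 'f::field_char_0"
  assumes "\<And>i. D i = x i * D (i - 1)" "holonomy x \<noteq> 1"
  shows "D i = 0"
proof -
  have *: "D (i + of_nat k) = (\<Prod>l<k. x (i + 1 + of_nat l)) * D i" for k
  proof (induction k)
    case (Suc k)
    then show ?case
      using assms(1)[of "i + of_nat (Suc k)"] by (simp add: algebra_simps)
  qed simp
  have "D i = holonomy x * D i"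
    using *[of "CARD('m)"] by (simp add: holonomy_def prod_mod_ring[of _ "i + 1"])
  with assms(2) show ?thesis by simp
qed

lemma wsum_unique:
  assumes "\<And>i. h i = 1 - holonomy x + x i * h (i - 1)" "holonomy x \<noteq> 1"
  shows "h = wsum x"
proof
  fix i
  have "h i - wsum x i = 0"
  proof (rule cyclic_unique[OF _ assms(2)])
    show "h i - wsum x i = x i * (h (i - 1) - wsum x (i - 1))" for i
      by (subst assms(1), subst wsum_rec) (simp add: algebra_simps)
  qed
  then show "h i = wsum x i" by simp
qed

text \<open>The substitution \<open>(1 - holonomy x) / (1 - h i)\<close> linearizes the Riccati
  equation and turns it into the recurrence of \<open>wsum\<close>. It breaks down where
  \<open>h\<close> takes the value 1, as for the constant solution 1.\<close>

lemma gauge_unique: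
  fixes x h :: "'m::nontriv mod_ring \<Rightarrow> 'f::field_char_0"
  assumes x: "\<And>j. x j \<noteq> 0" "holonomy x \<noteq> 1"
    and h: "\<And>j. h j \<noteq> 1" "\<And>j. x j * (1 - h j) = h j * (1 - h (j - 1))"
  shows "gauge x = h"
proof -
  let ?f = "\<lambda>i. (1 - holonomy x) / (1 - h i)"
  have n: "1 - h j \<noteq> 0" for j using h(1)[of j] by auto
  have "?f = wsum x"
  proof (rule wsum_unique[OF _ x(2)])
    fix i
    have "x i / (1 - h (i - 1)) = h i / (1 - h i)"
      unfolding frac_eq_eq[OF n n] by (rule h(2))
    moreover have "x i * ?f (i - 1) = (1 - holonomy x) * (x i / (1 - h (i - 1)))"
      by simp
    moreover have "?f i = 1 - holonomy x + (1 - holonomy x) * (h i / (1 - h i))"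
      using n[of i] by (simp add: divide_simps) (simp add: algebra_simps)
    ultimately show "?f i = 1 - holonomy x + x i * ?f (i - 1)" by (simp only:)
  qed
  then have "gauge x i = x i * ?f (i - 1) / ?f i" for i
    unfolding gauge_def by metis
  moreover have "x i * ?f (i - 1) / ?f i = h i" for i
  proof -
    have "a * (c / d) / (c / e) = b" if "a * e = b * d" "c \<noteq> 0" "d \<noteq> 0" "e \<noteq> 0" for a b c d e :: 'f
      using that by (simp add: field_simps)
    from this[OF h(2) _ n n, of "1 - holonomy x"] show ?thesis
      using x(2) by (simp only: right_minus_eq not_False_eq_True eq_commute[of 1])
  qed
  ultimately show ?thesis by auto
qed

context positive_part
begin

lemma wsum_P [simp, intro]: "(\<And>j. x j \<in> P) \<Longrightarrow> wsum x i \<in> P"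
  unfolding wsum_def by (intro add sum prod) auto

lemma gauge_P [simp, intro]: "(\<And>j. x j \<in> P) \<Longrightarrow> gauge x i \<in> P"
  unfolding gauge_def by auto

lemma holonomy_P: "(\<And>j. x j \<in> P) \<Longrightarrow> holonomy x \<in> P"
  unfolding holonomy_def by (intro prod) auto

text \<open>\<open>gauge\<close> is \<open>x\<close> times quotients of neighbouring values of
  \<open>wsum\<close>, and these quotients cancel around the cycle.\<close>

lemma holonomy_gauge:
  assumes "\<And>j. x j \<in> P"
  shows "holonomy (gauge x) = holonomy x"
proof -
  have "(\<Prod>j\<in>UNIV. wsum x j) \<noteq> 0" using assms nz by simp
  then show ?thesis
    by (simp add: holonomy_def gauge_def prod_dividef prod.distrib prod_mod_ring_shift)
qed

lemma gauge_neq_1: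
  assumes "\<And>j. x j \<in> P" "holonomy x \<noteq> 1"
  shows "gauge x i \<noteq> 1"
  using wsum_rec[of x i] assms nz[OF wsum_P[of x i]] by (auto simp: gauge_def)

text \<open>The recurrence of \<open>wsum\<close> gives
  \<open>1 - gauge x i = (1 - holonomy x) / wsum x i\<close>; inserting this on both sides leaves
  the same expression.\<close>

lemma gauge_eq:
  assumes "\<And>j. x j \<in> P"
  shows "x i * (1 - gauge x i) = gauge x i * (1 - gauge x (i - 1))"
proof -
  have w: "wsum x j \<noteq> 0" for j using assms nz by auto
  have "wsum x i * (1 - gauge x i) = 1 - holonomy x" for i
  proof -
    have "gauge x i * wsum x i = x i * wsum x (i - 1)"
      using w[of i] by (simp add: gauge_def)
    then have "wsum x i * (1 - gauge x i) = wsum x i - x i * wsum x (i - 1)"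
      by (simp add: right_diff_distrib mult.commute)
    then show ?thesis
      by (simp add: wsum_rec[of x i])
  qed
  then have *: "1 - gauge x i = (1 - holonomy x) / wsum x i" for i
    using w[of i] by (simp add: field_simps)
  show ?thesis
    using w unfolding * by (simp add: gauge_def)
qed

text \<open>The inverses of the gauge factors solve the Riccati equation of the reflected variables,
  whose holonomy is \<open>1 / holonomy x\<close> and so again not 1. Hence a second reflection
  undoes the first.\<close>

lemma gauge_reflect:
  assumes "\<And>j. x j \<in> P" "holonomy x \<noteq> 1"
  shows "gauge (\<lambda>j. x j / (gauge x j * gauge x (j - 1))) = (\<lambda>j. 1 / gauge x j)"
proof (rule gauge_unique)
  note g = nz[OF gauge_P[of x, OF assms(1)]]
  show "x j / (gauge x j * gauge x (j - 1)) \<noteq> 0" for j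
    using assms(1) g nz by simp
  have "holonomy (\<lambda>j. x j / (gauge x j * gauge x (j - 1))) = holonomy x / (holonomy x * holonomy x)"
    unfolding holonomy_gauge[of x, OF assms(1), symmetric]
    using holonomy_gauge[of x, OF assms(1)]
    by (simp add: holonomy_def prod_dividef prod.distrib prod_mod_ring_shift)
  then show "holonomy (\<lambda>j. x j / (gauge x j * gauge x (j - 1))) \<noteq> 1"
    using assms nz[OF holonomy_P[of x, OF assms(1)]] by simp
  show "1 / gauge x j \<noteq> 1" for j
    using gauge_neq_1[of x, OF assms] g by simp
  show "x j / (gauge x j * gauge x (j - 1)) * (1 - 1 / gauge x j) = 1 / gauge x j * (1 - 1 / gauge x (j - 1))" for j
  proof -
    have "a / (b * c) * (1 - 1 / b) = 1 / b * (1 - 1 / c)"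
      if "a * (1 - b) = b * (1 - c)" "b \<noteq> 0" "c \<noteq> 0" for a b c :: 'a
      using that by (simp add: divide_simps) (simp add: algebra_simps)
    then show ?thesis
      using gauge_eq[of x j, OF assms(1)] g by blast
  qed
qed

end

section \<open>Relations in simply laced Coxeter groups\<close>

lemma coxeter_A2:
  fixes a b :: "'x \<Rightarrow> 'x"
  assumes inv: "\<And>x. a (a x) = x" "\<And>x. b (b x) = x"
    and braid: "\<And>x. a (b (a x)) = b (a (b x))"
  shows "((a \<circ> b) ^^ 3) x = x"
  by (simp add: numeral_3_eq_3 inv braid)

text \<open>\<open>b1\<close> and \<open>b2\<close> commute and act together as one generator
  \<open>b\<close>, so this is the relation of type B2. In \<open>long\<close> the words
  \<open>abab\<close> and \<open>baba\<close> are two reduced words of the longest element of type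
  A3.\<close>

lemma coxeter_A3:
  fixes a b1 b2 :: "'x \<Rightarrow> 'x"
  assumes inv: "\<And>x. a (a x) = x" "\<And>x. b1 (b1 x) = x" "\<And>x. b2 (b2 x) = x"
    and braid1: "\<And>x. a (b1 (a x)) = b1 (a (b1 x))"
    and braid2: "\<And>x. a (b2 (a x)) = b2 (a (b2 x))"
    and comm: "\<And>x. b2 (b1 x) = b1 (b2 x)"
  shows "((a \<circ> b1 \<circ> b2) ^^ 4) z = z"
proof -
  have long: "a (b1 (b2 (a (b1 (b2 x))))) = b1 (b2 (a (b1 (b2 (a x)))))" for x
  proof -
    have "a (b1 (b2 (a (b1 (b2 x))))) = a (b2 (a (b1 (a (b2 x)))))"
      by (simp only: comm braid1[of "b2 x"])
    also have "\<dots> = b2 (a (b1 (b2 (a (b2 x)))))"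
      by (simp only: comm braid2[of "b1 (a (b2 x))"])
    also have "\<dots> = b2 (a (b1 (a (b2 (a x)))))"
      by (simp only: comm braid2[of "x"])
    also have "\<dots> = b1 (b2 (a (b1 (b2 (a x)))))"
      by (simp only: comm braid1[of "b2 (a x)"])
    finally show ?thesis .
  qed
  have "((a \<circ> b1 \<circ> b2) ^^ 4) z
      = a (b1 (b2 (a (b1 (b2 (a (b1 (b2 (a (b1 (b2 z)))))))))))"
    by (simp add: eval_nat_numeral)
  also have "\<dots> = z"
    by (subst long) (simp add: inv comm)
  finally show ?thesis .
qed

text \<open>
  Both reduced words of the longest element are connected by braid moves; each step below is one
  braid move up to commutations.
\<close>

lemma coxeter_D4:
  fixes a b1 b2 b3 :: "'x \<Rightarrow> 'x"
  assumes inv: "\<And>x. a (a x) = x" "\<And>x. b1 (b1 x) = x" "\<And>x. b2 (b2 x) = x" "\<And>x. b3 (b3 x) = x"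
    and braid1: "\<And>x. a (b1 (a x)) = b1 (a (b1 x))"
    and braid2: "\<And>x. a (b2 (a x)) = b2 (a (b2 x))"
    and braid3: "\<And>x. a (b3 (a x)) = b3 (a (b3 x))"
    and comm: "\<And>x. b2 (b1 x) = b1 (b2 x)" "\<And>x. b3 (b1 x) = b1 (b3 x)" "\<And>x. b3 (b2 x) = b2 (b3 x)"
  shows "((a \<circ> b1 \<circ> b2 \<circ> b3) ^^ 6) z = z"
proof -
  have long: "a (b1 (b2 (b3 (a (b1 (b2 (b3 (a (b1 (b2 (b3 x))))))))))) =
    b1 (b2 (b3 (a (b1 (b2 (b3 (a (b1 (b2 (b3 (a x)))))))))))" for x
  proof -
    have "a (b1 (b2 (b3 (a (b1 (b2 (b3 (a (b1 (b2 (b3 x))))))))))) = a (b2 (b3 (a (b1 (a (b2 (b3 (a (b1 (b2 (b3 x)))))))))))"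
      by (simp only: comm braid1[of "b2 (b3 (a (b1 (b2 (b3 x)))))"])
    also have "\<dots> = a (b2 (b3 (a (b1 (a (b3 (a (b2 (a (b1 (b3 x)))))))))))"
      by (simp only: comm braid2[of "b1 (b3 x)"])
    also have "\<dots> = a (b2 (b3 (a (b1 (b3 (a (b2 (b3 (a (b1 (b3 x)))))))))))"
      by (simp only: comm braid3[of "b2 (a (b1 (b3 x)))"])
    also have "\<dots> = a (b2 (a (b3 (a (b1 (a (b2 (b3 (a (b1 (b3 x)))))))))))"
      by (simp only: comm braid3[of "b1 (a (b2 (b3 (a (b1 (b3 x))))))"])
    also have "\<dots> = a (b2 (a (b3 (a (b1 (a (b2 (a (b3 (a (b1 x)))))))))))"
      by (simp only: comm braid3[of "b1 x"])
    also have "\<dots> = b2 (a (b2 (b3 (a (b1 (a (b2 (a (b3 (a (b1 x)))))))))))"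
      by (simp only: comm braid2[of "b3 (a (b1 (a (b2 (a (b3 (a (b1 x))))))))"])
    also have "\<dots> = b2 (a (b1 (b2 (b3 (a (b1 (b2 (a (b3 (a (b1 x)))))))))))"
      by (simp only: comm braid1[of "b2 (a (b3 (a (b1 x))))"])
    also have "\<dots> = b2 (a (b1 (b3 (a (b2 (a (b1 (a (b3 (a (b1 x)))))))))))"
      by (simp only: comm braid2[of "b1 (a (b3 (a (b1 x))))"])
    also have "\<dots> = b2 (a (b1 (b3 (a (b1 (b2 (a (b1 (b3 (a (b1 x)))))))))))"
      by (simp only: comm braid1[of "b3 (a (b1 x))"])
    also have "\<dots> = b2 (a (b3 (a (b1 (a (b2 (a (b1 (b3 (a (b1 x)))))))))))"
      by (simp only: comm braid1[of "b2 (a (b1 (b3 (a (b1 x)))))"])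
    also have "\<dots> = b2 (a (b3 (a (b1 (a (b2 (a (b3 (a (b1 (a x)))))))))))"
      by (simp only: comm braid1[of "x"])
    also have "\<dots> = b2 (b3 (a (b1 (b3 (a (b2 (a (b3 (a (b1 (a x)))))))))))"
      by (simp only: comm braid3[of "b1 (a (b2 (a (b3 (a (b1 (a x)))))))"])
    also have "\<dots> = b2 (b3 (a (b1 (b3 (a (b2 (b3 (a (b1 (b3 (a x)))))))))))"
      by (simp only: comm braid3[of "b1 (a x)"])
    also have "\<dots> = b2 (b3 (a (b1 (a (b3 (a (b2 (a (b1 (b3 (a x)))))))))))"
      by (simp only: comm braid3[of "b2 (a (b1 (b3 (a x))))"])
    also have "\<dots> = b1 (b2 (b3 (a (b1 (b3 (a (b2 (a (b1 (b3 (a x)))))))))))"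
      by (simp only: comm braid1[of "b3 (a (b2 (a (b1 (b3 (a x))))))"])
    also have "\<dots> = b1 (b2 (b3 (a (b1 (b2 (b3 (a (b1 (b2 (b3 (a x)))))))))))"
      by (simp only: comm braid2[of "b1 (b3 (a x))"])
    finally show ?thesis .
  qed
  have "((a \<circ> b1 \<circ> b2 \<circ> b3) ^^ 6) z
      = a (b1 (b2 (b3 (a (b1 (b2 (b3 (a (b1 (b2 (b3 (a (b1 (b2 (b3 (a (b1 (b2 (b3 (a (b1 (b2 (b3 z)))))))))))))))))))))))"
    by (simp add: eval_nat_numeral)
  also have "\<dots> = z"
    by (subst long) (simp add: inv comm)
  finally show ?thesis .
qed

section \<open>The braid relation of the gauge action\<close>

lemma holonomy_mult: "holonomy (\<lambda>j. x j * y j) = holonomy x * holonomy y"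
  by (simp add: holonomy_def prod.distrib)

lemma holonomy_divide: "holonomy (\<lambda>j. x j / y j) = holonomy x / holonomy y"
  by (simp add: holonomy_def prod_dividef)

lemma holonomy_shift: "holonomy (\<lambda>j. x (j - c)) = holonomy x"
  by (simp add: holonomy_def prod_mod_ring_shift)

text \<open>The Riccati condition that \<open>gauge_unique\<close> asks of a quotient
  \<open>e / c\<close>, cleared of denominators.\<close>

lemma riccati_quotient:
  fixes x c c' d e e' :: "'a::field"
  assumes "x * d * (c - e) = e * c * (c' - e')" "c \<noteq> 0" "c' \<noteq> 0"
  shows "x / (c * c') * d * (1 - e / c) = e / c * (1 - e' / c')"
proof -
  have "x / (c * c') * d * (1 - e / c) = x * d * (c - e) / (c * c * c')"
    using assms(2,3) by (simp add: field_simps)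
  also have "\<dots> = e / c * (1 - e' / c')"
    unfolding assms(1) using assms(2,3) by (simp add: field_simps)
  finally show ?thesis .
qed

context positive_part
begin

text \<open>\<open>x\<close> and \<open>y\<close> belong to adjacent nodes, with the index shifts of
  arrows from the first to the second. Three reflections have gauge factors \<open>g\<close>,
  \<open>h1\<close>, \<open>g1 / g\<close> in one order and \<open>h\<close>, \<open>g1\<close>,
  \<open>h1 / h\<close> in the other, so both orders accumulate \<open>g1\<close> at the first node
  and \<open>h1\<close> at the second.\<close>

lemma gauge_braid:
  fixes x y :: "'m::nontriv mod_ring \<Rightarrow> 'a"
  assumes x: "\<And>j. x j \<in> P" "holonomy x \<noteq> 1" and y: "\<And>j. y j \<in> P" "holonomy y \<noteq> 1"
    and xy: "holonomy x * holonomy y \<noteq> 1"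
  defines "g \<equiv> gauge x" and "h \<equiv> gauge y"
  defines "g1 \<equiv> gauge (\<lambda>j. x j * h j)" and "h1 \<equiv> gauge (\<lambda>j. y j * g (j - 1))"
  shows "gauge (\<lambda>j. x j / (g j * g (j - 1)) * h1 j) = (\<lambda>j. g1 j / g j)"
    and "gauge (\<lambda>j. y j / (h j * h (j - 1)) * g1 (j - 1)) = (\<lambda>j. h1 j / h j)"
proof -
  have gP: "g j \<in> P" and hP: "h j \<in> P" for j
    using x y by (auto simp: g_def h_def)
  have P1: "x j * h j \<in> P" "y j * g (j - 1) \<in> P" for j
    using x y gP hP by auto
  have g1P: "g1 j \<in> P" and h1P: "h1 j \<in> P" for j
    using P1 by (auto simp: g1_def h1_def)
  note nzs = nz[OF gP] nz[OF hP] nz[OF g1P] nz[OF h1P] nz[OF x(1)] nz[OF y(1)]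
  have hol: "holonomy g = holonomy x" "holonomy h = holonomy y"
    using holonomy_gauge[of x, OF x(1)] holonomy_gauge[of y, OF y(1)] by (simp_all add: g_def h_def)
  have hol_xh: "holonomy (\<lambda>j. x j * h j) = holonomy x * holonomy y"
    and hol_yg: "holonomy (\<lambda>j. y j * g (j - 1)) = holonomy x * holonomy y"
    by (simp_all add: holonomy_mult hol holonomy_shift)
  have hol1: "holonomy g1 = holonomy x * holonomy y" "holonomy h1 = holonomy x * holonomy y"
    using holonomy_gauge[of "\<lambda>j. x j * h j", OF P1(1)] holonomy_gauge[of "\<lambda>j. y j * g (j - 1)", OF P1(2)]
    by (simp_all add: g1_def h1_def hol_xh hol_yg)
  have eg: "x j * (1 - g j) = g j * (1 - g (j - 1))" for j
    unfolding g_def by (rule gauge_eq) (rule x)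
  have eh: "y j * (1 - h j) = h j * (1 - h (j - 1))" for j
    unfolding h_def by (rule gauge_eq) (rule y)
  have eg1: "x j * h j * (1 - g1 j) = g1 j * (1 - g1 (j - 1))" for j
    unfolding g1_def by (rule gauge_eq) (rule P1)
  have eh1: "y j * g (j - 1) * (1 - h1 j) = h1 j * (1 - h1 (j - 1))" for j
    unfolding h1_def by (rule gauge_eq) (rule P1)
  have ng: "g j \<noteq> 1" for j unfolding g_def by (rule gauge_neq_1) (rule x)+
  have nh: "h j \<noteq> 1" for j unfolding h_def by (rule gauge_neq_1) (rule y)+
  have ng1: "1 - g1 j \<noteq> 0" for j
    using gauge_neq_1[of "\<lambda>j. x j * h j" j] P1(1) xy by (simp add: g1_def hol_xh)
  have nh1: "1 - h1 j \<noteq> 0" for j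
    using gauge_neq_1[of "\<lambda>j. y j * g (j - 1)" j] P1(2) xy by (simp add: h1_def hol_yg)
  \<comment> \<open>The key identity is \<open>r j + g j * s j = 1\<close>: both sides satisfy the same linear recurrence
    around the cycle, whose multiplier \<open>g j * h j\<close> has product different from \<open>1\<close>.\<close>
  define r s where "r j = (1 - g j) / (1 - g1 j)" and "s j = (1 - h j) / (1 - h1 j)" for j
  have r: "(1 - g1 j) * r j = 1 - g j" and s: "(1 - h1 j) * s j = 1 - h j" for j
    using ng1[of j] nh1[of j] by (simp_all add: r_def s_def)
  \<comment> \<open>Comparing the Riccati equations before and after the reflection of the neighbour
    eliminates the variable itself. The same computation serves \<open>x\<close> with factor
    \<open>h\<close> and \<open>y\<close> with the shifted factor \<open>g\<close>.\<close>
  have step: "c1 * q = d * c * q'"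
    if "X * (1 - c) = c * (1 - c')" "X * d * (1 - c1) = c1 * (1 - c1')"
      "(1 - c1) * q = 1 - c" "(1 - c1') * q' = 1 - c'" "1 - c1 \<noteq> 0" "1 - c1' \<noteq> 0"
    for X c c' d c1 c1' q q' :: 'a
  proof -
    have "(1 - c1') * (c1 * q) = X * d * ((1 - c1) * q)"
      using that(2) by (simp add: mult_ac)
    also have "\<dots> = d * (c * (1 - c'))"
      unfolding that(3) that(1)[symmetric] by (simp add: mult_ac)
    also have "\<dots> = (1 - c1') * (d * c * q')"
      unfolding that(4)[symmetric] by (simp add: mult_ac)
    finally show ?thesis
      using that(6) by simp
  qed
  have L: "g1 j * r j = h j * g j * r (j - 1)" for j
    by (rule step[OF eg eg1 r r ng1 ng1])
  have K: "h1 j * s j = g (j - 1) * h j * s (j - 1)" for j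
    by (rule step[OF eh eh1 s s nh1 nh1])
  have rel: "r j + g j * s j = 1" for j
  proof -
    have "r j + g j * s j - 1 = 0"
    proof (rule cyclic_unique[of "\<lambda>j. r j + g j * s j - 1" "\<lambda>j. g j * h j"])
      fix j
      have "r j = 1 - g j + g1 j * r j" "s j = 1 - h j + h1 j * s j"
        using r[of j] s[of j] by (simp_all add: algebra_simps)
      then have "r j = 1 - g j + h j * g j * r (j - 1)"
        "s j = 1 - h j + g (j - 1) * h j * s (j - 1)"
        unfolding L K by simp_all
      moreover have "q + c * p - 1 = c * d * (q' + c' * p' - 1)"
        if "q = 1 - c + d * c * q'" "p = 1 - d + c' * d * p'" for q c p d q' c' p' :: 'a
        unfolding that by (simp add: algebra_simps)
      ultimately show "r j + g j * s j - 1 = g j * h j * (r (j - 1) + g (j - 1) * s (j - 1) - 1)"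
        by blast
    next
      show "holonomy (\<lambda>j. g j * h j) \<noteq> 1"
        using xy by (simp add: holonomy_mult hol)
    qed
    then show ?thesis by simp
  qed
  \<comment> \<open>With \<open>rel\<close> the differences \<open>g - g1\<close> and
    \<open>h - h1\<close> become products, to which the recurrences \<open>K\<close> and
    \<open>L\<close> apply in the Riccati equations of the two quotients.\<close>
  have gd: "g j - g1 j = (1 - g1 j) * (g j * s j)" for j
  proof -
    have "g j * s j = 1 - r j" using rel[of j] by (simp add: algebra_simps)
    moreover have "(1 - g1 j) * (1 - r j) = g j - g1 j"
      using r[of j] by (simp add: right_diff_distrib)
    ultimately show ?thesis by simp
  qed
  have hd: "g j * (h j - h1 j) = (1 - h1 j) * (g1 j * r j)" for j
  proof -
    have "g1 j * r j = r j - (1 - g j)"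
      using r[of j] by (simp add: algebra_simps)
    also have "\<dots> = g j - g j * s j"
      unfolding rel[of j, symmetric] by simp
    finally have *: "g1 j * r j = g j - g j * s j" .
    have "(1 - h1 j) * (g1 j * r j) = g j * ((1 - h1 j) - (1 - h1 j) * s j)"
      unfolding * by (simp add: algebra_simps)
    then show ?thesis by (simp add: s)
  qed
  have snz: "s j \<noteq> 0" "r j \<noteq> 0" for j
    using nh[of j] nh1[of j] ng[of j] ng1[of j] by (auto simp: s_def r_def)
  show "gauge (\<lambda>j. x j / (g j * g (j - 1)) * h1 j) = (\<lambda>j. g1 j / g j)"
  proof (rule gauge_unique)
    show "x j / (g j * g (j - 1)) * h1 j \<noteq> 0" for j
      using nzs by simp
    show "holonomy (\<lambda>j. x j / (g j * g (j - 1)) * h1 j) \<noteq> 1"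
      using y(2) nz[OF holonomy_P[of x, OF x(1)]]
      by (simp add: holonomy_mult holonomy_divide holonomy_shift hol hol1)
    show "g1 j / g j \<noteq> 1" for j
      using gd[of j] ng1[of j] nzs(1)[of j] snz[of j] by auto
    fix j
    have "x j * h1 j * (g j - g1 j) = x j * (1 - g1 j) * g j * (h1 j * s j)"
      by (simp add: gd mult_ac)
    also have "\<dots> = g j * g (j - 1) * s (j - 1) * (x j * h j * (1 - g1 j))"
      by (simp add: K mult_ac)
    also have "\<dots> = g1 j * g j * (g (j - 1) - g1 (j - 1))"
      unfolding eg1 gd by (simp add: mult_ac)
    finally have main: "x j * h1 j * (g j - g1 j) = g1 j * g j * (g (j - 1) - g1 (j - 1))" .
    from riccati_quotient[OF main nzs(1) nzs(1)]
    show "x j / (g j * g (j - 1)) * h1 j * (1 - g1 j / g j) = g1 j / g j * (1 - g1 (j - 1) / g (j - 1))" .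
  qed
  show "gauge (\<lambda>j. y j / (h j * h (j - 1)) * g1 (j - 1)) = (\<lambda>j. h1 j / h j)"
  proof (rule gauge_unique)
    show "y j / (h j * h (j - 1)) * g1 (j - 1) \<noteq> 0" for j
      using nzs by simp
    show "holonomy (\<lambda>j. y j / (h j * h (j - 1)) * g1 (j - 1)) \<noteq> 1"
      using x(2) nz[OF holonomy_P[of y, OF y(1)]]
      by (simp add: holonomy_mult holonomy_divide holonomy_shift hol hol1)
    show "h1 j / h j \<noteq> 1" for j
      using hd[of j] nh1[of j] nzs(2,3)[of j] snz[of j] by auto
    fix j
    have "g j * g (j - 1) * (y j * g1 (j - 1) * (h j - h1 j))
        = y j * g1 (j - 1) * g (j - 1) * (g j * (h j - h1 j))"
      by (simp add: mult_ac)
    also have "\<dots> = g1 (j - 1) * (y j * g (j - 1) * (1 - h1 j)) * (g1 j * r j)"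
      unfolding hd by (simp add: mult_ac)
    also have "\<dots> = h1 j * h j * g j * ((1 - h1 (j - 1)) * (g1 (j - 1) * r (j - 1)))"
      unfolding eh1[of j] L[of j] by (simp add: mult_ac)
    also have "\<dots> = g j * g (j - 1) * (h1 j * h j * (h (j - 1) - h1 (j - 1)))"
      unfolding hd[symmetric] by (simp add: mult_ac)
    finally have main: "y j * g1 (j - 1) * (h j - h1 j) = h1 j * h j * (h (j - 1) - h1 (j - 1))"
      using nzs(1) by simp
    from riccati_quotient[OF main nzs(2) nzs(2)]
    show "y j / (h j * h (j - 1)) * g1 (j - 1) * (1 - h1 j / h j) = h1 j / h j * (1 - h1 (j - 1) / h (j - 1))" .
  qed
qed

end

section \<open>The star of type \<open>D\<^sub>4\<close> and its foldings\<close>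

text \<open>
  Node \<open>0\<close> is the centre, every other node is a leaf, with arrows from the centre to the leaves. The
  first component holds the \<open>X\<close>-variables, the second accumulates the gauge factors of each node. Only
  the leaves \<open>1, 2, 3\<close> are ever used for reflections.
\<close>

type_synonym ('m, 'a) star_state =
  "(nat \<Rightarrow> 'm mod_ring \<Rightarrow> 'a) \<times> (nat \<Rightarrow> 'm mod_ring \<Rightarrow> 'a)"

definition star_reflect ::
    "nat \<Rightarrow> ('m::nontriv, 'a::field_char_0) star_state \<Rightarrow> ('m, 'a) star_state" where
  "star_reflect k S = (let g = gauge (fst S k) in
     (\<lambda>j. if j = k then (\<lambda>i. fst S k i / (g i * g (i - 1)))
          else if k = 0 then (\<lambda>i. fst S j i * g (i - 1))
          else if j = 0 then (\<lambda>i. fst S 0 i * g i)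
          else fst S j,
      (snd S)(k := (\<lambda>i. snd S k i * g i))))"

lemma star_reflect_self:
  "fst (star_reflect k S) k = (\<lambda>i. fst S k i / (gauge (fst S k) i * gauge (fst S k) (i - 1)))"
  and star_reflect_leaf: "j \<noteq> 0 \<Longrightarrow> fst (star_reflect 0 S) j = (\<lambda>i. fst S j i * gauge (fst S 0) (i - 1))"
  and star_reflect_center: "k \<noteq> 0 \<Longrightarrow> fst (star_reflect k S) 0 = (\<lambda>i. fst S 0 i * gauge (fst S k) i)"
  and star_reflect_other: "k \<noteq> 0 \<Longrightarrow> j \<noteq> 0 \<Longrightarrow> j \<noteq> k \<Longrightarrow> fst (star_reflect k S) j = fst S j"
  and star_reflect_snd: "snd (star_reflect k S) = (snd S)(k := (\<lambda>i. snd S k i * gauge (fst S k) i))"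
  by (simp_all add: star_reflect_def Let_def)

lemmas star_reflect_simps =
  star_reflect_self star_reflect_leaf star_reflect_center star_reflect_other star_reflect_snd

text \<open>The twelve monomials are the positive roots of \<open>D\<^sub>4\<close>, so the condition is Weyl invariant.\<close>

definition star_generic :: "(nat \<Rightarrow> 'a::field) \<Rightarrow> bool" where
  "star_generic u \<longleftrightarrow> u 0 \<noteq> 1 \<and> u 1 \<noteq> 1 \<and> u 2 \<noteq> 1 \<and> u 3 \<noteq> 1
     \<and> u 0 * u 1 \<noteq> 1 \<and> u 0 * u 2 \<noteq> 1 \<and> u 0 * u 3 \<noteq> 1
     \<and> u 0 * u 1 * u 2 \<noteq> 1 \<and> u 0 * u 1 * u 3 \<noteq> 1 \<and> u 0 * u 2 * u 3 \<noteq> 1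
     \<and> u 0 * u 1 * u 2 * u 3 \<noteq> 1 \<and> u 0 * u 0 * u 1 * u 2 * u 3 \<noteq> 1"

text \<open>The simple reflection of the centre permutes the positive roots except the simple root
  of the centre, which changes sign. So the twelve conditions are permuted, one of them after
  inversion; a leaf behaves in the same way.\<close>

lemma star_generic_center:
  assumes "star_generic u" "\<And>k. u k \<noteq> 0"
  shows "star_generic (\<lambda>k. if k = 0 then 1 / u 0 else u k * u 0)"
  using assms(1) assms(2)[of 0] by (simp add: star_generic_def field_simps)

lemma star_generic_leaf:
  assumes "star_generic u" "\<And>k. u k \<noteq> 0" "k \<in> {1, 2, 3}"
  shows "star_generic (\<lambda>j. if j = k then 1 / u k else if j = 0 then u 0 * u k else u j)"
  using assms(3,1) assms(2)[of k] by (auto simp: star_generic_def field_simps)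

context positive_part
begin

definition star_states :: "('m::nontriv, 'a) star_state set" where
  "star_states = {S. (\<forall>k i. fst S k i \<in> P) \<and> (\<forall>k i. snd S k i \<in> P)
     \<and> star_generic (\<lambda>k. holonomy (fst S k))}"

lemma star_states_P:
  "S \<in> star_states \<Longrightarrow> fst S k i \<in> P" "S \<in> star_states \<Longrightarrow> snd S k i \<in> P"
  by (auto simp: star_states_def)

lemma star_states_generic: "S \<in> star_states \<Longrightarrow> star_generic (\<lambda>k. holonomy (fst S k))"
  by (auto simp: star_states_def)

lemma star_states_holonomy:
  assumes "S \<in> star_states" "k \<in> {0, 1, 2, 3}"
  shows "holonomy (fst S k) \<noteq> 1"
  using star_states_generic[OF assms(1)] assms(2) by (auto simp: star_generic_def)

lemma holonomy_gauge_star: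
  assumes "S \<in> star_states"
  shows "holonomy (gauge (fst S k)) = holonomy (fst S k)"
  by (rule holonomy_gauge) (rule star_states_P[OF assms])

text \<open>Since gauge factors have the holonomy of the variables they come from, the holonomies
  move as the exponentials of the simple roots under a simple reflection, and genericity is Weyl
  invariant.\<close>

lemma star_reflect_states:
  assumes S: "S \<in> star_states" and k: "k \<in> {0, 1, 2, 3}"
  shows "star_reflect k S \<in> star_states"
proof -
  let ?u = "\<lambda>k. holonomy (fst S k)"
  have nzu: "?u k \<noteq> 0" for k
    by (rule nz, rule holonomy_P) (rule star_states_P[OF S])
  have hol_self: "holonomy (fst (star_reflect k S) k) = 1 / ?u k"
    using nzu by (simp add: star_reflect_simps holonomy_mult holonomy_divide holonomy_shift holonomy_gauge_star[OF S])
  have "star_generic (\<lambda>j. holonomy (fst (star_reflect k S) j))"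
  proof (cases "k = 0")
    case True
    have "(\<lambda>j. holonomy (fst (star_reflect k S) j)) = (\<lambda>j. if j = 0 then 1 / ?u 0 else ?u j * ?u 0)"
      using hol_self
      by (auto simp: fun_eq_iff True star_reflect_leaf holonomy_mult holonomy_shift holonomy_gauge_star[OF S])
    then show ?thesis
      using star_generic_center[OF star_states_generic[OF S] nzu] by simp
  next
    case False
    have "(\<lambda>j. holonomy (fst (star_reflect k S) j))
        = (\<lambda>j. if j = k then 1 / ?u k else if j = 0 then ?u 0 * ?u k else ?u j)"
      using hol_self False
      by (auto simp: fun_eq_iff star_reflect_center star_reflect_other holonomy_mult holonomy_gauge_star[OF S])
    then show ?thesis
      using star_generic_leaf[OF star_states_generic[OF S] nzu, of k] k False by simp
  qed
  moreover have "gauge (fst S k) i \<in> P" for i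
    by (rule gauge_P) (rule star_states_P[OF S])
  then have "fst (star_reflect k S) j i \<in> P" "snd (star_reflect k S) j i \<in> P" for j i
    using star_states_P[OF S] by (auto simp: star_reflect_def Let_def)
  ultimately show ?thesis
    by (simp add: star_states_def)
qed

lemma star_reflect_involution:
  assumes S: "S \<in> star_states" and k: "k \<in> {0, 1, 2, 3}"
  shows "star_reflect k (star_reflect k S) = S"
proof -
  let ?g = "gauge (fst S k)"
  have g: "gauge (fst (star_reflect k S) k) = (\<lambda>j. 1 / ?g j)"
    unfolding star_reflect_self
    by (rule gauge_reflect) (rule star_states_P[OF S] star_states_holonomy[OF S k])+
  have nzg: "?g j \<noteq> 0" for j
    by (rule nz, rule gauge_P) (rule star_states_P[OF S])
  have "fst (star_reflect k (star_reflect k S)) j = fst S j" for j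
  proof -
    consider "j = k" | "j \<noteq> k" "k = 0" | "j \<noteq> k" "k \<noteq> 0" "j = 0" | "j \<noteq> k" "k \<noteq> 0" "j \<noteq> 0"
      by blast
    then show ?thesis
    proof cases
      case 1
      then show ?thesis
        unfolding 1 star_reflect_self[of k "star_reflect k S"] g
        using nzg by (simp add: star_reflect_self)
    next
      case 2
      then show ?thesis
        using g nzg by (simp add: star_reflect_leaf)
    qed (use g nzg in \<open>simp_all add: star_reflect_simps(3,4)\<close>)
  qed
  moreover have "snd (star_reflect k (star_reflect k S)) = snd S"
    by (simp add: star_reflect_snd g nzg)
  ultimately show ?thesis
    by (intro prod_eqI ext) auto
qed

lemma star_reflect_commute:
  assumes "k \<noteq> 0" "l \<noteq> 0" "k \<noteq> l"
  shows "star_reflect k (star_reflect l S) = star_reflect l (star_reflect k S)"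
proof -
  have "fst (star_reflect k (star_reflect l S)) j = fst (star_reflect l (star_reflect k S)) j" for j
    using assms by (cases "j = k"; cases "j = l"; cases "j = 0") (simp_all add: star_reflect_simps mult_ac)
  moreover have "snd (star_reflect k (star_reflect l S)) = snd (star_reflect l (star_reflect k S))"
    using assms by (simp add: star_reflect_simps fun_upd_twist)
  ultimately show ?thesis
    by (intro prod_eqI ext) auto
qed

text \<open>By \<open>gauge_braid\<close> both sides accumulate the same factors at the centre and
  at leaf \<open>k\<close>; any other leaf depends only on the factor accumulated at the
  centre.\<close>

lemma star_reflect_braid:
  assumes S: "S \<in> star_states" and k: "k \<in> {1, 2, 3}"
  shows "star_reflect 0 (star_reflect k (star_reflect 0 S)) = star_reflect k (star_reflect 0 (star_reflect k S))"
proof -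
  let ?x = "fst S 0" and ?y = "fst S k"
  let ?g = "gauge ?x" and ?h = "gauge ?y"
  let ?g1 = "gauge (\<lambda>j. ?x j * ?h j)" and ?h1 = "gauge (\<lambda>j. ?y j * ?g (j - 1))"
  have k0: "k \<noteq> 0" using k by auto
  have hol: "holonomy ?x \<noteq> 1" "holonomy ?y \<noteq> 1" "holonomy ?x * holonomy ?y \<noteq> 1"
    using star_states_generic[OF S] k by (auto simp: star_generic_def)
  note SP = star_states_P(1)[OF S]
  have nzg: "?g j \<noteq> 0" "?h j \<noteq> 0" "?g1 j \<noteq> 0" "?h1 j \<noteq> 0" for j
    by (rule nz; use SP in auto)+
  note br = gauge_braid[of ?x ?y, OF SP hol(1) SP hol(2) hol(3)]
  have l2: "fst (star_reflect k (star_reflect 0 S)) 0 = (\<lambda>j. ?x j / (?g j * ?g (j - 1)) * ?h1 j)"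
    using k0 by (simp add: star_reflect_simps)
  have r2: "fst (star_reflect 0 (star_reflect k S)) k = (\<lambda>j. ?y j / (?h j * ?h (j - 1)) * ?g1 (j - 1))"
    using k0 by (simp add: star_reflect_simps)
  have gl: "gauge (fst (star_reflect k (star_reflect 0 S)) 0) = (\<lambda>j. ?g1 j / ?g j)"
    unfolding l2 by (rule br)
  have gr: "gauge (fst (star_reflect 0 (star_reflect k S)) k) = (\<lambda>j. ?h1 j / ?h j)"
    unfolding r2 by (rule br)
  have g2: "gauge (fst (star_reflect 0 S) k) = ?h1" "gauge (fst (star_reflect k S) 0) = ?g1"
    using k0 by (simp_all add: star_reflect_simps)
  have "fst (star_reflect 0 (star_reflect k (star_reflect 0 S))) j
      = fst (star_reflect k (star_reflect 0 (star_reflect k S))) j" for j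
  proof -
    consider "j = 0" | "j = k" | "j \<noteq> 0" "j \<noteq> k" by blast
    then show ?thesis
    proof cases
      case 1
      have "fst (star_reflect 0 (star_reflect k (star_reflect 0 S))) 0
          = (\<lambda>i. ?x i * ?h1 i / (?g1 i * ?g1 (i - 1)))"
        unfolding star_reflect_self[of 0 "star_reflect k (star_reflect 0 S)"] gl unfolding l2
        using nzg by (simp add: field_simps)
      moreover have "fst (star_reflect k (star_reflect 0 (star_reflect k S))) 0
          = (\<lambda>i. ?x i * ?h1 i / (?g1 i * ?g1 (i - 1)))"
        unfolding star_reflect_center[OF k0, of "star_reflect 0 (star_reflect k S)"] gr
          star_reflect_self[of 0 "star_reflect k S"] g2
        using nzg k0 by (simp add: star_reflect_center field_simps)
      ultimately show ?thesis by (simp add: 1)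
    next
      case 2
      have "fst (star_reflect 0 (star_reflect k (star_reflect 0 S))) k
          = (\<lambda>i. ?y i * ?g1 (i - 1) / (?h1 i * ?h1 (i - 1)))"
        unfolding star_reflect_leaf[OF k0, of "star_reflect k (star_reflect 0 S)"] gl
          star_reflect_self[of k "star_reflect 0 S"] g2
        using nzg k0 by (simp add: star_reflect_leaf field_simps)
      moreover have "fst (star_reflect k (star_reflect 0 (star_reflect k S))) k
          = (\<lambda>i. ?y i * ?g1 (i - 1) / (?h1 i * ?h1 (i - 1)))"
        unfolding star_reflect_self[of k "star_reflect 0 (star_reflect k S)"] gr unfolding r2
        using nzg by (simp add: field_simps)
      ultimately show ?thesis by (simp add: 2)
    next
      case 3
      have "fst (star_reflect 0 (star_reflect k (star_reflect 0 S))) j = (\<lambda>i. fst S j i * ?g1 (i - 1))"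
        unfolding star_reflect_leaf[OF 3(1), of "star_reflect k (star_reflect 0 S)"] gl
        using nzg k0 3 by (simp add: star_reflect_simps)
      moreover have "fst (star_reflect k (star_reflect 0 (star_reflect k S))) j = (\<lambda>i. fst S j i * ?g1 (i - 1))"
        using k0 3 by (simp add: star_reflect_simps)
      ultimately show ?thesis by simp
    qed
  qed
  moreover have "snd (star_reflect 0 (star_reflect k (star_reflect 0 S)))
      = (snd S)(0 := (\<lambda>i. snd S 0 i * ?g1 i), k := (\<lambda>i. snd S k i * ?h1 i))"
    unfolding star_reflect_snd gl g2 using nzg k0 by (simp add: fun_eq_iff)
  moreover have "snd (star_reflect k (star_reflect 0 (star_reflect k S)))
      = (snd S)(0 := (\<lambda>i. snd S 0 i * ?g1 i), k := (\<lambda>i. snd S k i * ?h1 i))"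
    unfolding star_reflect_snd gr g2 using nzg k0 by (simp add: fun_eq_iff)
  ultimately show ?thesis
    by (intro prod_eqI ext) auto
qed

text \<open>Cutting off outside the invariant set turns the relations into identities of total functions.\<close>

definition star_act :: "nat \<Rightarrow> ('m::nontriv, 'a) star_state \<Rightarrow> ('m, 'a) star_state" where
  "star_act k S = (if S \<in> star_states then star_reflect k S else S)"

lemma star_act_states: "k \<in> {0, 1, 2, 3} \<Longrightarrow> S \<in> star_states \<Longrightarrow> star_act k S \<in> star_states"
  by (simp add: star_act_def star_reflect_states)

lemma star_act_involution: "k \<in> {0, 1, 2, 3} \<Longrightarrow> star_act k (star_act k S) = S"
  by (simp add: star_act_def star_reflect_states star_reflect_involution)

lemma star_act_commute:
  "k \<in> {1, 2, 3} \<Longrightarrow> l \<in> {1, 2, 3} \<Longrightarrow> k \<noteq> l \<Longrightarrow> star_act k (star_act l S) = star_act l (star_act k S)"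
  using star_reflect_commute[of k l S] by (auto simp: star_act_def star_reflect_states)

lemma star_act_braid:
  "k \<in> {1, 2, 3} \<Longrightarrow> star_act 0 (star_act k (star_act 0 S)) = star_act k (star_act 0 (star_act k S))"
  using star_reflect_braid[of S k] by (auto simp: star_act_def star_reflect_states)

lemma star_act_A2: "((star_act 0 \<circ> star_act 1) ^^ 3) S = S"
  by (rule coxeter_A2) (simp_all add: star_act_involution star_act_braid)

lemma star_act_A3: "((star_act 0 \<circ> star_act 1 \<circ> star_act 2) ^^ 4) S = S"
  by (rule coxeter_A3) (simp_all add: star_act_involution star_act_braid star_act_commute)

lemma star_act_D4: "((star_act 0 \<circ> star_act 1 \<circ> star_act 2 \<circ> star_act 3) ^^ 6) S = S"
  by (rule coxeter_D4) (simp_all add: star_act_involution star_act_braid star_act_commute)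

end

text \<open>
  Accumulated gauge factors in rank 2: \<open>Y\<close> for the centre and \<open>Z\<close> for the leaf, starting from variables
  \<open>a\<close> and \<open>b\<close>, where the leaf acts on the centre with multiplicity \<open>r\<close>. Unfolding replaces the leaf by
  \<open>r\<close> copies of itself.
\<close>

definition pair_center ::
    "nat \<Rightarrow> ('m::nontriv mod_ring \<Rightarrow> 'a::field_char_0)
      \<Rightarrow> ('m mod_ring \<Rightarrow> 'a) \<times> ('m mod_ring \<Rightarrow> 'a) \<Rightarrow> ('m mod_ring \<Rightarrow> 'a) \<times> ('m mod_ring \<Rightarrow> 'a)" where
  "pair_center r a = (\<lambda>(Y, Z). (\<lambda>i. Y i * gauge (\<lambda>i. a i / (Y i * Y (i - 1)) * Z i ^ r) i, Z))"

definition pair_leaf ::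
    "('m::nontriv mod_ring \<Rightarrow> 'a::field_char_0)
      \<Rightarrow> ('m mod_ring \<Rightarrow> 'a) \<times> ('m mod_ring \<Rightarrow> 'a) \<Rightarrow> ('m mod_ring \<Rightarrow> 'a) \<times> ('m mod_ring \<Rightarrow> 'a)" where
  "pair_leaf b = (\<lambda>(Y, Z). (Y, \<lambda>i. Z i * gauge (\<lambda>i. b i / (Z i * Z (i - 1)) * Y (i - 1)) i))"

text \<open>Nodes above \<open>r\<close> are spectators: they carry the variables of a leaf that is
  never reflected. With them all three multiplicities share the state space and the genericity
  condition of type D4.\<close>

definition star_of ::
    "nat \<Rightarrow> ('m::nontriv mod_ring \<Rightarrow> 'a::field_char_0) \<Rightarrow> ('m mod_ring \<Rightarrow> 'a)
      \<Rightarrow> ('m mod_ring \<Rightarrow> 'a) \<times> ('m mod_ring \<Rightarrow> 'a) \<Rightarrow> ('m, 'a) star_state" where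
  "star_of r a b = (\<lambda>(Y, Z).
     (\<lambda>k. if k = 0 then (\<lambda>i. a i / (Y i * Y (i - 1)) * Z i ^ r)
          else if k \<le> r then (\<lambda>i. b i / (Z i * Z (i - 1)) * Y (i - 1))
          else (\<lambda>i. b i * Y (i - 1)),
      \<lambda>k. if k = 0 then Y else if k \<le> r then Z else (\<lambda>_. 1)))"

lemma star_reflect_star_of_center:
  "star_reflect 0 (star_of r a b p) = star_of r a b (pair_center r a p)"
  by (cases p) (auto simp: star_reflect_def star_of_def pair_center_def Let_def fun_eq_iff mult_ac)

text \<open>The copies of the leaf are not adjacent, so reflecting them in turn uses the same gauge
  factor for each; the centre receives it \<open>r\<close> times, whence the power of
  \<open>Z\<close>.\<close>

lemma star_reflect_star_of_leaf:
  "star_reflect 1 (star_of 1 a b p) = star_of 1 a b (pair_leaf b p)"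
  "star_reflect 1 (star_reflect 2 (star_of 2 a b p)) = star_of 2 a b (pair_leaf b p)"
  "star_reflect 1 (star_reflect 2 (star_reflect 3 (star_of 3 a b p))) = star_of 3 a b (pair_leaf b p)"
  by (cases p; auto simp: star_reflect_def star_of_def pair_leaf_def Let_def fun_eq_iff mult_ac
      power2_eq_square power3_eq_cube)+

lemma star_of_eqD: "r > 0 \<Longrightarrow> star_of r a b p = star_of r a b q \<Longrightarrow> p = q"
proof -
  assume r: "r > 0" and eq: "star_of r a b p = star_of r a b q"
  have "snd (star_of r a b p) 0 = fst p" "snd (star_of r a b p) 1 = snd p" for p
    using r by (auto simp: star_of_def split: prod.splits)
  with eq show ?thesis by (metis prod_eqI)
qed

context positive_part
begin

text \<open>\<open>star_of\<close> carries the pair of reflections to the folded word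
  \<open>w\<close> in the star and is injective, so the order of \<open>w\<close> descends.\<close>

lemma pair_order:
  fixes a b :: "'m::nontriv mod_ring \<Rightarrow> 'a"
  assumes P: "\<And>i. a i \<in> P" "\<And>i. b i \<in> P"
    and generic: "\<And>p q. p + q \<noteq> 0 \<Longrightarrow> holonomy a ^ p * holonomy b ^ q \<noteq> 1"
    and rn: "(r, n) \<in> {(1, 3), (2, 4), (3, 6)}"
  shows "((pair_center r a \<circ> pair_leaf b) ^^ n) (\<lambda>_. 1, \<lambda>_. 1) = (\<lambda>_. 1, \<lambda>_. 1)"
proof -
  let ?p = "(\<lambda>_. 1, \<lambda>_. 1) :: ('m mod_ring \<Rightarrow> 'a) \<times> ('m mod_ring \<Rightarrow> 'a)"
  let ?u = "holonomy a" and ?v = "holonomy b"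
  define f where "f = pair_center r a \<circ> pair_leaf b"
  define w :: "('m, 'a) star_state \<Rightarrow> ('m, 'a) star_state" where
    "w = (if r = 1 then star_act 0 \<circ> star_act 1 else if r = 2 then star_act 0 \<circ> star_act 1 \<circ> star_act 2
      else star_act 0 \<circ> star_act 1 \<circ> star_act 2 \<circ> star_act 3)"
  \<comment> \<open>The exponent pairs are the positive roots of D4 after identification of the
    three leaves.\<close>
  have "star_generic (\<lambda>k. if k = 0 then ?u else ?v)"
    using generic[of 1 0] generic[of 0 1] generic[of 1 1] generic[of 1 2] generic[of 1 3] generic[of 2 3]
    by (simp add: star_generic_def eval_nat_numeral mult_ac)
  moreover have "(\<lambda>k. holonomy (fst (star_of r a b ?p) k)) = (\<lambda>k. if k = 0 then ?u else ?v)"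
    by (simp add: star_of_def fun_eq_iff)
  ultimately have start: "star_of r a b ?p \<in> star_states"
    using P by (auto simp: star_states_def star_of_def)
  have w: "w (star_of r a b p) = star_of r a b (f p)
      \<and> w (star_of r a b p) \<in> star_states" if "star_of r a b p \<in> star_states" for p
  proof -
    have "w (star_of r a b p) = star_of r a b (f p)"
    proof -
      have act: "star_act k S = star_reflect k S" "star_reflect k S \<in> star_states"
        if "S \<in> star_states" "k \<in> {0, 1, 2, 3}" for k and S :: "('m, 'a) star_state"
        using that by (simp_all add: star_act_def star_reflect_states del: One_nat_def)
      consider "r = 1" | "r = 2" | "r = 3" using rn by auto
      then show ?thesis
      proof cases
        case 1
        show ?thesis
          using that act(2)[of "star_of 1 a b p" 1] unfolding 1
          by (simp add: w_def 1 act star_reflect_star_of_leaf(1) star_reflect_star_of_center f_def del: One_nat_def)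
      next
        case 2
        show ?thesis
          using that act(2)[of "star_reflect 2 (star_of 2 a b p)" 1] unfolding 2
          by (simp add: w_def 2 act star_reflect_star_of_leaf(2) star_reflect_star_of_center f_def del: One_nat_def)
      next
        case 3
        show ?thesis
          using that act(2)[of "star_reflect 2 (star_reflect 3 (star_of 3 a b p))" 1] unfolding 3
          by (simp add: w_def 3 act star_reflect_star_of_leaf(3) star_reflect_star_of_center f_def del: One_nat_def)
      qed
    qed
    moreover have "w (star_of r a b p) \<in> star_states"
      using that by (auto simp: w_def star_act_states simp del: One_nat_def)
    ultimately show ?thesis by simp
  qed
  have "(w ^^ k) (star_of r a b ?p) = star_of r a b ((f ^^ k) ?p)
      \<and> (w ^^ k) (star_of r a b ?p) \<in> star_states" for k
  proof (induction k)
    case (Suc k)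
    then have "star_of r a b ((f ^^ k) ?p) \<in> star_states"
      by (metis (no_types))
    from w[OF this] Suc show ?case by auto
  qed (simp add: start)
  moreover have "(w ^^ n) S = S" for S
    using rn star_act_A2[of S] star_act_A3[of S] star_act_D4[of S] by (auto simp: w_def)
  ultimately have "star_of r a b ?p = star_of r a b ((f ^^ n) ?p)"
    by metis
  moreover have "r > 0" using rn by auto
  ultimately show ?thesis
    unfolding f_def[symmetric] by (metis (no_types) star_of_eqD)
qed

end

section \<open>Mutating along the cycle\<close>

lemma even_abs_mult_add: "even (\<bar>a\<bar> * b + a * \<bar>b\<bar>)" for a b :: int
  by (cases "a \<ge> 0"; cases "b \<ge> 0") (auto simp: abs_if)

definition path_term :: "int \<Rightarrow> int \<Rightarrow> int" where
  "path_term a b = (\<bar>a\<bar> * b + a * \<bar>b\<bar>) div 2"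

lemma path_term_simps:
  "path_term 0 b = 0" "path_term a 0 = 0"
  "path_term 1 b = max b 0" "path_term (- 1) b = min b 0"
  "path_term (- a) (- b) = - path_term a b"
  by (auto simp: path_term_def abs_if max_def min_def)

lemma path_term_commute: "path_term a b = path_term b a"
  by (simp add: path_term_def mult.commute add.commute)

lemma two_path_term: "2 * path_term a b = \<bar>a\<bar> * b + a * \<bar>b\<bar>"
  unfolding path_term_def using even_abs_mult_add[of a b] by simp

lemma mutate_matrix_path_term:
  "mutate_matrix k \<epsilon> i j = (if k = i \<or> k = j then - \<epsilon> i j else \<epsilon> i j + path_term (\<epsilon> i k) (\<epsilon> k j))"
  by (simp add: mutate_matrix_def path_term_def)

text \<open>This turns facts about rows under iterated mutation into facts about columns: mutation
  of \<open>A\<close> at \<open>k\<close> reads row \<open>k\<close>, mutation of \<open>X\<close>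
  reads column \<open>k\<close>.\<close>

lemma mutate_matrix_neg_transpose:
  "mutate_matrix k (\<lambda>i j. - \<epsilon> j i) = (\<lambda>i j. - mutate_matrix k \<epsilon> j i)"
  by (auto simp: fun_eq_iff mutate_matrix_path_term path_term_simps path_term_commute)

definition skew_symmetrizable :: "('v \<Rightarrow> 'v \<Rightarrow> int) \<Rightarrow> bool" where
  "skew_symmetrizable \<epsilon> \<longleftrightarrow> (\<exists>d :: 'v \<Rightarrow> int. (\<forall>i. d i > 0) \<and> (\<forall>i j. d j * \<epsilon> i j = - (d i * \<epsilon> j i)))"

lemma skew_symmetrizable_diag: "skew_symmetrizable \<epsilon> \<Longrightarrow> \<epsilon> i i = 0"
proof -
  assume "skew_symmetrizable \<epsilon>"
  then obtain d :: "'a \<Rightarrow> int" where "d i > 0" "d i * \<epsilon> i i = - (d i * \<epsilon> i i)"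
    unfolding skew_symmetrizable_def by blast
  then show ?thesis by simp
qed

text \<open>A symmetrizer survives because \<open>path_term\<close> obeys the same symmetry. The
  purpose is the zero diagonal of every mutated matrix, on which involutivity of mutation
  rests.\<close>

lemma skew_symmetrizable_mutate:
  assumes "skew_symmetrizable \<epsilon>"
  shows "skew_symmetrizable (mutate_matrix k \<epsilon>)"
proof -
  obtain d :: "'a \<Rightarrow> int" where pos: "\<And>i. d i > 0" and d: "\<And>i j. d j * \<epsilon> i j = - (d i * \<epsilon> j i)"
    using assms by (auto simp: skew_symmetrizable_def)
  have abs: "d j * \<bar>\<epsilon> i j\<bar> = d i * \<bar>\<epsilon> j i\<bar>" for i j
    using arg_cong[OF d[of j i], of abs] pos[of i] pos[of j] by (simp add: abs_mult)
  have pt: "d j * path_term (\<epsilon> i k) (\<epsilon> k j) = - (d i * path_term (\<epsilon> j k) (\<epsilon> k i))" for i j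
  proof -
    have "2 * (d j * path_term (\<epsilon> i k) (\<epsilon> k j)) = \<bar>\<epsilon> i k\<bar> * (d j * \<epsilon> k j) + \<epsilon> i k * (d j * \<bar>\<epsilon> k j\<bar>)"
      using arg_cong[OF two_path_term[of "\<epsilon> i k" "\<epsilon> k j"], of "\<lambda>z. d j * z"]
      by (simp add: distrib_left mult.left_commute)
    also have "\<dots> = - (d k * \<bar>\<epsilon> i k\<bar>) * \<epsilon> j k + (d k * \<epsilon> i k) * \<bar>\<epsilon> j k\<bar>"
      by (simp only: d[of j k] abs[of j k]) (simp only: mult_ac mult_minus_left mult_minus_right)
    also have "\<dots> = - (d i * \<bar>\<epsilon> k i\<bar>) * \<epsilon> j k - (d i * \<epsilon> k i) * \<bar>\<epsilon> j k\<bar>"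
      by (simp only: d[of k i] abs[of k i] mult_minus_left mult_minus_right diff_conv_add_uminus)
    also have "\<dots> = - (2 * (d i * path_term (\<epsilon> j k) (\<epsilon> k i)))"
      using arg_cong[OF two_path_term[of "\<epsilon> j k" "\<epsilon> k i"], of "\<lambda>z. d i * z"]
      by (simp add: distrib_left mult_ac)
    finally show ?thesis by presburger
  qed
  have "d j * mutate_matrix k \<epsilon> i j = - (d i * mutate_matrix k \<epsilon> j i)" for i j
  proof (cases "k = i \<or> k = j")
    case True
    then show ?thesis
      using d[of j i] by (auto simp: mutate_matrix_path_term)
  next
    case False
    then have "d j * mutate_matrix k \<epsilon> i j = d j * \<epsilon> i j + d j * path_term (\<epsilon> i k) (\<epsilon> k j)"
      by (simp add: mutate_matrix_path_term distrib_left)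
    also have "\<dots> = - (d i * \<epsilon> j i) - d i * path_term (\<epsilon> j k) (\<epsilon> k i)"
      by (simp only: d[of j i] pt[of j i])
    finally show ?thesis
      using False by (simp add: mutate_matrix_path_term distrib_left)
  qed
  with pos show ?thesis
    unfolding skew_symmetrizable_def by blast
qed

text \<open>Opposite rows and columns leave no arrow between \<open>p\<close> and \<open>q\<close>.
  The path terms through \<open>p\<close> and \<open>q\<close> cancel elsewhere, and the
  transposition undoes the sign changes in their rows and columns.\<close>

lemma mutate_opposite_pair:
  assumes "p \<noteq> q" "\<epsilon> p p = 0" "\<And>w. \<epsilon> q w = - \<epsilon> p w" "\<And>w. \<epsilon> w q = - \<epsilon> w p"
  shows "mutate_matrix q (mutate_matrix p \<epsilon>) (Transposition.transpose p q i) (Transposition.transpose p q j) = \<epsilon> i j"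
proof -
  have "\<epsilon> p q = 0" "\<epsilon> q p = 0" "\<epsilon> q q = 0" using assms by simp_all
  then show ?thesis
    using assms
    by (cases "i = p"; cases "i = q"; cases "j = p"; cases "j = q")
      (simp_all add: mutate_matrix_path_term path_term_simps)
qed

text \<open>
  The cycle is \<open>v 0, ..., v (K + 1)\<close>, and \<open>b j\<close> is the part outside the cycle of the exponent vector
  \<open>cexp j\<close> of the \<open>j\<close>-th summand of \<open>f\<^sub>A\<close>. Row \<open>v j\<close> of the exchange matrix is \<open>cexp (j - 1) - cexp j\<close>.
  After mutation at \<open>v 0, ..., v (k - 1)\<close> the cycle \<open>v k, ..., v (K + 1)\<close> remains, and the summands with
  indices \<open>K + 1, 0, ..., k - 1\<close> are merged into a single one with exponent vector \<open>hexp k\<close>. Columns are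
  treated as rows of the negated transposed matrix.
\<close>

locale cyclic_vertices =
  fixes v :: "nat \<Rightarrow> 'v::finite" and K :: nat and b :: "nat \<Rightarrow> 'v \<Rightarrow> int"
  assumes inj: "inj_on v {..Suc K}"
    and nonneg: "b j w \<ge> 0"
    and circle: "j \<le> Suc K \<Longrightarrow> l \<le> Suc K \<Longrightarrow> b j (v l) = 0"
    and disjoint: "j \<le> Suc K \<Longrightarrow> l \<le> Suc K \<Longrightarrow> j \<noteq> l \<Longrightarrow> b j w = 0 \<or> b l w = 0"
begin

lemma v_eq: "j \<le> Suc K \<Longrightarrow> l \<le> Suc K \<Longrightarrow> v j = v l \<longleftrightarrow> j = l"
  using inj by (auto simp: inj_on_def)

definition delta :: "nat \<Rightarrow> 'v \<Rightarrow> int" where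
  "delta j w = (if w = v j then 1 else 0)"

definition cexp :: "nat \<Rightarrow> 'v \<Rightarrow> int" where
  "cexp j w = b j w - delta j w - delta (Suc j) w"

text \<open>At \<open>k = 0\<close> this is the summand between \<open>v (Suc K)\<close> and
  \<open>v 0\<close>; it differs from \<open>cexp (Suc K)\<close> because \<open>v\<close> is not
  assumed periodic. For \<open>k = Suc l\<close> the mutated variable at \<open>v l\<close> stands
  in for the merged summands.\<close>

definition hexp :: "nat \<Rightarrow> 'v \<Rightarrow> int" where
  "hexp k w = (case k of 0 \<Rightarrow> b (Suc K) w | Suc l \<Rightarrow> delta l w) - delta (Suc K) w - delta k w"

definition rows :: "nat \<Rightarrow> ('v \<Rightarrow> 'v \<Rightarrow> int) \<Rightarrow> bool" where
  "rows k \<epsilon> \<longleftrightarrow> (\<forall>w. \<epsilon> (v k) w = hexp k w - cexp k w)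
     \<and> (\<forall>j w. k \<le> j \<and> j < K \<longrightarrow> \<epsilon> (v (Suc j)) w = cexp j w - cexp (Suc j) w)
     \<and> (\<forall>w. \<epsilon> (v (Suc K)) w = cexp K w - hexp k w)"

lemma delta_v: "j \<le> Suc K \<Longrightarrow> l \<le> Suc K \<Longrightarrow> delta j (v l) = (if j = l then 1 else 0)"
  by (auto simp: delta_def v_eq)

lemma cexp_v: "j \<le> K \<Longrightarrow> l \<le> Suc K \<Longrightarrow> cexp j (v l) = (if l = j \<or> l = Suc j then - 1 else 0)"
  by (auto simp: cexp_def delta_v circle)

lemma hexp_v: "k \<le> K \<Longrightarrow> l \<le> Suc K \<Longrightarrow>
    hexp k (v l) = (if Suc l = k then 1 else if l = k \<or> l = Suc K then - 1 else 0)"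
  by (cases k) (auto simp: hexp_def delta_v circle)

text \<open>The tropical content of the binomial with exponents \<open>hexp k\<close> and
  \<open>cexp k\<close>: outside the cycle its two terms involve different variables, so only
  denominators on the cycle remain.\<close>

lemma min_hexp_cexp:
  assumes "k \<le> K"
  shows "min (hexp k w) (cexp k w) = - (if w \<in> {v k, v (Suc k), v (Suc K)} then 1 else 0)"
proof (cases "w \<in> v ` {..Suc K}")
  case True
  then obtain l where "l \<le> Suc K" "w = v l" by auto
  then show ?thesis
    using assms by (auto simp: hexp_v cexp_v v_eq)
next
  case False
  then have w: "w \<noteq> v l" if "l \<le> Suc K" for l using that by auto
  have h: "hexp k w = (if k = 0 then b (Suc K) w else 0)"
    using assms w by (cases k) (auto simp: hexp_def delta_def)
  have c: "cexp k w = b k w"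
    using assms w by (auto simp: cexp_def delta_def)
  have "w \<notin> {v k, v (Suc k), v (Suc K)}"
    using w assms by auto
  moreover have "min (hexp k w) (cexp k w) = 0"
    using assms nonneg[of k w] nonneg[of "Suc K" w] disjoint[of k "Suc K" w] unfolding h c by auto
  ultimately show ?thesis by simp
qed

lemma hexp_Suc:
  assumes "k < K"
  shows "hexp (Suc k) w = (if w = v k then 2 else 0) + min (hexp k w) (cexp k w)"
proof -
  have "v k \<noteq> v (Suc k)" "v k \<noteq> v (Suc K)" "v (Suc k) \<noteq> v (Suc K)"
    using assms by (simp_all add: v_eq)
  moreover have "min (hexp k w) (cexp k w) = - (if w \<in> {v k, v (Suc k), v (Suc K)} then 1 else 0)"
    using assms by (intro min_hexp_cexp) simp
  ultimately show ?thesis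
    by (simp add: hexp_def delta_def)
qed

text \<open>Within the remaining cycle only the rows of \<open>v (Suc k)\<close> and
  \<open>v (Suc K)\<close> meet \<open>v k\<close>, with entries -1 and 1. Mutation adds to them the
  negative and the positive part of row \<open>k\<close>, which replaces \<open>cexp k\<close> in
  the first and \<open>hexp k\<close> in the second by the minimum of both.\<close>

lemma rows_mutate:
  assumes k: "k < K" and r: "rows k \<epsilon>"
  shows "rows (Suc k) (mutate_matrix (v k) \<epsilon>)"
proof -
  have row_k: "\<epsilon> (v k) w = hexp k w - cexp k w"
    and row_j: "k \<le> j \<Longrightarrow> j < K \<Longrightarrow> \<epsilon> (v (Suc j)) w = cexp j w - cexp (Suc j) w"
    and row_last: "\<epsilon> (v (Suc K)) w = cexp K w - hexp k w" for j w
    using r by (auto simp: rows_def)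
  have ne: "v k \<noteq> v (Suc k)" "v k \<noteq> v (Suc K)"
    using k by (auto simp: v_eq)
  have "mutate_matrix (v k) \<epsilon> (v (Suc k)) w = hexp (Suc k) w - cexp (Suc k) w" for w
  proof (cases "w = v k")
    case True
    then show ?thesis
      using k ne by (simp add: mutate_matrix_path_term row_j cexp_v hexp_v)
  next
    case False
    have "\<epsilon> (v (Suc k)) (v k) = - 1"
      using k by (simp add: row_j cexp_v)
    then show ?thesis
      using k ne False by (simp add: mutate_matrix_path_term row_j path_term_simps row_k hexp_Suc)
  qed
  moreover have "mutate_matrix (v k) \<epsilon> (v (Suc K)) w = cexp K w - hexp (Suc k) w" for w
  proof (cases "w = v k")
    case True
    then show ?thesis
      using k ne by (simp add: mutate_matrix_path_term row_last cexp_v hexp_v)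
  next
    case False
    have "\<epsilon> (v (Suc K)) (v k) = 1"
      using k by (simp add: row_last cexp_v hexp_v)
    then show ?thesis
      using k ne False by (simp add: mutate_matrix_path_term row_last path_term_simps row_k hexp_Suc)
  qed
  moreover have "mutate_matrix (v k) \<epsilon> (v (Suc j)) w = cexp j w - cexp (Suc j) w"
    if "Suc k \<le> j" "j < K" for j w
  proof -
    have "\<epsilon> (v (Suc j)) (v k) = 0" "v k \<noteq> v (Suc j)"
      using that by (auto simp: row_j cexp_v v_eq)
    then show ?thesis
      using that by (auto simp: mutate_matrix_path_term row_j path_term_simps cexp_v)
  qed
  ultimately show ?thesis
    by (simp add: rows_def)
qed

primrec exch_seq :: "('v \<Rightarrow> 'v \<Rightarrow> int) \<Rightarrow> nat \<Rightarrow> 'v \<Rightarrow> 'v \<Rightarrow> int" where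
  "exch_seq \<epsilon> 0 = \<epsilon>"
| "exch_seq \<epsilon> (Suc k) = mutate_matrix (v k) (exch_seq \<epsilon> k)"

lemma rows_exch_seq: "rows 0 \<epsilon> \<Longrightarrow> k \<le> K \<Longrightarrow> rows k (exch_seq \<epsilon> k)"
  by (induction k) (auto intro: rows_mutate)

end

section \<open>Monomials with integer exponents and the exchange relation\<close>

definition monomial :: "('v::finite \<Rightarrow> 'g::field_char_0) \<Rightarrow> ('v \<Rightarrow> int) \<Rightarrow> 'g" where
  "monomial A e = (\<Prod>w\<in>UNIV. A w powi e w)"

lemma monomial_add: "(\<And>w. A w \<noteq> 0) \<Longrightarrow> monomial A (\<lambda>w. x w + y w) = monomial A x * monomial A y"
  by (simp add: monomial_def power_int_add prod.distrib)

lemma monomial_diff: "(\<And>w. A w \<noteq> 0) \<Longrightarrow> monomial A (\<lambda>w. x w - y w) = monomial A x / monomial A y"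
  by (simp add: monomial_def power_int_diff prod_dividef)

lemma monomial_mult: "monomial (\<lambda>w. A w * B w) e = monomial A e * monomial B e"
  by (simp add: monomial_def power_int_mult_distrib prod.distrib)

lemma monomial_indicator:
  assumes "finite T"
  shows "monomial A (\<lambda>w. if w \<in> T then 1 else 0) = (\<Prod>w\<in>T. A w)"
proof -
  have "monomial A (\<lambda>w. if w \<in> T then 1 else 0) = (\<Prod>w\<in>UNIV. if w \<in> T then A w else 1)"
    unfolding monomial_def by (rule prod.cong) auto
  then show ?thesis
    by (simp add: prod.If_cases)
qed

lemma monomial_cong:
  assumes "\<And>w. e w \<noteq> 0 \<Longrightarrow> A w = B w"
  shows "monomial A e = monomial B e"
  unfolding monomial_def
proof (rule prod.cong)
  show "A w powi e w = B w powi e w" for w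
    using assms[of w] by (cases "e w = 0") simp_all
qed simp

text \<open>The monomial of \<open>t\<close> is the common denominator of the two monomials, so
  \<open>x + t\<close> and \<open>y + t\<close> are the positive and negative parts of the
  row.\<close>

lemma mutate_A_split:
  fixes A :: "'v::finite \<Rightarrow> 'g::field_char_0"
  assumes nz: "\<And>w. A w \<noteq> 0"
    and row: "\<And>w. \<epsilon> k w = x w - y w"
    and min: "\<And>w. min (x w) (y w) = - t w"
  shows "mutate_A k \<epsilon> A k = inverse (A k) * monomial A t * (monomial A x + monomial A y)"
proof -
  have pos: "0 < \<epsilon> k w \<Longrightarrow> \<epsilon> k w = t w + x w" "\<not> 0 < \<epsilon> k w \<Longrightarrow> t w + x w = 0"
    and neg: "\<epsilon> k w < 0 \<Longrightarrow> - \<epsilon> k w = t w + y w" "\<not> \<epsilon> k w < 0 \<Longrightarrow> t w + y w = 0" for w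
    using min[of w] row[of w] by (auto simp: min_def split: if_splits)
  have "(\<Prod>j | \<epsilon> k j > 0. A j powi \<epsilon> k j) = monomial A (\<lambda>w. t w + x w)"
    unfolding monomial_def
  proof (rule prod.mono_neutral_cong_left)
    show "\<forall>w\<in>UNIV - {j. \<epsilon> k j > 0}. A w powi (t w + x w) = 1"
      by (simp add: pos(2))
    show "A w powi \<epsilon> k w = A w powi (t w + x w)" if "w \<in> {j. \<epsilon> k j > 0}" for w
      using that by (subst pos(1)) auto
  qed auto
  moreover have "(\<Prod>j | \<epsilon> k j < 0. A j powi - \<epsilon> k j) = monomial A (\<lambda>w. t w + y w)"
    unfolding monomial_def
  proof (rule prod.mono_neutral_cong_left)
    show "\<forall>w\<in>UNIV - {j. \<epsilon> k j < 0}. A w powi (t w + y w) = 1"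
      by (simp add: neg(2))
    show "A w powi - \<epsilon> k w = A w powi (t w + y w)" if "w \<in> {j. \<epsilon> k j < 0}" for w
      using that by (subst neg(1)) auto
  qed auto
  ultimately show ?thesis
    by (simp add: mutate_A_def monomial_add[OF nz] algebra_simps)
qed

lemma mutate_A_cong:
  assumes "\<And>w. \<epsilon> k w = \<epsilon>' k w" "A k = B k" "\<And>w. \<epsilon> k w \<noteq> 0 \<Longrightarrow> A w = B w"
  shows "mutate_A k \<epsilon> A k = mutate_A k \<epsilon>' B k"
proof -
  have "(\<Prod>j | \<epsilon>' k j > 0. A j powi \<epsilon>' k j) = (\<Prod>j | \<epsilon>' k j > 0. B j powi \<epsilon>' k j)"
    "(\<Prod>j | \<epsilon>' k j < 0. A j powi - \<epsilon>' k j) = (\<Prod>j | \<epsilon>' k j < 0. B j powi - \<epsilon>' k j)"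
    using assms(1,3) by (auto intro!: prod.cong)
  then show ?thesis
    by (simp add: mutate_A_def assms)
qed

context cyclic_vertices
begin

primrec A_seq :: "('v \<Rightarrow> 'v \<Rightarrow> int) \<Rightarrow> ('v \<Rightarrow> 'g::field_char_0) \<Rightarrow> nat \<Rightarrow> 'v \<Rightarrow> 'g" where
  "A_seq \<epsilon> A 0 = A"
| "A_seq \<epsilon> A (Suc k) = mutate_A (v k) (exch_seq \<epsilon> k) (A_seq \<epsilon> A k)"

text \<open>The partial sum of \<open>f\<^sub>A\<close> that starts with the summand of index \<open>K + 1\<close>, which is \<open>hexp 0\<close>.\<close>

definition csum :: "('v \<Rightarrow> 'g::field_char_0) \<Rightarrow> nat \<Rightarrow> 'g" where
  "csum A k = monomial A (hexp 0) + (\<Sum>l<k. monomial A (cexp l))"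

lemma monomial_delta: "monomial A (delta j) = A (v j)"
  using monomial_indicator[of "{v j}" A] by (simp add: delta_def[abs_def])

lemma A_seq_outside: "w \<notin> v ` {..<k} \<Longrightarrow> A_seq \<epsilon> A k w = A w"
  by (induction k) (auto simp: mutate_A_def lessThan_Suc)

lemma csum_P:
  assumes "positive_part P" "\<And>w. A w \<in> P"
  shows "csum A k \<in> P"
proof -
  interpret positive_part P by fact
  have m: "monomial A e \<in> P" for e
    unfolding monomial_def by (intro prod powi assms)
  show ?thesis
    by (cases "k = 0") (auto simp: csum_def m intro!: add sum)
qed

text \<open>For \<open>k \<le> K\<close> the negated minimum of \<open>hexp k\<close> and
  \<open>cexp k\<close>. At \<open>k = K\<close> two of the three vertices coincide, so the last
  step has its own evaluation.\<close>

definition corner :: "nat \<Rightarrow> 'v \<Rightarrow> int" where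
  "corner k w = (if w \<in> {v k, v (Suc k), v (Suc K)} then 1 else 0)"

lemma monomial_corner:
  assumes "k < K"
  shows "monomial A (corner k) = A (v k) * A (v (Suc k)) * A (v (Suc K))"
  using assms unfolding corner_def by (subst monomial_indicator) (auto simp: v_eq mult_ac)

lemma monomial_corner_last: "monomial A (corner K) = A (v K) * A (v (Suc K))"
  unfolding corner_def by (subst monomial_indicator) (auto simp: v_eq mult_ac)

lemma A_seq_Suc_v: "A_seq \<epsilon> A (Suc k) w = (if w = v k then A_seq \<epsilon> A (Suc k) (v k) else A_seq \<epsilon> A k w)"
  by (simp add: mutate_A_def)

text \<open>Mutation at \<open>v k\<close> adds the next summand of \<open>f_A\<close>: the new
  variable is the enlarged partial sum times two cycle variables, and these are exactly the
  denominators in \<open>hexp (Suc k)\<close>.\<close>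

lemma A_seq_invariant:
  fixes A :: "'v \<Rightarrow> 'g::field_char_0"
  assumes P: "positive_part P" "\<And>w. A w \<in> P" and r: "rows 0 \<epsilon>" and "k \<le> K"
  shows "(\<forall>j<k. A_seq \<epsilon> A k (v j) = A (v (Suc K)) * A (v (Suc j)) * csum A (Suc j))
    \<and> (\<forall>w. A_seq \<epsilon> A k w \<in> P)
    \<and> monomial (A_seq \<epsilon> A k) (hexp k) = csum A k"
  using \<open>k \<le> K\<close>
proof (induction k)
  case 0
  then show ?case by (simp add: csum_def P)
next
  case (Suc k)
  interpret positive_part P by fact
  let ?B = "A_seq \<epsilon> A k"
  have IH: "\<And>j. j < k \<Longrightarrow> ?B (v j) = A (v (Suc K)) * A (v (Suc j)) * csum A (Suc j)"
    "\<And>w. ?B w \<in> P" "monomial ?B (hexp k) = csum A k"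
    using Suc by auto
  have k: "k < K" using Suc by simp
  have same: "?B (v l) = A (v l)" if "k \<le> l" "l \<le> Suc K" for l
    using that k by (intro A_seq_outside) (auto simp: v_eq)
  have ck: "monomial ?B (cexp k) = monomial A (cexp k)"
  proof (rule monomial_cong)
    fix w assume "cexp k w \<noteq> 0"
    moreover have "cexp k (v l) = 0" if "l < k" for l
      using that k by (simp add: cexp_v)
    ultimately show "?B w = A w"
      by (intro A_seq_outside) auto
  qed
  note csum_P = csum_P[OF P]
  have "rows k (exch_seq \<epsilon> k)"
    using r k by (intro rows_exch_seq) auto
  then have row: "exch_seq \<epsilon> k (v k) w = hexp k w - cexp k w" for w
    by (simp add: rows_def)
  have "A_seq \<epsilon> A (Suc k) (v k)
      = inverse (?B (v k)) * monomial ?B (corner k) * (monomial ?B (hexp k) + monomial ?B (cexp k))"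
    unfolding A_seq.simps
  proof (rule mutate_A_split)
    show "?B w \<noteq> 0" for w by (rule nz[OF IH(2)])
    show "min (hexp k w) (cexp k w) = - corner k w" for w
      using k by (simp only: corner_def) (rule min_hexp_cexp, simp)
  qed (rule row)
  also have "\<dots> = A (v (Suc k)) * A (v (Suc K)) * csum A (Suc k)"
    using nz[OF P(2)] k by (simp add: monomial_corner same IH(3) ck csum_def field_simps)
  finally have new: "A_seq \<epsilon> A (Suc k) (v k) = A (v (Suc K)) * A (v (Suc k)) * csum A (Suc k)"
    by (simp add: mult_ac)
  have val: "A_seq \<epsilon> A (Suc k) w = (if w = v k then A (v (Suc K)) * A (v (Suc k)) * csum A (Suc k) else ?B w)" for w
    by (subst A_seq_Suc_v) (simp only: new)
  have inP: "A_seq \<epsilon> A (Suc k) w \<in> P" for w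
    unfolding val using IH(2) P(2) csum_P by auto
  have "monomial (A_seq \<epsilon> A (Suc k)) (hexp (Suc k))
      = A_seq \<epsilon> A (Suc k) (v k) / A_seq \<epsilon> A (Suc k) (v (Suc K)) / A_seq \<epsilon> A (Suc k) (v (Suc k))"
  proof -
    have "hexp (Suc k) = (\<lambda>w. (delta k w - delta (Suc K) w) - delta (Suc k) w)"
      by (simp add: hexp_def fun_eq_iff)
    then show ?thesis
      by (simp only: monomial_diff[of "A_seq \<epsilon> A (Suc k)", OF nz[OF inP]] monomial_delta)
  qed
  also have "\<dots> = csum A (Suc k)"
    using k nz[OF P(2)] unfolding val by (simp add: v_eq same)
  finally have m: "monomial (A_seq \<epsilon> A (Suc k)) (hexp (Suc k)) = csum A (Suc k)" .
  have "A_seq \<epsilon> A (Suc k) (v j) = A (v (Suc K)) * A (v (Suc j)) * csum A (Suc j)" if "j < Suc k" for j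
    using that k IH(1)[of j] unfolding val by (auto simp: v_eq less_Suc_eq)
  then show ?case using m inP by blast
qed

definition A_mid :: "('v \<Rightarrow> 'v \<Rightarrow> int) \<Rightarrow> ('v \<Rightarrow> 'g::field_char_0) \<Rightarrow> 'v \<Rightarrow> 'g" where
  "A_mid \<epsilon> A = mutate_A (v (Suc K)) (mutate_matrix (v K) (exch_seq \<epsilon> K))
     (mutate_A (v K) (exch_seq \<epsilon> K) (A_seq \<epsilon> A K))"

lemma rows_last:
  assumes "rows K \<epsilon>"
  shows "\<epsilon> (v (Suc K)) w = - \<epsilon> (v K) w" "\<epsilon> (v K) (v K) = 0" "\<epsilon> (v K) (v (Suc K)) = 0"
    "\<epsilon> (v (Suc K)) (v K) = 0"
  using assms by (simp_all add: rows_def hexp_v cexp_v)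

text \<open>The last two vertices have opposite rows and no arrow between them, so neither mutation
  affects the other. Both exchange binomials complete the full sum, while the old variables trade
  places.\<close>

lemma A_mid_eq:
  fixes A :: "'v \<Rightarrow> 'g::field_char_0"
  assumes P: "positive_part P" "\<And>w. A w \<in> P" and r: "rows 0 \<epsilon>"
  shows "A_mid \<epsilon> A w = (if w = v K then A (v (Suc K)) * csum A (Suc K)
     else if w = v (Suc K) then A (v K) * csum A (Suc K) else A_seq \<epsilon> A K w)"
proof -
  interpret positive_part P by fact
  let ?B = "A_seq \<epsilon> A K" and ?e = "exch_seq \<epsilon> K"
  have BP: "?B w \<in> P" for w
    using A_seq_invariant[OF P r, of K] by simp
  have h: "monomial ?B (hexp K) = csum A K"
    using A_seq_invariant[OF P r, of K] by simp
  have same: "?B (v K) = A (v K)" "?B (v (Suc K)) = A (v (Suc K))"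
    by (rule A_seq_outside; auto simp: v_eq)+
  have c: "monomial ?B (cexp K) = monomial A (cexp K)"
  proof (rule monomial_cong)
    fix w assume "cexp K w \<noteq> 0"
    moreover have "cexp K (v l) = 0" if "l < K" for l
      using that by (simp add: cexp_v)
    ultimately show "?B w = A w"
      by (intro A_seq_outside) auto
  qed
  have rK: "rows K ?e"
    using r by (intro rows_exch_seq) auto
  have min: "min (hexp K w) (cexp K w) = - corner K w" for w
    by (simp only: corner_def) (rule min_hexp_cexp, simp)
  have p: "mutate_A (v K) ?e ?B (v K)
      = inverse (?B (v K)) * monomial ?B (corner K) * (monomial ?B (hexp K) + monomial ?B (cexp K))"
    by (rule mutate_A_split[OF nz[OF BP] _ min]) (use rK in \<open>simp add: rows_def\<close>)
  have q: "mutate_A (v (Suc K)) ?e ?B (v (Suc K))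
      = inverse (?B (v (Suc K))) * monomial ?B (corner K) * (monomial ?B (cexp K) + monomial ?B (hexp K))"
    by (rule mutate_A_split[OF nz[OF BP]]) (use rK min in \<open>simp_all add: rows_def min.commute\<close>)
  have ne: "v K \<noteq> v (Suc K)" by (simp add: v_eq)
  have q': "A_mid \<epsilon> A (v (Suc K)) = mutate_A (v (Suc K)) ?e ?B (v (Suc K))"
    unfolding A_mid_def
  proof (rule mutate_A_cong)
    show "mutate_matrix (v K) ?e (v (Suc K)) w = ?e (v (Suc K)) w" for w
      using ne rows_last(3,4)[OF rK] by (auto simp: mutate_matrix_path_term path_term_simps)
  next
    fix w assume "mutate_matrix (v K) ?e (v (Suc K)) w \<noteq> 0"
    then have "w \<noteq> v K"
      using ne rows_last(3,4)[OF rK] by (auto simp: mutate_matrix_path_term path_term_simps)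
    then show "mutate_A (v K) ?e ?B w = ?B w"
      by (simp add: mutate_A_def)
  qed (use ne in \<open>auto simp: mutate_A_def\<close>)
  have p': "A_mid \<epsilon> A (v K) = mutate_A (v K) ?e ?B (v K)"
    using ne by (simp add: A_mid_def mutate_A_def)
  have o: "w \<noteq> v K \<Longrightarrow> w \<noteq> v (Suc K) \<Longrightarrow> A_mid \<epsilon> A w = ?B w" for w
    by (simp add: A_mid_def mutate_A_def)
  have cancel: "inverse x * (x * y) * z = y * z" "inverse y * (x * y) * z = x * z"
    if "x \<noteq> 0" "y \<noteq> 0" for x y z :: 'g
    using that by (simp_all add: field_simps)
  have "A_mid \<epsilon> A (v K) = A (v (Suc K)) * csum A (Suc K)"
    unfolding p' p monomial_corner_last same c h cancel[OF nz[OF P(2)] nz[OF P(2)]]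
    by (simp add: csum_def add.commute add.left_commute)
  moreover have "A_mid \<epsilon> A (v (Suc K)) = A (v K) * csum A (Suc K)"
    unfolding q' q monomial_corner_last same c h cancel[OF nz[OF P(2)] nz[OF P(2)]]
    by (simp add: csum_def add.commute add.left_commute)
  ultimately show ?thesis
    using o[of w] by simp
qed

text \<open>Every summand has two cycle variables, both in its denominator, so scaling the cycle by
  \<open>F\<close> divides each partial sum by \<open>F * F\<close>. The mutated variables are
  partial sums times two cycle variables and hence do not change.\<close>

lemma A_mid_scaled:
  fixes A :: "'v \<Rightarrow> 'g::field_char_0"
  assumes P: "positive_part P" "\<And>w. A w \<in> P" and r: "rows 0 \<epsilon>"
  defines "F \<equiv> csum A (Suc K)"
  defines "A' \<equiv> (\<lambda>w. A w * (if w \<in> v ` {..Suc K} then F else 1))"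
  shows "A_mid \<epsilon> A (Transposition.transpose (v K) (v (Suc K)) w) = A_seq \<epsilon> A' K w"
proof -
  interpret positive_part P by fact
  have FP: "F \<in> P"
    unfolding F_def by (rule csum_P[OF P])
  have A'P: "A' w \<in> P" for w
    using FP P(2) by (simp add: A'_def)
  let ?z = "\<lambda>w. if w \<in> v ` {..Suc K} then F else 1"
  have z: "?z w \<noteq> 0" for w using nz[OF FP] by simp
  have zb: "monomial ?z (b j) = 1" if "j \<le> Suc K" for j
  proof -
    have "monomial ?z (b j) = monomial (\<lambda>_. 1) (b j)"
      using that by (intro monomial_cong) (auto simp: circle)
    then show ?thesis by (simp add: monomial_def)
  qed
  have zd: "monomial ?z (delta j) = F" if "j \<le> Suc K" for j
    using that by (simp add: monomial_delta)
  have mc: "monomial A' (cexp l) = monomial A (cexp l) / (F * F)" if "l \<le> K" for l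
  proof -
    have "cexp l = (\<lambda>w. (b l w - delta l w) - delta (Suc l) w)"
      by (simp add: cexp_def fun_eq_iff)
    then have "monomial ?z (cexp l) = 1 / F / F"
      using that by (simp only: monomial_diff[OF z] zb zd le_SucI Suc_le_mono)
    then show ?thesis
      unfolding A'_def monomial_mult by simp
  qed
  have mh: "monomial A' (hexp 0) = monomial A (hexp 0) / (F * F)"
  proof -
    have "hexp 0 = (\<lambda>w. (b (Suc K) w - delta (Suc K) w) - delta 0 w)"
      by (simp add: hexp_def fun_eq_iff)
    then have "monomial ?z (hexp 0) = 1 / F / F"
      by (simp only: monomial_diff[OF z] zb zd le_refl le0)
    then show ?thesis
      unfolding A'_def monomial_mult by simp
  qed
  have cs: "csum A' j = csum A j / (F * F)" if "j \<le> Suc K" for j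
    using that by (simp add: csum_def mh mc add_divide_distrib sum_divide_distrib)
  have s: "A_seq \<epsilon> A K (v j) = A_seq \<epsilon> A' K (v j)" if "j < K" for j
  proof -
    have "A' (v (Suc K)) = A (v (Suc K)) * F" "A' (v (Suc j)) = A (v (Suc j)) * F"
      using that by (auto simp: A'_def)
    then show ?thesis
      using that A_seq_invariant[OF P r, of K] A_seq_invariant[OF P(1) A'P r, of K] cs[of "Suc j"] nz[OF FP]
      by simp
  qed
  have last: "A_seq \<epsilon> A' K (v K) = A (v K) * F" "A_seq \<epsilon> A' K (v (Suc K)) = A (v (Suc K)) * F"
    by (subst A_seq_outside; auto simp: v_eq A'_def)+
  have o: "A_seq \<epsilon> A' K w = A_seq \<epsilon> A K w" if "w \<notin> v ` {..Suc K}"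
  proof -
    have "w \<notin> v ` {..<K}" using that by auto
    then show ?thesis
      using that by (simp add: A_seq_outside A'_def)
  qed
  have ne: "v K \<noteq> v (Suc K)" by (simp add: v_eq)
  consider "w = v K" | "w = v (Suc K)" | j where "j < K" "w = v j"
    | "w \<noteq> v K" "w \<noteq> v (Suc K)" "w \<notin> v ` {..<K}"
    by auto
  then show ?thesis
  proof cases
    case 1
    then show ?thesis
      using ne by (simp add: A_mid_eq[OF P r] last F_def)
  next
    case 2
    then show ?thesis
      using ne by (simp add: A_mid_eq[OF P r] last F_def)
  next
    case 3
    then have "w \<noteq> v K" "w \<noteq> v (Suc K)" by (auto simp: v_eq)
    then have "A_mid \<epsilon> A (Transposition.transpose (v K) (v (Suc K)) w) = A_seq \<epsilon> A K w"
      by (simp add: A_mid_eq[OF P r])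
    then show ?thesis
      using s[OF 3(1)] 3(2) by simp
  next
    case 4
    have "{..Suc K} = insert (Suc K) (insert K {..<K})" by auto
    with 4 have out: "w \<notin> v ` {..Suc K}" by simp
    from 4 have "A_mid \<epsilon> A (Transposition.transpose (v K) (v (Suc K)) w) = A_seq \<epsilon> A K w"
      by (simp add: A_mid_eq[OF P r])
    then show ?thesis
      using o[OF out] by simp
  qed
qed

end

section \<open>The \<open>X\<close>-variables along the cycle\<close>

text \<open>Splitting the entry into its positive part \<open>x\<close> and negative part
  \<open>y\<close> avoids a case distinction by sign in the mutation rule.\<close>

lemma mutate_X_factor:
  fixes Y :: "'f::field_char_0"
  assumes "Y \<noteq> 0" "1 + Y \<noteq> 0" "e = x - y" "x \<ge> 0" "y \<ge> 0" "x = 0 \<or> y = 0"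
  shows "(1 + Y powi (- sgn e)) powi (- e) = (Y / (1 + Y)) powi x * (1 + Y) powi y"
proof -
  consider "x = 0" "y = 0" | "x = 0" "y > 0" | "y = 0" "x > 0"
    using assms by fastforce
  then show ?thesis
  proof cases
    case 3
    have "1 + inverse Y = inverse (Y / (1 + Y))"
      using assms(1,2) by (simp add: field_simps)
    then show ?thesis
      using 3 assms(3) by (simp add: power_int_minus flip: power_int_inverse)
  qed (simp_all add: assms(3))
qed

context cyclic_vertices
begin

text \<open>With \<open>yplus\<close>, the positive and negative parts of the column entry
  \<open>cexp k w - hexp k w\<close>.\<close>

definition xplus :: "nat \<Rightarrow> 'v \<Rightarrow> int" where "xplus k w = cexp k w + corner k w"
definition yplus :: "nat \<Rightarrow> 'v \<Rightarrow> int" where "yplus k w = hexp k w + corner k w"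

lemma plus_nonneg:
  assumes "k \<le> K"
  shows "xplus k w \<ge> 0" "yplus k w \<ge> 0" "xplus k w = 0 \<or> yplus k w = 0"
  using min_hexp_cexp[OF assms, of w] unfolding xplus_def yplus_def corner_def
  by (auto simp: min_def split: if_splits)

lemma plus_v:
  assumes "k \<le> K" "l \<le> Suc K"
  shows "xplus k (v l) = (if k < K \<and> l = Suc K then 1 else 0)"
    and "yplus k (v l) = (if Suc l = k \<or> k < K \<and> l = Suc k then 1 else 0)"
  using assms by (auto simp: xplus_def yplus_def corner_def cexp_v hexp_v v_eq)

lemma plus_outside:
  assumes "k \<le> K" "w \<notin> v ` {..Suc K}"
  shows "xplus k w = b k w" "yplus k w = (if k = 0 then b (Suc K) w else 0)"
proof -
  have w: "w \<noteq> v l" if "l \<le> Suc K" for l using that assms by auto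
  then have "w \<noteq> v k" "w \<noteq> v (Suc k)" "w \<noteq> v (Suc K)" using assms by auto
  then show "xplus k w = b k w" "yplus k w = (if k = 0 then b (Suc K) w else 0)"
    using w assms(1) by (cases k; auto simp: xplus_def yplus_def corner_def cexp_def hexp_def delta_def)+
qed

lemma mutate_X_split:
  assumes k: "k \<le> K" and col: "\<epsilon> w (v k) = cexp k w - hexp k w" and w: "w \<noteq> v k"
    and Y: "X (v k) \<noteq> 0" "1 + X (v k) \<noteq> 0"
  shows "mutate_X (v k) \<epsilon> X w
    = X w * ((X (v k) / (1 + X (v k))) powi xplus k w * (1 + X (v k)) powi yplus k w)"
  using w mutate_X_factor[OF Y _ plus_nonneg[OF k], of "\<epsilon> w (v k)" w] col
  by (simp add: mutate_X_def xplus_def yplus_def)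

primrec X_seq :: "('v \<Rightarrow> 'v \<Rightarrow> int) \<Rightarrow> ('v \<Rightarrow> 'f::field_char_0) \<Rightarrow> nat \<Rightarrow> 'v \<Rightarrow> 'f" where
  "X_seq \<epsilon> X 0 = X"
| "X_seq \<epsilon> X (Suc k) = mutate_X (v k) (exch_seq \<epsilon> k) (X_seq \<epsilon> X k)"

text \<open>The recurrence of \<open>wsum\<close> with constant term 1 instead of
  \<open>1 - holonomy\<close>, started at \<open>v 0\<close>: the sum over chains that do not
  continue from \<open>v 0\<close> back to \<open>v (Suc K)\<close>.\<close>

primrec G :: "('v \<Rightarrow> 'f::field_char_0) \<Rightarrow> nat \<Rightarrow> 'f" where
  "G X 0 = 1"
| "G X (Suc k) = 1 + X (v k) * G X k"

definition cols :: "nat \<Rightarrow> ('v \<Rightarrow> 'v \<Rightarrow> int) \<Rightarrow> bool" where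
  "cols k \<epsilon> \<longleftrightarrow> rows k (\<lambda>i j. - \<epsilon> j i)"

lemma cols_exch_seq:
  assumes "cols 0 \<epsilon>" "k \<le> K"
  shows "cols k (exch_seq \<epsilon> k)"
proof -
  have "exch_seq (\<lambda>i j. - \<epsilon> j i) k = (\<lambda>i j. - exch_seq \<epsilon> k j i)"
    by (induction k) (simp_all add: mutate_matrix_neg_transpose)
  then show ?thesis
    using rows_exch_seq[of "\<lambda>i j. - \<epsilon> j i" k] assms by (simp add: cols_def)
qed

text \<open>A vertex settles one step late: \<open>v j\<close> is inverted by its own mutation and
  gets its numerator from the next one, while \<open>v (Suc K)\<close> collects the variables
  passed. Only the first mutation meets the outside neighbours with exponent
  \<open>b (Suc K)\<close>, hence the case \<open>k = 0\<close>.\<close>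

definition X_inv :: "('v \<Rightarrow> 'f::field_char_0) \<Rightarrow> nat \<Rightarrow> ('v \<Rightarrow> 'f) \<Rightarrow> bool" where
  "X_inv X k Y \<longleftrightarrow>
     (\<forall>j. Suc j < k \<longrightarrow> Y (v j) = G X (Suc (Suc j)) / (X (v j) * G X j))
   \<and> (\<forall>j. Suc j = k \<longrightarrow> Y (v j) = 1 / (X (v j) * G X j))
   \<and> Y (v k) = X (v k) * G X k
   \<and> (\<forall>j. k < j \<and> j \<le> K \<longrightarrow> Y (v j) = X (v j))
   \<and> Y (v (Suc K)) = X (v (Suc K)) * (\<Prod>l<k. X (v l)) / G X k
   \<and> (\<forall>w. w \<notin> v ` {..Suc K} \<longrightarrow> Y w = X w * (if k = 0 then 1 else G X 1 powi b (Suc K) w)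
        * (\<Prod>l<k. (X (v l) * G X l / G X (Suc l)) powi b l w))"

lemma G_P:
  assumes "positive_part P" "\<And>w. X w \<in> P"
  shows "G X k \<in> P"
proof -
  interpret positive_part P by fact
  show ?thesis by (induction k) (auto simp: assms(2))
qed

lemma X_seq_inv:
  fixes X :: "'v \<Rightarrow> 'f::field_char_0"
  assumes P: "positive_part P" "\<And>w. X w \<in> P" and c: "cols 0 \<epsilon>" and "k \<le> K"
  shows "X_inv X k (X_seq \<epsilon> X k)"
  using \<open>k \<le> K\<close>
proof (induction k)
  case 0
  then show ?case by (simp add: X_inv_def)
next
  case (Suc k)
  interpret positive_part P by fact
  have k: "k < K" using Suc by simp
  have GP: "G X l \<in> P" for l by (rule G_P[OF P])
  note nzG = nz[OF GP] and nzX = nz[OF P(2)]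
  let ?Y = "X_seq \<epsilon> X k" and ?Z = "X_seq \<epsilon> X (Suc k)"
  have inv: "X_inv X k ?Y" using Suc by simp
  have y: "?Y (v k) = X (v k) * G X k"
    using inv by (simp add: X_inv_def)
  have y1: "1 + ?Y (v k) = G X (Suc k)"
    by (simp add: y)
  have "cols k (exch_seq \<epsilon> k)"
    using c k by (intro cols_exch_seq) auto
  then have "- exch_seq \<epsilon> k w (v k) = hexp k w - cexp k w" for w
    by (simp add: cols_def rows_def)
  then have col: "exch_seq \<epsilon> k w (v k) = cexp k w - hexp k w" for w
    by (metis minus_diff_eq minus_minus)
  have Z: "?Z w = ?Y w * ((X (v k) * G X k / G X (Suc k)) powi xplus k w * G X (Suc k) powi yplus k w)"
    if "w \<noteq> v k" for w
  proof -
    have "?Y (v k) \<noteq> 0" "1 + ?Y (v k) \<noteq> 0"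
      unfolding y1 using nzG[of "Suc k"] by (simp_all add: y nzG nzX del: G.simps)
    from mutate_X_split[where X = ?Y and k = k and w = w and \<epsilon> = "exch_seq \<epsilon> k", OF _ col that this] k show ?thesis
      unfolding y1 X_seq.simps by (simp add: y del: G.simps)
  qed
  have Zk: "?Z (v k) = 1 / (X (v k) * G X k)"
    by (simp add: mutate_X_def y inverse_eq_divide)
  have "?Z (v j) = G X (Suc (Suc j)) / (X (v j) * G X j)" if "Suc j < Suc k" for j
  proof -
    have "v j \<noteq> v k" using that k by (simp add: v_eq)
    moreover have "xplus k (v j) = 0" "yplus k (v j) = (if Suc j = k then 1 else 0)"
      using that k by (simp_all add: plus_v)
    ultimately have "?Z (v j) = ?Y (v j) * (if Suc j = k then G X (Suc k) else 1)"
      by (simp add: Z del: G.simps X_seq.simps)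
    moreover have "?Y (v j) = (if Suc j = k then 1 else G X (Suc (Suc j))) / (X (v j) * G X j)"
      using inv that unfolding X_inv_def by (auto simp del: G.simps)
    ultimately show ?thesis
      by (auto simp del: G.simps)
  qed
  moreover have "?Z (v (Suc k)) = X (v (Suc k)) * G X (Suc k)"
  proof -
    have "v (Suc k) \<noteq> v k" using k by (simp add: v_eq)
    moreover have "xplus k (v (Suc k)) = 0" "yplus k (v (Suc k)) = 1"
      using k by (simp_all add: plus_v)
    moreover have "?Y (v (Suc k)) = X (v (Suc k))"
      using inv k unfolding X_inv_def by auto
    ultimately show ?thesis
      by (simp add: Z del: G.simps X_seq.simps)
  qed
  moreover have "?Z (v j) = X (v j)" if "Suc k < j" "j \<le> K" for j
  proof -
    have "v j \<noteq> v k" using that k by (simp add: v_eq)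
    moreover have "xplus k (v j) = 0" "yplus k (v j) = 0"
      using k that by (simp_all add: plus_v)
    moreover have "?Y (v j) = X (v j)"
      using inv that unfolding X_inv_def by auto
    ultimately show ?thesis
      by (simp add: Z del: G.simps X_seq.simps)
  qed
  moreover have "?Z (v (Suc K)) = X (v (Suc K)) * (\<Prod>l<Suc k. X (v l)) / G X (Suc k)"
  proof -
    have "v (Suc K) \<noteq> v k" using k by (simp add: v_eq)
    moreover have "xplus k (v (Suc K)) = 1" "yplus k (v (Suc K)) = 0"
      using k by (simp_all add: plus_v)
    moreover have "?Y (v (Suc K)) = X (v (Suc K)) * (\<Prod>l<k. X (v l)) / G X k"
      using inv unfolding X_inv_def by blast
    ultimately have "?Z (v (Suc K)) = X (v (Suc K)) * (\<Prod>l<k. X (v l)) / G X k * (X (v k) * G X k / G X (Suc k))"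
      by (simp add: Z del: G.simps X_seq.simps)
    also have "\<dots> = X (v (Suc K)) * (\<Prod>l<Suc k. X (v l)) / G X (Suc k)"
      using nzG[of k] by (simp add: mult_ac del: G.simps)
    finally show ?thesis .
  qed
  moreover have "?Z w = X w * G X 1 powi b (Suc K) w
      * (\<Prod>l<Suc k. (X (v l) * G X l / G X (Suc l)) powi b l w)" if w: "w \<notin> v ` {..Suc K}" for w
  proof -
    have wk: "w \<noteq> v k" using w k by auto
    have "?Y w = X w * (if k = 0 then 1 else G X 1 powi b (Suc K) w)
        * (\<Prod>l<k. (X (v l) * G X l / G X (Suc l)) powi b l w)"
      using inv w unfolding X_inv_def by blast
    moreover have "xplus k w = b k w" "yplus k w = (if k = 0 then b (Suc K) w else 0)"
      using k w by (simp_all add: plus_outside)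
    ultimately have "?Z w = X w * (if k = 0 then 1 else G X 1 powi b (Suc K) w)
        * (\<Prod>l<k. (X (v l) * G X l / G X (Suc l)) powi b l w)
        * ((X (v k) * G X k / G X (Suc k)) powi b k w * G X (Suc k) powi (if k = 0 then b (Suc K) w else 0))"
      by (simp only: Z[OF wk])
    then show ?thesis
      by (cases "k = 0") (simp_all add: mult_ac del: G.simps X_seq.simps)
  qed
  ultimately show ?case
    unfolding X_inv_def using Zk by (simp del: G.simps X_seq.simps)
qed

definition X_mid :: "('v \<Rightarrow> 'v \<Rightarrow> int) \<Rightarrow> ('v \<Rightarrow> 'f::field_char_0) \<Rightarrow> 'v \<Rightarrow> 'f" where
  "X_mid \<epsilon> X = mutate_X (v (Suc K)) (mutate_matrix (v K) (exch_seq \<epsilon> K))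
     (mutate_X (v K) (exch_seq \<epsilon> K) (X_seq \<epsilon> X K))"

text \<open>\<open>p\<close> and \<open>q\<close> are the variables at the last two vertices before
  their mutations. No arrow joins these vertices and their columns are opposite, so a third vertex
  receives both factors with the roles of \<open>xplus\<close> and \<open>yplus\<close>
  exchanged.\<close>

lemma X_mid_eq:
  fixes X :: "'v \<Rightarrow> 'f::field_char_0"
  assumes P: "positive_part P" "\<And>w. X w \<in> P" and c: "cols 0 \<epsilon>"
  defines "p \<equiv> X (v K) * G X K" and "q \<equiv> X (v (Suc K)) * (\<Prod>l<K. X (v l)) / G X K"
  shows "X_mid \<epsilon> X w = (if w = v K then 1 / p else if w = v (Suc K) then 1 / q
     else X_seq \<epsilon> X K w * (p * (1 + q) / (1 + p)) powi xplus K w * ((1 + p) * q / (1 + q)) powi yplus K w)"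
proof -
  interpret positive_part P by fact
  let ?Y = "X_seq \<epsilon> X K" and ?e = "exch_seq \<epsilon> K"
  let ?Z = "mutate_X (v K) ?e ?Y"
  have inv: "X_inv X K ?Y"
    by (rule X_seq_inv[OF P c]) simp
  have GP: "G X k \<in> P" for k by (rule G_P[OF P])
  have pP: "p \<in> P" and qP: "q \<in> P"
    unfolding p_def q_def using GP P(2) by (auto intro!: divide mult prod)
  have p1: "1 + p \<noteq> 0" "1 + q \<noteq> 0" using pP qP nz by auto
  have Y: "?Y (v K) = p" "?Y (v (Suc K)) = q"
    using inv by (simp_all add: X_inv_def p_def q_def)
  have ne: "v K \<noteq> v (Suc K)" by (simp add: v_eq)
  have "cols K ?e"
    using c by (intro cols_exch_seq) auto
  then have r: "- ?e w (v K) = hexp K w - cexp K w" "- ?e w (v (Suc K)) = cexp K w - hexp K w" for w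
    by (simp_all add: cols_def rows_def)
  have colp: "?e w (v K) = cexp K w - hexp K w" and colq: "?e w (v (Suc K)) = hexp K w - cexp K w" for w
    using r[of w] by (metis minus_diff_eq minus_minus)+
  have zero: "?e (v (Suc K)) (v K) = 0" "?e (v K) (v (Suc K)) = 0" "?e (v K) (v K) = 0"
    by (simp_all add: colp colq hexp_v cexp_v)
  have Zp: "?Z (v K) = 1 / p"
    by (simp add: mutate_X_def Y inverse_eq_divide)
  have Zq: "?Z (v (Suc K)) = q"
    using ne by (simp add: mutate_X_def Y zero)
  have Z: "?Z w = ?Y w * ((p / (1 + p)) powi xplus K w * (1 + p) powi yplus K w)" if "w \<noteq> v K" for w
    using mutate_X_split[of K ?e w ?Y] colp that nz[OF pP] p1 by (simp add: Y)
  have colq': "mutate_matrix (v K) ?e w (v (Suc K)) = ?e w (v (Suc K))" if "w \<noteq> v K" for w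
    using that ne zero by (simp add: mutate_matrix_path_term path_term_simps)
  have "X_mid \<epsilon> X (v K) = 1 / p"
    using ne by (simp add: X_mid_def mutate_X_def[of "v (Suc K)"] mutate_matrix_path_term zero Zp)
  moreover have "X_mid \<epsilon> X (v (Suc K)) = 1 / q"
    by (simp add: X_mid_def mutate_X_def[of "v (Suc K)"] Zq inverse_eq_divide)
  moreover have "X_mid \<epsilon> X w = ?Y w * (p * (1 + q) / (1 + p)) powi xplus K w * ((1 + p) * q / (1 + q)) powi yplus K w"
    if w: "w \<noteq> v K" "w \<noteq> v (Suc K)"
  proof -
    have "X_mid \<epsilon> X w = ?Z w * (1 + q powi (- sgn (?e w (v (Suc K))))) powi (- ?e w (v (Suc K)))"
      using w by (simp add: X_mid_def mutate_X_def[of "v (Suc K)"] colq' Zq)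
    also have "(1 + q powi (- sgn (?e w (v (Suc K))))) powi (- ?e w (v (Suc K)))
        = (q / (1 + q)) powi yplus K w * (1 + q) powi xplus K w"
      using plus_nonneg[of K w] nz[OF qP] p1
      by (intro mutate_X_factor) (auto simp: colq xplus_def yplus_def)
    finally show ?thesis
      unfolding Z[OF w(1)] by (simp add: power_int_mult_distrib power_int_divide_distrib mult_ac)
  qed
  ultimately show ?thesis by auto
qed

end

context cyclic_vertices
begin

text \<open>In the application \<open>f k\<close> is \<open>wsum\<close> at the vertex preceding
  \<open>v k\<close> and \<open>g\<close> is the gauge factor. The proof compares
  \<open>X_inv\<close> for \<open>X\<close> with \<open>X_inv\<close> for the reflected variables
  \<open>X'\<close>.\<close>

lemma X_mid_reflected:
  fixes X X' :: "'v \<Rightarrow> 'f::field_char_0" and f :: "nat \<Rightarrow> 'f"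
  assumes P: "positive_part P" "\<And>w. X w \<in> P" and c: "cols 0 \<epsilon>"
    and fP: "\<And>k. f k \<in> P"
    and rec: "\<And>k. k \<le> Suc K \<Longrightarrow> f (Suc k) = 1 - u + X (v k) * f k"
    and cyclic: "f (Suc (Suc K)) = f 0" and last: "f (Suc K) = G X (Suc K)"
    and u: "u = (\<Prod>l\<le>Suc K. X (v l))"
  defines "g \<equiv> (\<lambda>k. X (v k) * f k / f (Suc k))"
  assumes X': "X' (v 0) = X (v 0) / (g 0 * g (Suc K))"
    "\<And>j. j \<le> K \<Longrightarrow> X' (v (Suc j)) = X (v (Suc j)) / (g (Suc j) * g j)"
    "\<And>w. w \<notin> v ` {..Suc K} \<Longrightarrow> X' w = X w * (\<Prod>l\<le>Suc K. g l powi b l w)"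
  shows "X_mid \<epsilon> X (Transposition.transpose (v K) (v (Suc K)) w) = X_seq \<epsilon> X' K w"
proof -
  interpret positive_part P by fact
  have GP: "G X k \<in> P" for k by (rule G_P[OF P])
  have gP: "g k \<in> P" for k unfolding g_def by (intro divide mult P fP)
  note nzf = nz[OF fP] and nzX = nz[OF P(2)] and nzG = nz[OF GP] and nzg = nz[OF gP]
  have X'P: "X' w \<in> P" for w
  proof (cases "w \<in> v ` {..Suc K}")
    case True
    then obtain l where l: "l \<le> Suc K" "w = v l" by auto
    show ?thesis
      using l by (cases l) (auto simp: X' intro!: divide mult P gP)
  next
    case False
    then show ?thesis
      by (simp add: X'(3)) (intro mult prod P gP powi)
  qed
  \<comment> \<open>\<open>E\<close> solves the homogeneous recurrence and makes up the difference
    between \<open>f\<close> and \<open>(1 - u) * G X\<close>. Then \<open>Q\<close> is the running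
    product of gauge factors, beginning with \<open>g (Suc K)\<close>.\<close>
  define E where "E k = f (Suc K) * X (v (Suc K)) * (\<Prod>l<k. X (v l))" for k
  define Q where "Q k = E k / f k" for k
  have EP: "E k \<in> P" for k unfolding E_def by (intro mult prod P fP)
  have QP: "Q k \<in> P" for k unfolding Q_def by (intro divide EP fP)
  note nzE = nz[OF EP] and nzQ = nz[OF QP]
  have E_Suc: "E (Suc k) = X (v k) * E k" for k by (simp add: E_def)
  have fE: "f k = (1 - u) * G X k + E k" if "k \<le> Suc K" for k
    using that
  proof (induction k)
    case 0
    then show ?case
      using rec[of "Suc K"] by (simp add: cyclic E_def mult.commute)
  next
    case (Suc k)
    then have "f (Suc k) = 1 - u + X (v k) * ((1 - u) * G X k + E k)"
      using rec[of k] by simp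
    then show ?case by (simp add: E_Suc algebra_simps)
  qed
  have gQ: "Q (Suc k) = g k * Q k" for k
    using nzf[of k] by (simp add: Q_def g_def E_Suc)
  have Q0: "Q 0 = g (Suc K)"
    by (simp add: Q_def g_def E_def cyclic mult.commute)
  \<comment> \<open>Values at the cyclic predecessor: at index 0 nothing is accumulated yet in
    \<open>Qp\<close>, and \<open>gp\<close> is the gauge factor of
    \<open>v (Suc K)\<close>.\<close>
  define Qp where "Qp k = (case k of 0 \<Rightarrow> 1 | Suc l \<Rightarrow> Q l)" for k
  define gp where "gp k = (case k of 0 \<Rightarrow> Q 0 | Suc l \<Rightarrow> g l)" for k
  have nzQp: "Qp k \<noteq> 0" "gp k \<noteq> 0" for k
    using nzQ nzg by (auto simp: Qp_def gp_def split: nat.split)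
  have gpQp: "gp k * Qp k = Q k" for k
    by (cases k) (simp_all add: gp_def Qp_def gQ)
  have X'gp: "X' (v k) = X (v k) / (g k * gp k)" if "k \<le> Suc K" for k
    using that by (cases k) (simp_all add: gp_def X' Q0)
  have G'_step: "G X' (Suc k) = G X (Suc k) / Q k \<and> X' (v k) * G X' k = X (v k) * G X k / Q (Suc k)"
    if "k \<le> K" "G X' k = G X k / Qp k" for k
  proof -
    have "X' (v k) * G X' k = X (v k) * G X k / (g k * (gp k * Qp k))"
      using that by (simp add: X'gp)
    then have XG: "X' (v k) * G X' k = X (v k) * G X k / Q (Suc k)"
      by (simp add: gpQp gQ)
    \<comment> \<open>The constant terms \<open>1 - u\<close> cancel here, and this makes
      \<open>G X'\<close> a rescaling of \<open>G X\<close>.\<close>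
    have "E k + G X k * f (Suc k) = (1 + X (v k) * G X k) * f k"
    proof -
      have Ek: "E k = f k - (1 - u) * G X k"
        using fE[of k] that(1) by simp
      have fs: "f (Suc k) = 1 - u + X (v k) * f k"
        using rec[of k] that(1) by simp
      show ?thesis
        by (simp only: Ek fs) (simp add: algebra_simps)
    qed
    then have "(E k + G X k * f (Suc k)) / E k = G X (Suc k) * f k / E k"
      by simp
    then have "1 + X (v k) * G X k / Q (Suc k) = G X (Suc k) / Q k"
      using nzE[of k] nzX by (simp add: Q_def E_Suc add_divide_distrib)
    then show ?thesis using XG by simp
  qed
  have G': "G X' k = G X k / Qp k" if "k \<le> Suc K" for k
    using that
  proof (induction k)
    case 0
    then show ?case by (simp add: Qp_def)
  next
    case (Suc k)
    then have "G X' (Suc k) = G X (Suc k) / Q k"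
      using G'_step[of k] by (simp del: G.simps)
    then show ?case by (simp add: Qp_def)
  qed
  have G'_Suc: "G X' (Suc k) = G X (Suc k) / Q k"
    and XG': "X' (v k) * G X' k = X (v k) * G X k / Q (Suc k)" if "k \<le> K" for k
    using G'_step[OF that G'] that by auto
  define p where "p = X (v K) * G X K"
  define q where "q = X (v (Suc K)) * (\<Prod>l<K. X (v l)) / G X K"
  have pP: "p \<in> P" and qP: "q \<in> P"
    unfolding p_def q_def by (intro divide mult prod P GP)+
  have nzpq: "p \<noteq> 0" "q \<noteq> 0" "1 + p \<noteq> 0" "1 + q \<noteq> 0"
    using pP qP nz[OF add[OF one pP]] nz[OF add[OF one qP]] nz by auto
  have pf: "1 + p = f (Suc K)"
    by (simp add: p_def last)
  have pq: "p * q = u"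
    using nzG[of K] by (simp add: p_def q_def u lessThan_Suc_atMost[symmetric] mult_ac)
  have QSK: "Q (Suc K) = u"
    using nzf by (simp add: Q_def E_def u lessThan_Suc_atMost[symmetric] mult_ac)
  have EK: "E K = (1 + p) * q * G X K"
    using nzG[of K] by (simp add: E_def pf q_def)
  have fK: "f K = (1 + q) * G X K"
    unfolding fE[of K, simplified] EK pq[symmetric] by (simp add: algebra_simps)
  \<comment> \<open>\<open>Q K\<close> and \<open>g K\<close> are exactly the bases of the powers
    \<open>yplus\<close> and \<open>xplus\<close> in \<open>X_mid_eq\<close>.\<close>
  have QK: "Q K = (1 + p) * q / (1 + q)"
    using nzG[of K] by (simp add: Q_def EK fK)
  have gK: "g K = p * (1 + q) / (1 + p)"
  proof -
    have "g K = Q (Suc K) / Q K" using nzQ[of K] by (simp add: gQ)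
    then show ?thesis
      using nzpq by (simp add: QSK QK flip: pq)
  qed
  have prodX': "(\<Prod>l<k. X' (v l)) = (\<Prod>l<k. X (v l)) * Q 0 / (Q k * Qp k)" if "k \<le> Suc K" for k
    using that
  proof (induction k)
    case 0
    then show ?case using nzQ[of 0] by (simp add: Qp_def)
  next
    case (Suc k)
    have "Qp (Suc k) = gp k * Qp k" by (simp add: gpQp) (simp add: Qp_def)
    then show ?case
      using Suc by (simp add: X'gp gQ mult_ac)
  qed
  have inv: "X_inv X K (X_seq \<epsilon> X K)"
    by (rule X_seq_inv[OF P c]) simp
  have inv': "X_inv X' K (X_seq \<epsilon> X' K)"
    by (rule X_seq_inv[OF P(1) X'P c]) simp
  have mid: "X_mid \<epsilon> X w = (if w = v K then 1 / p else if w = v (Suc K) then 1 / q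
     else X_seq \<epsilon> X K w * (p * (1 + q) / (1 + p)) powi xplus K w * ((1 + p) * q / (1 + q)) powi yplus K w)" for w
    unfolding p_def q_def by (rule X_mid_eq[OF P c])
  have ne: "v K \<noteq> v (Suc K)" by (simp add: v_eq)
  consider "w = v K" | "w = v (Suc K)" | j where "Suc j < K" "w = v j" | j where "Suc j = K" "w = v j"
    | "w \<noteq> v K" "w \<noteq> v (Suc K)" "w \<notin> v ` {..<K}"
    by (metis Suc_lessI imageE lessThan_iff)
  then show ?thesis
  proof cases
    case 1
    have "X_seq \<epsilon> X' K (v K) = X' (v K) * G X' K"
      using inv' by (simp add: X_inv_def)
    also have "\<dots> = p / (p * q)"
      unfolding pq using XG'[of K] by (simp add: p_def QSK)
    finally show ?thesis
      using ne nzpq by (simp add: 1 mid)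
  next
    case 2
    have "X_seq \<epsilon> X' K (v (Suc K)) = X' (v (Suc K)) * (\<Prod>l<K. X' (v l)) / G X' K"
      using inv' by (simp add: X_inv_def)
    also have "\<dots> = X (v (Suc K)) / (g (Suc K) * g K) * ((\<Prod>l<K. X (v l)) * Q 0 / (Q K * Qp K)) / (G X K / Qp K)"
      using X'(2)[of K] prodX'[of K] G'[of K] by simp
    also have "\<dots> = X (v (Suc K)) * (\<Prod>l<K. X (v l)) / G X K / (g K * Q K)"
      using nzQp[of K] nzg[of "Suc K"] unfolding Q0 by (simp add: field_simps)
    also have "\<dots> = q / (p * q)"
      by (simp only: gQ[symmetric] QSK pq q_def[symmetric])
    finally show ?thesis
      using ne nzpq by (simp add: 2 mid)
  next
    case 3
    then have "w \<noteq> v K" "w \<noteq> v (Suc K)" by (auto simp: v_eq)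
    then have "X_mid \<epsilon> X (Transposition.transpose (v K) (v (Suc K)) w) = X_seq \<epsilon> X K w"
      using 3 by (simp add: mid plus_v)
    also have "\<dots> = G X (Suc (Suc j)) / (X (v j) * G X j)"
      using inv 3 unfolding X_inv_def by blast
    also have "\<dots> = G X' (Suc (Suc j)) / (X' (v j) * G X' j)"
      using 3 nzQ[of "Suc j"] by (simp add: XG' G'_Suc del: G.simps)
    also have "\<dots> = X_seq \<epsilon> X' K w"
      using inv' 3 unfolding X_inv_def by metis
    finally show ?thesis .
  next
    case 4
    then have w: "w \<noteq> v K" "w \<noteq> v (Suc K)" by (auto simp: v_eq)
    have "xplus K w = 0" "yplus K w = 1"
      using 4 by (auto simp: plus_v)
    with w have "X_mid \<epsilon> X (Transposition.transpose (v K) (v (Suc K)) w) = X_seq \<epsilon> X K w * Q K"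
      by (simp add: mid QK)
    also have "X_seq \<epsilon> X K w = 1 / (X (v j) * G X j)"
      using inv 4 unfolding X_inv_def by blast
    also have "1 / (X (v j) * G X j) * Q K = 1 / (X' (v j) * G X' j)"
      using 4 by (simp add: XG')
    also have "\<dots> = X_seq \<epsilon> X' K w"
      using inv' 4 unfolding X_inv_def by metis
    finally show ?thesis .
  next
    case 5
    have "{..Suc K} = insert (Suc K) (insert K {..<K})" by auto
    with 5 have out: "w \<notin> v ` {..Suc K}" by simp
    have "X_mid \<epsilon> X (Transposition.transpose (v K) (v (Suc K)) w)
        = X_seq \<epsilon> X K w * g K powi b K w * Q K powi (if K = 0 then b (Suc K) w else 0)"
      using 5 out by (simp add: mid plus_outside gK QK)
    also have "X_seq \<epsilon> X K w = X w * (if K = 0 then 1 else G X 1 powi b (Suc K) w)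
        * (\<Prod>l<K. (X (v l) * G X l / G X (Suc l)) powi b l w)"
      using inv out unfolding X_inv_def by blast
    finally have lhs: "X_mid \<epsilon> X (Transposition.transpose (v K) (v (Suc K)) w)
        = X w * (if K = 0 then 1 else G X 1 powi b (Suc K) w)
        * (\<Prod>l<K. (X (v l) * G X l / G X (Suc l)) powi b l w)
        * g K powi b K w * Q K powi (if K = 0 then b (Suc K) w else 0)" .
    have "X_seq \<epsilon> X' K w = X' w * (if K = 0 then 1 else G X' 1 powi b (Suc K) w)
        * (\<Prod>l<K. (X' (v l) * G X' l / G X' (Suc l)) powi b l w)"
      using inv' out unfolding X_inv_def by blast
    also have "(\<Prod>l<K. (X' (v l) * G X' l / G X' (Suc l)) powi b l w)
        = (\<Prod>l<K. (X (v l) * G X l / G X (Suc l)) powi b l w) / (\<Prod>l<K. g l powi b l w)"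
      unfolding prod_dividef[symmetric]
    proof (rule prod.cong)
      fix l assume "l \<in> {..<K}"
      then have "X' (v l) * G X' l / G X' (Suc l) = X (v l) * G X l / G X (Suc l) / g l"
        using nzQ[of l] by (simp add: XG' G'_Suc gQ del: G.simps)
      then show "(X' (v l) * G X' l / G X' (Suc l)) powi b l w
          = (X (v l) * G X l / G X (Suc l)) powi b l w / g l powi b l w"
        by (simp only: power_int_divide_distrib)
    qed simp
    also have "X' w = X w * ((\<Prod>l<K. g l powi b l w) * g K powi b K w * g (Suc K) powi b (Suc K) w)"
      using X'(3)[OF out] by (simp flip: lessThan_Suc_atMost)
    finally have rhs: "X_seq \<epsilon> X' K w
        = X w * (if K = 0 then 1 else G X' 1 powi b (Suc K) w) * g (Suc K) powi b (Suc K) w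
        * (\<Prod>l<K. (X (v l) * G X l / G X (Suc l)) powi b l w) * g K powi b K w"
      using nzg by simp
    show ?thesis
    proof (cases "K = 0")
      case True
      then show ?thesis
        unfolding lhs rhs by (simp add: Q0)
    next
      case False
      have "G X' 1 = G X 1 / g (Suc K)"
        using G'_Suc[of 0] by (simp add: Q0)
      then have "G X' 1 powi b (Suc K) w * g (Suc K) powi b (Suc K) w = G X 1 powi b (Suc K) w"
        using nzg[of "Suc K"] by (simp add: power_int_divide_distrib)
      then show ?thesis
        unfolding lhs rhs using False by (simp add: mult_ac del: G.simps)
    qed
  qed
qed

end

section \<open>The formula for \<open>R(s, i)\<close>\<close>

lemma exchange_matrix_skew:
  assumes "skew_symmetric \<sigma>"
  shows "int (d j) * exchange_matrix d \<sigma> i j = - (int (d i) * exchange_matrix d \<sigma> j i)"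
proof -
  have *: "d j * (d i div gcd (d i) (d j)) = d i * (d j div gcd (d j) (d i))"
    by (simp add: div_mult_swap gcd.commute[of "d j"] mult.commute)
  have "int (d j) * exchange_matrix d \<sigma> i j = \<sigma> i j * int (d j * (d i div gcd (d i) (d j)))"
    by (simp add: exchange_matrix_def mult_ac)
  also have "\<dots> = - (\<sigma> j i * int (d i * (d j div gcd (d j) (d i))))"
  proof -
    have "\<sigma> i j = - \<sigma> j i"
      using assms unfolding skew_symmetric_def by blast
    then show ?thesis unfolding * by simp
  qed
  also have "\<dots> = - (int (d i) * exchange_matrix d \<sigma> j i)"
    by (simp add: exchange_matrix_def mult_ac)
  finally show ?thesis .
qed

text \<open>The exponents outside the cycle of the summand of \<open>f_A\<close> with index
  \<open>y\<close>. The weight \<open>c\<close> is left open because rows use the exchange entries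
  \<open>s t\<close> and columns the entries \<open>t s\<close>.\<close>

definition link ::
    "('s \<Rightarrow> 's \<Rightarrow> int) \<Rightarrow> 's \<Rightarrow> ('s \<Rightarrow> int) \<Rightarrow> 'm::nontriv mod_ring \<Rightarrow> 's \<times> 'm mod_ring \<Rightarrow> int" where
  "link \<sigma> s c y w = c (fst w) * ((if snd w = y \<and> fst w \<in> in_nbrs \<sigma> s then 1 else 0)
     + (if snd w = y + 1 \<and> fst w \<in> out_nbrs \<sigma> s then 1 else 0))"

definition link_ext ::
    "('s \<Rightarrow> 's \<Rightarrow> int) \<Rightarrow> 's \<Rightarrow> ('s \<Rightarrow> int) \<Rightarrow> 'm::nontriv mod_ring \<Rightarrow> 's \<times> 'm mod_ring \<Rightarrow> int" where
  "link_ext \<sigma> s c y w = link \<sigma> s c y w - (if w = (s, y) then 1 else 0) - (if w = (s, y + 1) then 1 else 0)"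

lemma not_in_nbrs_self: "skew_symmetric \<sigma> \<Longrightarrow> s \<notin> in_nbrs \<sigma> s \<and> s \<notin> out_nbrs \<sigma> s"
proof -
  assume "skew_symmetric \<sigma>"
  then have "\<sigma> s s = - \<sigma> s s" unfolding skew_symmetric_def by blast
  then show ?thesis by (simp add: in_nbrs_def out_nbrs_def)
qed

lemma nbrs_disjoint: "skew_symmetric \<sigma> \<Longrightarrow> t \<in> in_nbrs \<sigma> s \<Longrightarrow> t \<notin> out_nbrs \<sigma> s"
proof -
  assume "skew_symmetric \<sigma>" "t \<in> in_nbrs \<sigma> s"
  then have "\<sigma> s t = - \<sigma> t s" "\<sigma> t s \<ge> 1"
    unfolding skew_symmetric_def in_nbrs_def by blast+
  then show ?thesis by (simp add: out_nbrs_def)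
qed

text \<open>Vertex \<open>(s, y)\<close> is the common end of the summands \<open>y - 1\<close> and
  \<open>y\<close>; variables of the first count positively, those of the second negatively. For
  \<open>m = 2\<close> the indices \<open>y - 1\<close> and \<open>y + 1\<close> agree and the cycle
  arrows cancel.\<close>

lemma Qm_arrows_diff:
  assumes skew: "skew_symmetric \<sigma>" and c: "c t = \<bar>\<sigma> s t\<bar> * e" and e: "t = s \<longrightarrow> e = 1"
  shows "(Qm_arrows \<sigma> (s, y) (t, x) - Qm_arrows \<sigma> (t, x) (s, y)) * e
    = link_ext \<sigma> s c (y - 1) (t, x) - link_ext \<sigma> s c y (t, x)"
proof -
  have ts: "\<sigma> t s = - \<sigma> s t"
    using skew unfolding skew_symmetric_def by blast
  have yx: "y = x + 1 \<longleftrightarrow> x = y - 1"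
    by (auto simp: algebra_simps)
  show ?thesis
  proof (cases "t = s")
    case True
    then have "\<sigma> s s = 0" using ts by simp
    then show ?thesis
      using True e by (simp add: link_ext_def link_def in_nbrs_def out_nbrs_def yx)
  next
    case False
    consider "\<sigma> s t \<ge> 1" | "\<sigma> s t = 0" | "\<sigma> s t \<le> - 1" by linarith
    then show ?thesis
    proof cases
      case 1
      then show ?thesis
        using False by (auto simp: link_ext_def link_def in_nbrs_def out_nbrs_def ts c yx algebra_simps)
    next
      case 2
      then show ?thesis
        using False by (simp add: link_ext_def link_def in_nbrs_def out_nbrs_def ts)
    next
      case 3
      then show ?thesis
        using False by (auto simp: link_ext_def link_def in_nbrs_def out_nbrs_def ts c yx algebra_simps)
    qed
  qed
qed

lemma exch_Qm:
  "exch (Qm d \<sigma>) (s, y) (t, x)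
    = (Qm_arrows \<sigma> (s, y) (t, x) - Qm_arrows \<sigma> (t, x) (s, y)) * int (d s div gcd (d s) (d t))"
  by (simp add: Qm_def quiver_of_def exchange_matrix_def)

lemma abs_exchange_matrix: "\<bar>exchange_matrix d \<sigma> s t\<bar> = \<bar>\<sigma> s t\<bar> * int (d s div gcd (d s) (d t))"
  by (simp add: exchange_matrix_def abs_mult)

lemma exch_Qm_row:
  assumes "skew_symmetric \<sigma>" "\<And>s. d s > 0"
  shows "exch (Qm d \<sigma>) (s, y) w
    = link_ext \<sigma> s (\<lambda>t. \<bar>exchange_matrix d \<sigma> s t\<bar>) (y - 1) w
      - link_ext \<sigma> s (\<lambda>t. \<bar>exchange_matrix d \<sigma> s t\<bar>) y w"
proof -
  obtain t x where w: "w = (t, x)" by force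
  show ?thesis
    unfolding w exch_Qm
    by (rule Qm_arrows_diff) (use assms in \<open>auto simp: abs_exchange_matrix\<close>)
qed

lemma exch_Qm_col:
  assumes "skew_symmetric \<sigma>" "\<And>s. d s > 0"
  shows "- exch (Qm d \<sigma>) w (s, y)
    = link_ext \<sigma> s (\<lambda>t. \<bar>exchange_matrix d \<sigma> t s\<bar>) (y - 1) w
      - link_ext \<sigma> s (\<lambda>t. \<bar>exchange_matrix d \<sigma> t s\<bar>) y w"
proof -
  obtain t x where w: "w = (t, x)" by force
  have "\<sigma> t s = - \<sigma> s t"
    using assms unfolding skew_symmetric_def by blast
  then have "(Qm_arrows \<sigma> (s, y) (t, x) - Qm_arrows \<sigma> (t, x) (s, y)) * int (d t div gcd (d t) (d s))
    = link_ext \<sigma> s (\<lambda>t. \<bar>exchange_matrix d \<sigma> t s\<bar>) (y - 1) (t, x)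
      - link_ext \<sigma> s (\<lambda>t. \<bar>exchange_matrix d \<sigma> t s\<bar>) y (t, x)"
    by (intro Qm_arrows_diff) (use assms in \<open>auto simp: abs_exchange_matrix\<close>)
  moreover have "- ((b - a) * e) = (a - b) * e" for a b e :: int
    by (simp add: algebra_simps)
  ultimately show ?thesis
    unfolding w exch_Qm by metis
qed

lemma skew_symmetrizable_Qm:
  fixes d :: "'s \<Rightarrow> nat"
  assumes "\<And>s. d s > 0"
  shows "skew_symmetrizable (exch (Qm d \<sigma> :: ('s \<times> 'm::nontriv mod_ring) weighted_quiver))"
proof -
  let ?a = "\<lambda>v w :: 's \<times> 'm mod_ring. Qm_arrows \<sigma> v w - Qm_arrows \<sigma> w v"
  have "skew_symmetric ?a"
    by (simp add: skew_symmetric_def)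
  from exchange_matrix_skew[OF this, of "\<lambda>v. d (fst v)"] show ?thesis
    unfolding skew_symmetrizable_def Qm_def quiver_of_def
    using assms by (intro exI[of _ "\<lambda>v. int (d (fst v))"]) (metis of_nat_0_less_iff weighted_quiver.select_convs(2))
qed

section \<open>Seeds with positive variables, on which mutation is an involution\<close>

definition good_seed :: "'f set \<Rightarrow> 'g set \<Rightarrow> ('v, 'f, 'g) seed \<Rightarrow> bool" where
  "good_seed P P' S \<longleftrightarrow> skew_symmetrizable (exch (quiver S))
     \<and> (\<forall>w. xvar S w \<in> P) \<and> (\<forall>w. avar S w \<in> P')"

lemma
  fixes S :: "('v::finite, 'f::field_char_0, 'g::field_char_0) seed"
  assumes P: "positive_part P" "positive_part P'" and S: "good_seed P P' S"
  shows good_seed_mutate: "good_seed P P' (mutate k S)"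
    and good_seed_involution: "mutate k (mutate k S) = S"
proof -
  interpret X: positive_part P by fact
  interpret A: positive_part P' by fact
  have SP: "xvar S w \<in> P" "avar S w \<in> P'" for w
    using S by (auto simp: good_seed_def)
  have X': "mutate_X k (exch (quiver S)) (xvar S) w \<in> P" for w
    unfolding mutate_X_def using SP by (auto intro!: X.mult X.powi X.add)
  have A': "mutate_A k (exch (quiver S)) (avar S) w \<in> P'" for w
    unfolding mutate_A_def using SP by (auto intro!: A.mult A.add A.prod)
  show "good_seed P P' (mutate k S)"
    using S X' A' by (simp add: good_seed_def mutate_def skew_symmetrizable_mutate)
  show "mutate k (mutate k S) = S"
  proof (rule mutate_involution)
    show "exch (quiver S) i i = 0" for i
      using S by (simp add: good_seed_def skew_symmetrizable_diag)
    show "1 + xvar S k \<noteq> 0"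
      by (rule X.nz) (use SP in auto)
    show "mutate_A k (exch (quiver S)) (avar S) k \<noteq> 0"
      by (rule A.nz[OF A'])
  qed (rule X.nz A.nz; rule SP)+
qed

lemma mutate_seq_rev:
  assumes P: "positive_part P" "positive_part P'" and S: "good_seed P P' S"
  shows "mutate_seq s i (rev ks) (mutate_seq s i ks S) = S"
  using S
proof (induction ks arbitrary: S)
  case (Cons k ks)
  let ?T = "mutate (s, i + of_nat k) S"
  have "mutate_seq s i (rev (k # ks)) (mutate_seq s i (k # ks) S)
      = mutate (s, i + of_nat k) (mutate_seq s i (rev ks) (mutate_seq s i ks ?T))"
    by (simp add: mutate_seq_def)
  also have "\<dots> = mutate (s, i + of_nat k) ?T"
    using Cons.IH[OF good_seed_mutate[OF P Cons.prems]] by simp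
  also have "\<dots> = S"
    by (rule good_seed_involution[OF P Cons.prems])
  finally show ?case .
qed (simp add: mutate_seq_def)

definition reflect_A ::
    "('s::finite \<Rightarrow> nat) \<Rightarrow> ('s \<Rightarrow> 's \<Rightarrow> int) \<Rightarrow> 's
      \<Rightarrow> ('s \<times> 'm::nontriv mod_ring \<Rightarrow> 'g::field_char_0) \<Rightarrow> 's \<times> 'm mod_ring \<Rightarrow> 'g" where
  "reflect_A d \<sigma> s A w = (if fst w = s then f_A d \<sigma> A s * A w else A w)"

text \<open>Stated with gauge factors, so that a reflection multiplies variables by powers of them;
  \<open>reflect_X_formula\<close> translates to \<open>f_X\<close>.\<close>

definition reflect_X ::
    "('s::finite \<Rightarrow> nat) \<Rightarrow> ('s \<Rightarrow> 's \<Rightarrow> int) \<Rightarrow> 's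
      \<Rightarrow> ('s \<times> 'm::nontriv mod_ring \<Rightarrow> 'f::field_char_0) \<Rightarrow> 's \<times> 'm mod_ring \<Rightarrow> 'f" where
  "reflect_X d \<sigma> s X w = (let g = gauge (\<lambda>j. X (s, j)); t = fst w; j = snd w in
     if t = s then X w / (g j * g (j - 1))
     else if t \<in> out_nbrs \<sigma> s then X w * g (j - 1) powi \<bar>exchange_matrix d \<sigma> t s\<bar>
     else if t \<in> in_nbrs \<sigma> s then X w * g j powi \<bar>exchange_matrix d \<sigma> t s\<bar>
     else X w)"

lemma cyclic_vertices_link:
  fixes i :: "'m::nontriv mod_ring" and s :: "'s::finite"
  assumes skew: "skew_symmetric \<sigma>" and c: "\<And>t. c t \<ge> 0"
  shows "cyclic_vertices (\<lambda>k. (s, i + of_nat k)) (CARD('m) - 2) (\<lambda>j. link \<sigma> s c (i + of_nat j))"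
proof -
  have card: "Suc (Suc (CARD('m) - 2)) = CARD('m)"
    using card_nontriv_ge_2[where 'm = 'm] by simp
  have eq: "i + of_nat j = i + of_nat l \<longleftrightarrow> j = l"
    if "j \<le> Suc (CARD('m) - 2)" "l \<le> Suc (CARD('m) - 2)" for j l
    using that card by (simp add: of_nat_mod_ring_eq_iff)
  show ?thesis
  proof
    show "inj_on (\<lambda>k. (s, i + of_nat k)) {..Suc (CARD('m) - 2)}"
      by (auto simp: inj_on_def eq simp del: add_left_cancel)
    show "0 \<le> link \<sigma> s c (i + of_nat j) w" for j w
      using c by (simp add: link_def)
    show "link \<sigma> s c (i + of_nat j) (s, i + of_nat l) = 0" for j l
      using not_in_nbrs_self[OF skew, of s] by (simp add: link_def)
    show "link \<sigma> s c (i + of_nat j) w = 0 \<or> link \<sigma> s c (i + of_nat l) w = 0"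
      if "j \<le> Suc (CARD('m) - 2)" "l \<le> Suc (CARD('m) - 2)" "j \<noteq> l" for j l w
      using eq[OF that(1,2)] that(3) nbrs_disjoint[OF skew, of "fst w" s]
      by (auto simp: link_def)
  qed
qed

lemma of_nat_card_minus:
  "of_nat (CARD('m) - 2) = (- 2 :: 'm::nontriv mod_ring)"
  "of_nat (Suc (CARD('m) - 2)) = (- 1 :: 'm mod_ring)"
proof -
  show *: "of_nat (CARD('m) - 2) = (- 2 :: 'm mod_ring)"
    using card_nontriv_ge_2[where 'm = 'm] by (simp add: of_nat_diff)
  show "of_nat (Suc (CARD('m) - 2)) = (- 1 :: 'm mod_ring)"
    unfolding of_nat_Suc * by simp
qed

lemma rows_link:
  fixes i :: "'m::nontriv mod_ring" and s :: "'s::finite"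
  assumes skew: "skew_symmetric \<sigma>" and c: "\<And>t. c t \<ge> 0"
    and row: "\<And>y w. \<epsilon> (s, y) w = link_ext \<sigma> s c (y - 1) w - link_ext \<sigma> s c y w"
  shows "cyclic_vertices.rows (\<lambda>k. (s, i + of_nat k)) (CARD('m) - 2) (\<lambda>j. link \<sigma> s c (i + of_nat j)) 0 \<epsilon>"
proof -
  interpret cyclic_vertices "\<lambda>k. (s, i + of_nat k)" "CARD('m) - 2" "\<lambda>j. link \<sigma> s c (i + of_nat j)"
    by (rule cyclic_vertices_link[OF skew c])
  have ce: "cexp j = link_ext \<sigma> s c (i + of_nat j)" for j
    by (auto simp: cexp_def link_ext_def delta_def fun_eq_iff algebra_simps)
  have he: "hexp 0 = link_ext \<sigma> s c (i - 1)"
    unfolding hexp_def link_ext_def delta_def fun_eq_iff of_nat_card_minus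
    by (auto simp: algebra_simps)
  show ?thesis
    unfolding rows_def ce he row of_nat_card_minus by (auto simp: algebra_simps of_nat_card_minus)
qed

lemma G_eq_sum:
  fixes i :: "'m::nontriv mod_ring" and s :: "'s::finite"
  shows "cyclic_vertices.G (\<lambda>k. (s, i + of_nat k)) X (Suc k)
    = 1 + (\<Sum>n\<le>k. \<Prod>l\<le>n. X (s, i + of_nat k - of_nat l))"
proof -
  \<comment> \<open>\<open>G\<close> depends only on the vertices, so zero outside exponents serve
    for the interpretation.\<close>
  interpret cyclic_vertices "\<lambda>k. (s, i + of_nat k)" "CARD('m) - 2" "\<lambda>j. link (\<lambda>_ _. 0) s (\<lambda>_. 0) (i + of_nat j)"
    by (rule cyclic_vertices_link) (simp_all add: skew_symmetric_def)
  show ?thesis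
  proof (induction k)
    case (Suc k)
    have "(\<Prod>l\<le>Suc n. X (s, i + of_nat (Suc k) - of_nat l))
        = X (s, i + of_nat (Suc k)) * (\<Prod>l\<le>n. X (s, i + of_nat k - of_nat l))" for n
      by (subst prod.atMost_Suc_shift) (simp add: algebra_simps)
    then show ?case
      unfolding G.simps(2)[of X "Suc k"] Suc.IH sum.atMost_Suc_shift[of _ k]
      by (simp add: distrib_left sum_distrib_left)
  qed simp
qed

lemma monomial_link:
  fixes A :: "'s::finite \<times> 'm::nontriv mod_ring \<Rightarrow> 'g::field_char_0"
  assumes "skew_symmetric \<sigma>"
  shows "monomial A (link \<sigma> s c y)
    = (\<Prod>t\<in>in_nbrs \<sigma> s. A (t, y) powi c t) * (\<Prod>t\<in>out_nbrs \<sigma> s. A (t, y + 1) powi c t)"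
proof -
  have inner: "(\<Prod>x\<in>UNIV. A (t, x) powi link \<sigma> s c y (t, x))
      = (if t \<in> in_nbrs \<sigma> s then A (t, y) powi c t else 1) * (if t \<in> out_nbrs \<sigma> s then A (t, y + 1) powi c t else 1)" for t
  proof -
    have *: "A (t, x) powi link \<sigma> s c y (t, x)
        = (if x = y then if t \<in> in_nbrs \<sigma> s then A (t, y) powi c t else 1 else 1)
          * (if x = y + 1 then if t \<in> out_nbrs \<sigma> s then A (t, y + 1) powi c t else 1 else 1)" for x
      using nbrs_disjoint[OF assms, of t s] by (auto simp: link_def)
    show ?thesis
      unfolding * prod.distrib by (simp only: prod.delta finite UNIV_I if_True)
  qed
  have "monomial A (link \<sigma> s c y) = (\<Prod>t\<in>UNIV. \<Prod>x\<in>UNIV. A (t, x) powi link \<sigma> s c y (t, x))"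
    unfolding monomial_def UNIV_Times_UNIV[symmetric] by (simp add: prod.cartesian_product case_prod_beta)
  then show ?thesis
    unfolding inner prod.distrib by (simp add: prod.If_cases)
qed

lemma monomial_link_ext:
  fixes A :: "'s::finite \<times> 'm::nontriv mod_ring \<Rightarrow> 'g::field_char_0"
  assumes skew: "skew_symmetric \<sigma>" and A: "\<And>w. A w \<noteq> 0"
  shows "monomial A (link_ext \<sigma> s (\<lambda>t. \<bar>exchange_matrix d \<sigma> s t\<bar>) y)
    = 1 / (A (s, y) * A (s, y + 1))
      * (\<Prod>t\<in>in_nbrs \<sigma> s. A (t, y) powi - exchange_matrix d \<sigma> s t)
      * (\<Prod>t\<in>out_nbrs \<sigma> s. A (t, y + 1) powi exchange_matrix d \<sigma> s t)"
proof -
  have ind: "monomial A (\<lambda>w. if w = v then 1 else 0) = A v" for v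
    using monomial_indicator[of "{v}" A] by simp
  have "\<sigma> s t = - \<sigma> t s" for t
    using skew unfolding skew_symmetric_def by blast
  then have abs: "t \<in> in_nbrs \<sigma> s \<Longrightarrow> \<bar>exchange_matrix d \<sigma> s t\<bar> = - exchange_matrix d \<sigma> s t"
    "t \<in> out_nbrs \<sigma> s \<Longrightarrow> \<bar>exchange_matrix d \<sigma> s t\<bar> = exchange_matrix d \<sigma> s t" for t
    by (auto simp: exchange_matrix_def abs_mult in_nbrs_def out_nbrs_def)
  have "monomial A (link_ext \<sigma> s (\<lambda>t. \<bar>exchange_matrix d \<sigma> s t\<bar>) y)
      = monomial A (link \<sigma> s (\<lambda>t. \<bar>exchange_matrix d \<sigma> s t\<bar>) y) / A (s, y) / A (s, y + 1)"
    unfolding link_ext_def[abs_def] by (simp only: monomial_diff[OF A] ind)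
  then show ?thesis
    unfolding monomial_link[OF skew] by (simp add: abs mult.assoc cong: prod.cong)
qed

lemma in_vertices:
  fixes i :: "'m::nontriv mod_ring"
  shows "w \<in> (\<lambda>k. (s, i + of_nat k)) ` {..Suc (CARD('m) - 2)} \<longleftrightarrow> fst w = s"
proof
  assume "fst w = s"
  moreover obtain k where "k < CARD('m)" "snd w = i + of_nat k"
    by (rule mod_ring_index)
  ultimately show "w \<in> (\<lambda>k. (s, i + of_nat k)) ` {..Suc (CARD('m) - 2)}"
    by (intro image_eqI[of _ _ k]) (auto intro: prod_eqI)
qed auto

lemma lessThan_card: "{..<CARD('m::nontriv)} = {..Suc (CARD('m) - 2)}"
  using card_nontriv_ge_2[where 'm = 'm] by auto

lemma mutate_seq_upt:
  fixes S :: "('s::finite, 'm::nontriv, 'f::field_char_0, 'g::field_char_0) Qm_seed"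
  shows "mutate_seq s i [0..<k] S = \<lparr>
     quiver = \<lparr>weight = weight (quiver S),
       exch = cyclic_vertices.exch_seq (\<lambda>k. (s, i + of_nat k)) (exch (quiver S)) k\<rparr>,
     xvar = cyclic_vertices.X_seq (\<lambda>k. (s, i + of_nat k)) (exch (quiver S)) (xvar S) k,
     avar = cyclic_vertices.A_seq (\<lambda>k. (s, i + of_nat k)) (exch (quiver S)) (avar S) k\<rparr>"
proof -
  interpret cyclic_vertices "\<lambda>k. (s, i + of_nat k)" "CARD('m) - 2" "\<lambda>j. link (\<lambda>_ _. 0) s (\<lambda>_. 0) (i + of_nat j)"
    by (rule cyclic_vertices_link) (simp_all add: skew_symmetric_def)
  show ?thesis
    by (induction k) (simp_all add: mutate_seq_def mutate_def)
qed

text \<open>An outside neighbour is attached to exactly one summand: that of its own index for an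
  in-neighbour, the preceding one for an out-neighbour.\<close>

lemma prod_gauge_link:
  fixes g :: "'m::nontriv mod_ring \<Rightarrow> 'f::field_char_0"
  assumes "skew_symmetric \<sigma>"
  shows "(\<Prod>l\<le>Suc (CARD('m) - 2). g (i + of_nat l) powi link \<sigma> s c (i + of_nat l) w)
    = (if fst w \<in> out_nbrs \<sigma> s then g (snd w - 1) powi c (fst w)
       else if fst w \<in> in_nbrs \<sigma> s then g (snd w) powi c (fst w) else 1)"
proof -
  have "(\<Prod>l\<le>Suc (CARD('m) - 2). g (i + of_nat l) powi link \<sigma> s c (i + of_nat l) w)
      = (\<Prod>y\<in>UNIV. g y powi link \<sigma> s c y w)"
    unfolding lessThan_card[symmetric] by (rule prod_mod_ring[symmetric])
  also have "\<dots> = (\<Prod>y\<in>UNIV. if y = (if fst w \<in> out_nbrs \<sigma> s then snd w - 1 else snd w)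
      then if fst w \<in> out_nbrs \<sigma> s \<or> fst w \<in> in_nbrs \<sigma> s then g y powi c (fst w) else 1 else 1)"
    using nbrs_disjoint[OF assms, of "fst w" s]
    by (intro prod.cong) (auto simp: link_def algebra_simps)
  also have "\<dots> = (if fst w \<in> out_nbrs \<sigma> s \<or> fst w \<in> in_nbrs \<sigma> s
      then g (if fst w \<in> out_nbrs \<sigma> s then snd w - 1 else snd w) powi c (fst w) else 1)"
    by (simp only: prod.delta finite UNIV_I if_True)
  finally show ?thesis by auto
qed

lemma reflect_X_P:
  assumes "positive_part P" "\<And>w. X w \<in> P"
  shows "reflect_X d \<sigma> s X w \<in> P"
proof -
  interpret positive_part P by fact
  show ?thesis
    using assms(2) by (auto simp: reflect_X_def Let_def)
qed

lemma f_A_P: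
  assumes "positive_part P" "\<And>w. A w \<in> P"
  shows "f_A d \<sigma> A s \<in> P"
proof -
  interpret positive_part P by fact
  show ?thesis
    unfolding f_A_def by (intro sum mult divide prod powi assms one) auto
qed

lemma reflect_A_P:
  assumes "positive_part P" "\<And>w. A w \<in> P"
  shows "reflect_A d \<sigma> s A w \<in> P"
proof -
  interpret positive_part P by fact
  show ?thesis
    using assms(2) f_A_P[of P A, OF assms] by (auto simp: reflect_A_def)
qed

theorem R_at_eq:
  fixes S :: "('s::finite, 'm::nontriv, 'f::field_char_0, 'g::field_char_0) Qm_seed"
  assumes d: "\<And>s. d s > 0" and skew: "skew_symmetric \<sigma>"
    and P: "positive_part P" "positive_part P'" and Q: "quiver S = Qm d \<sigma>"
    and X: "\<And>w. xvar S w \<in> P" and A: "\<And>w. avar S w \<in> P'"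
  shows "R_at s i S
    = \<lparr>quiver = Qm d \<sigma>, xvar = reflect_X d \<sigma> s (xvar S), avar = reflect_A d \<sigma> s (avar S)\<rparr>"
proof -
  interpret PX: positive_part P by fact
  interpret PA: positive_part P' by fact
  let ?K = "CARD('m) - 2"
  let ?v = "\<lambda>k. (s, i + of_nat k)"
  let ?cA = "\<lambda>t. \<bar>exchange_matrix d \<sigma> s t\<bar>" and ?cX = "\<lambda>t. \<bar>exchange_matrix d \<sigma> t s\<bar>"
  let ?e = "exch (Qm d \<sigma> :: ('s \<times> 'm mod_ring) weighted_quiver)"
  let ?p = "?v ?K" and ?q = "?v (Suc ?K)"
  \<comment> \<open>The same cycle twice: row weights for the \<open>A\<close>-variables, column
    weights for the \<open>X\<close>-variables. \<open>exch_seq\<close> depends only on the vertices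
    and is common to both.\<close>
  interpret CA: cyclic_vertices ?v ?K "\<lambda>j. link \<sigma> s ?cA (i + of_nat j)"
    by (rule cyclic_vertices_link[OF skew]) simp
  interpret CX: cyclic_vertices ?v ?K "\<lambda>j. link \<sigma> s ?cX (i + of_nat j)"
    by (rule cyclic_vertices_link[OF skew]) simp
  define S' where "S' = \<lparr>quiver = Qm d \<sigma>, xvar = reflect_X d \<sigma> s (xvar S), avar = reflect_A d \<sigma> s (avar S)\<rparr>"
  have rows: "CA.rows 0 ?e"
    by (rule rows_link[OF skew]) (simp_all add: exch_Qm_row[OF skew d])
  have "CX.rows 0 (\<lambda>i j. - ?e j i)"
    by (rule rows_link[OF skew]) (simp_all only: exch_Qm_col[OF skew d] abs_ge_zero)
  then have cols: "CX.cols 0 ?e"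
    by (simp add: CX.cols_def)
  have good': "good_seed P P' S'"
    using reflect_X_P[of P "xvar S", OF P(1) X] reflect_A_P[of P' "avar S", OF P(2) A] skew_symmetrizable_Qm[of d, OF d]
    by (simp add: good_seed_def S'_def)
  have ne: "?p \<noteq> ?q"
    by (simp add: CA.v_eq)
  have pos: "of_nat CARD('m) + i - 2 = i + of_nat ?K" "of_nat CARD('m) + i - 1 = i + of_nat (Suc ?K)"
    unfolding of_nat_card_minus by simp_all
  let ?T = "mutate_seq s i [0..<?K] S" and ?T' = "mutate_seq s i [0..<?K] S'"
  let ?eK = "CA.exch_seq ?e ?K"
  have "CA.rows ?K ?eK"
    by (rule CA.rows_exch_seq[OF rows]) simp
  note rl = CA.rows_last[OF this]
  have "CX.cols ?K ?eK"
    by (rule CX.cols_exch_seq[OF cols]) simp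
  then have cl: "?eK w ?q = - ?eK w ?p" for w
    using CX.rows_last(1)[of "\<lambda>i j. - ?eK j i" w] by (simp add: CX.cols_def)
  have csum: "CA.csum (avar S) (Suc ?K) = f_A d \<sigma> (avar S) s"
  proof -
    note m = monomial_link_ext[OF skew PA.nz[OF A]]
    have ce: "CA.cexp j = link_ext \<sigma> s ?cA (i + of_nat j)" for j
      by (auto simp: CA.cexp_def link_ext_def CA.delta_def fun_eq_iff algebra_simps)
    have he: "CA.hexp 0 = link_ext \<sigma> s ?cA (i + of_nat (Suc ?K))"
      unfolding CA.hexp_def link_ext_def CA.delta_def fun_eq_iff of_nat_card_minus
      by (auto simp: algebra_simps)
    have "CA.csum (avar S) (Suc ?K) = (\<Sum>l\<le>Suc ?K. monomial (avar S) (link_ext \<sigma> s ?cA (i + of_nat l)))"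
      unfolding CA.csum_def ce he by (simp add: lessThan_Suc_atMost add.commute)
    also have "\<dots> = (\<Sum>y\<in>UNIV. monomial (avar S) (link_ext \<sigma> s ?cA y))"
      unfolding lessThan_card[symmetric] by (rule sum_mod_ring[symmetric])
    also have "\<dots> = f_A d \<sigma> (avar S) s"
      unfolding f_A_def by (rule sum.cong) (simp_all only: m)
    finally show ?thesis .
  qed
  have A': "avar S' = (\<lambda>w. avar S w * (if w \<in> ?v ` {..Suc ?K} then CA.csum (avar S) (Suc ?K) else 1))"
    unfolding csum in_vertices by (auto simp: S'_def reflect_A_def fun_eq_iff)
  have amid: "CA.A_mid ?e (avar S) (Transposition.transpose ?p ?q w) = CA.A_seq ?e (avar S') ?K w" for w
    unfolding A' by (rule CA.A_mid_scaled[OF P(2) A rows])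
  have xmid: "CX.X_mid ?e (xvar S) (Transposition.transpose ?p ?q w) = CX.X_seq ?e (xvar S') ?K w" for w
  proof -
    define x where "x = (\<lambda>j. xvar S (s, j))"
    have xP: "x j \<in> P" for j by (simp add: x_def X)
    \<comment> \<open>The shift makes \<open>f 0\<close> the value at the last vertex of the cycle
      and \<open>f (Suc k)\<close> the value at vertex \<open>k\<close>.\<close>
    define f where "f k = wsum x (i + of_nat k - 1)" for k
    have fP: "f k \<in> P" for k unfolding f_def using xP by auto
    have f_Suc: "f (Suc k) = wsum x (i + of_nat k)" for k
      by (simp add: f_def)
    have g: "xvar S (?v k) * f k / f (Suc k) = gauge x (i + of_nat k)" for k
      unfolding f_Suc by (simp add: f_def gauge_def x_def)
    show ?thesis
    proof (rule CX.X_mid_reflected[where X = "xvar S" and X' = "xvar S'" and f = f and u = "holonomy x" and P = P and \<epsilon> = ?e and w = w,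
          OF P(1) X cols fP], unfold g)
      show "f (Suc k) = 1 - holonomy x + xvar S (?v k) * f k" for k
        unfolding f_Suc by (subst wsum_rec) (simp add: f_def x_def)
      show "f (Suc (Suc ?K)) = f 0"
        unfolding f_Suc of_nat_card_minus by (simp add: f_def)
      show "f (Suc ?K) = CX.G (xvar S) (Suc ?K)"
        unfolding f_Suc G_eq_sum by (simp add: wsum_def x_def atLeast0AtMost)
      show "holonomy x = (\<Prod>l\<le>Suc ?K. xvar S (?v l))"
        unfolding holonomy_def lessThan_card[symmetric]
        by (subst prod_mod_ring[of _ i]) (simp add: x_def)
      show "xvar S' (?v 0) = xvar S (?v 0) / (gauge x (i + of_nat 0) * gauge x (i + of_nat (Suc ?K)))"
        unfolding of_nat_card_minus by (simp add: S'_def reflect_X_def Let_def x_def)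
      show "xvar S' (?v (Suc j)) = xvar S (?v (Suc j)) / (gauge x (i + of_nat (Suc j)) * gauge x (i + of_nat j))" for j
        by (simp add: S'_def reflect_X_def Let_def x_def algebra_simps)
      show "xvar S' w = xvar S w * (\<Prod>l\<le>Suc ?K. gauge x (i + of_nat l) powi link \<sigma> s ?cX (i + of_nat l) w)"
        if "w \<notin> ?v ` {..Suc ?K}" for w
        using that unfolding prod_gauge_link[OF skew] in_vertices
        by (auto simp: S'_def reflect_X_def Let_def x_def)
    qed
  qed
  have mid: "permute (Transposition.transpose ?p ?q) (mutate ?q (mutate ?p ?T)) = ?T'"
  proof -
    let ?t = "Transposition.transpose ?p ?q"
    have w: "(\<lambda>w. weight (Qm d \<sigma>) (?t w)) = weight (Qm d \<sigma>)"
      by (auto simp: Qm_def quiver_of_def Transposition.transpose_def fun_eq_iff)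
    have "mutate_matrix ?q (mutate_matrix ?p ?eK) (?t w) (?t z) = ?eK w z" for w z
      by (rule mutate_opposite_pair[OF ne]) (rule rl cl)+
    then have e: "(\<lambda>w z. mutate_matrix ?q (mutate_matrix ?p ?eK) (?t w) (?t z)) = ?eK"
      by (simp only:)
    have x: "(\<lambda>w. CX.X_mid ?e (xvar S) (?t w)) = CX.X_seq ?e (xvar S') ?K"
      by (simp only: xmid)
    have a: "(\<lambda>w. CA.A_mid ?e (avar S) (?t w)) = CA.A_seq ?e (avar S') ?K"
      by (simp only: amid)
    have Q': "quiver S' = Qm d \<sigma>"
      by (simp add: S'_def)
    show ?thesis
      unfolding mutate_seq_upt permute_def mutate_def
      by (simp only: inv_transpose_eq seed.select_convs weighted_quiver.select_convs Q Q'
          CA.A_mid_def[symmetric] CX.X_mid_def[symmetric] w e x a)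
  qed
  have "R_at s i S = mutate_seq s i (rev [0..<?K]) (permute (Transposition.transpose ?p ?q) (mutate ?q (mutate ?p ?T)))"
    by (simp only: R_at_def pos o_apply)
  also have "\<dots> = S'"
    unfolding mid by (rule mutate_seq_rev[OF P good'])
  finally show ?thesis
    by (simp add: S'_def)
qed

section \<open>The Weyl group action\<close>

definition scale2 ::
    "'s \<Rightarrow> 's \<Rightarrow> ('s \<times> 'i \<Rightarrow> 'g::field_char_0) \<Rightarrow> 'g \<Rightarrow> 'g \<Rightarrow> 's \<times> 'i \<Rightarrow> 'g" where
  "scale2 s t A x y w = (if fst w = s then x * A w else if fst w = t then y * A w else A w)"

lemma abs_exchange_matrix_nbrs:
  assumes "skew_symmetric \<sigma>"
  shows "u \<in> in_nbrs \<sigma> s \<Longrightarrow> \<bar>exchange_matrix d \<sigma> s u\<bar> = - exchange_matrix d \<sigma> s u"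
    and "u \<in> out_nbrs \<sigma> s \<Longrightarrow> \<bar>exchange_matrix d \<sigma> s u\<bar> = exchange_matrix d \<sigma> s u"
    and "u \<notin> in_nbrs \<sigma> s \<Longrightarrow> u \<notin> out_nbrs \<sigma> s \<Longrightarrow> exchange_matrix d \<sigma> s u = 0"
    and "u \<in> out_nbrs \<sigma> s \<longleftrightarrow> s \<in> in_nbrs \<sigma> u"
proof -
  have "\<sigma> s u = - \<sigma> u s"
    using assms unfolding skew_symmetric_def by blast
  then show "u \<in> in_nbrs \<sigma> s \<Longrightarrow> \<bar>exchange_matrix d \<sigma> s u\<bar> = - exchange_matrix d \<sigma> s u"
    "u \<in> out_nbrs \<sigma> s \<Longrightarrow> \<bar>exchange_matrix d \<sigma> s u\<bar> = exchange_matrix d \<sigma> s u"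
    "u \<notin> in_nbrs \<sigma> s \<Longrightarrow> u \<notin> out_nbrs \<sigma> s \<Longrightarrow> exchange_matrix d \<sigma> s u = 0"
    "u \<in> out_nbrs \<sigma> s \<longleftrightarrow> s \<in> in_nbrs \<sigma> u"
    by (auto simp: exchange_matrix_def abs_mult in_nbrs_def out_nbrs_def)
qed

text \<open>All summands of \<open>f_A\<close> have the same degrees, -2 in the
  \<open>s\<close>-variables and the absolute exchange entry in the \<open>t\<close>-variables, so
  the whole sum scales by one factor.\<close>

lemma f_A_scale2:
  fixes A :: "'s::finite \<times> 'm::nontriv mod_ring \<Rightarrow> 'g::field_char_0"
  assumes skew: "skew_symmetric \<sigma>" and st: "s \<noteq> t" and nz: "\<And>w. A w \<noteq> 0" "x \<noteq> 0" "y \<noteq> 0"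
  shows "f_A d \<sigma> (scale2 s t A x y) s = f_A d \<sigma> A s / (x * x) * y powi \<bar>exchange_matrix d \<sigma> s t\<bar>"
proof -
  let ?B = "scale2 s t A x y"
  let ?z = "\<lambda>w. if fst w = s then x else if fst w = t then y else 1"
  have z: "?B = (\<lambda>w. ?z w * A w)"
    by (auto simp: scale2_def)
  have nzB: "?B w \<noteq> 0" for w
    using nz by (simp add: scale2_def)
  have f: "f_A d \<sigma> A' s = (\<Sum>i\<in>UNIV. monomial A' (link_ext \<sigma> s (\<lambda>t. \<bar>exchange_matrix d \<sigma> s t\<bar>) i))"
    if "\<And>w. A' w \<noteq> 0" for A' :: "'s \<times> 'm mod_ring \<Rightarrow> 'g"
    unfolding f_A_def by (rule sum.cong) (simp_all only: monomial_link_ext[OF skew that])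
  have nzz: "?z w \<noteq> 0" for w :: "'s \<times> 'm mod_ring" using nz by simp
  have s: "s \<notin> in_nbrs \<sigma> s" "s \<notin> out_nbrs \<sigma> s"
    using not_in_nbrs_self[OF skew, of s] by auto
  have pr: "(\<Prod>u\<in>T. ?z (u, i) powi e u) = (if t \<in> T then y powi e t else 1)"
    if "s \<notin> T" for T :: "'s set" and i :: "'m mod_ring" and e
  proof -
    have "(\<Prod>u\<in>T. ?z (u, i) powi e u) = (\<Prod>u\<in>T. if u = t then y powi e t else 1)"
      using that by (intro prod.cong) auto
    then show ?thesis by simp
  qed
  have "monomial ?z (link_ext \<sigma> s (\<lambda>t. \<bar>exchange_matrix d \<sigma> s t\<bar>) i) = 1 / (x * x) * y powi \<bar>exchange_matrix d \<sigma> s t\<bar>"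
    for i :: "'m mod_ring"
    unfolding monomial_link_ext[of \<sigma> ?z, OF skew nzz] pr[OF s(1)] pr[OF s(2)]
    using nbrs_disjoint[OF skew, of t s] abs_exchange_matrix_nbrs(1-3)[OF skew, of t s d] by auto
  then show ?thesis
    unfolding f[OF nzB] f[OF nz(1)] unfolding z monomial_mult
    by (simp add: sum_distrib_left sum_distrib_right sum_divide_distrib mult.commute)
qed

lemma scale2_commute: "s \<noteq> t \<Longrightarrow> scale2 s t A x y = scale2 t s A y x"
  by (auto simp: scale2_def fun_eq_iff)

lemma reflect_A_scale2:
  fixes A :: "'s::finite \<times> 'm::nontriv mod_ring \<Rightarrow> 'g::field_char_0"
  assumes skew: "skew_symmetric \<sigma>" and st: "s \<noteq> t" and nz: "\<And>w. A w \<noteq> 0" "x \<noteq> 0" "y \<noteq> 0"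
  shows "reflect_A d \<sigma> s (scale2 s t A x y)
      = scale2 s t A (f_A d \<sigma> A s / x * y powi \<bar>exchange_matrix d \<sigma> s t\<bar>) y"
    and "reflect_A d \<sigma> t (scale2 s t A x y)
      = scale2 s t A x (f_A d \<sigma> A t / y * x powi \<bar>exchange_matrix d \<sigma> t s\<bar>)"
proof -
  show "reflect_A d \<sigma> s (scale2 s t A x y)
      = scale2 s t A (f_A d \<sigma> A s / x * y powi \<bar>exchange_matrix d \<sigma> s t\<bar>) y"
    using f_A_scale2[where A = A and d = d, OF skew st nz] nz(2)
    by (auto simp: fun_eq_iff reflect_A_def) (auto simp: scale2_def)
  show "reflect_A d \<sigma> t (scale2 s t A x y)
      = scale2 s t A x (f_A d \<sigma> A t / y * x powi \<bar>exchange_matrix d \<sigma> t s\<bar>)"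
    unfolding scale2_commute[OF st]
    using f_A_scale2[where A = A and d = d, OF skew st[symmetric] nz(1,3,2)] nz(3)
    by (auto simp: fun_eq_iff reflect_A_def) (auto simp: scale2_def)
qed

lemma reflect_A_involution:
  fixes A :: "'s::finite \<times> 'm::nontriv mod_ring \<Rightarrow> 'g::field_char_0"
  assumes skew: "skew_symmetric \<sigma>" and P: "positive_part P" "\<And>w. A w \<in> P"
  shows "reflect_A d \<sigma> s (reflect_A d \<sigma> s A) = A"
proof -
  interpret positive_part P by fact
  have fP: "f_A d \<sigma> A s \<in> P" by (rule f_A_P[OF P])
  note nzf = nz[OF fP]
  have nzA: "A w \<noteq> 0" "reflect_A d \<sigma> s A w \<noteq> 0" for w
    using nz[OF P(2)] nzf by (auto simp: reflect_A_def)
  have s: "s \<notin> in_nbrs \<sigma> s" "s \<notin> out_nbrs \<sigma> s"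
    using not_in_nbrs_self[OF skew, of s] by auto
  have "f_A d \<sigma> (reflect_A d \<sigma> s A) s = (\<Sum>i\<in>UNIV. 1 / (A (s, i) * A (s, i + 1))
        * (\<Prod>t\<in>in_nbrs \<sigma> s. A (t, i) powi (- exchange_matrix d \<sigma> s t))
        * (\<Prod>t\<in>out_nbrs \<sigma> s. A (t, i + 1) powi exchange_matrix d \<sigma> s t) / (f_A d \<sigma> A s * f_A d \<sigma> A s))"
    unfolding f_A_def[of d \<sigma> "reflect_A d \<sigma> s A"]
  proof (rule sum.cong, simp)
    fix i :: "'m mod_ring"
    have "(\<Prod>t\<in>in_nbrs \<sigma> s. reflect_A d \<sigma> s A (t, i) powi (- exchange_matrix d \<sigma> s t))
        = (\<Prod>t\<in>in_nbrs \<sigma> s. A (t, i) powi (- exchange_matrix d \<sigma> s t))"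
      "(\<Prod>t\<in>out_nbrs \<sigma> s. reflect_A d \<sigma> s A (t, i + 1) powi exchange_matrix d \<sigma> s t)
        = (\<Prod>t\<in>out_nbrs \<sigma> s. A (t, i + 1) powi exchange_matrix d \<sigma> s t)"
      using s by (auto intro!: prod.cong simp: reflect_A_def)
    then show "1 / (reflect_A d \<sigma> s A (s, i) * reflect_A d \<sigma> s A (s, i + 1))
        * (\<Prod>t\<in>in_nbrs \<sigma> s. reflect_A d \<sigma> s A (t, i) powi (- exchange_matrix d \<sigma> s t))
        * (\<Prod>t\<in>out_nbrs \<sigma> s. reflect_A d \<sigma> s A (t, i + 1) powi exchange_matrix d \<sigma> s t)
      = 1 / (A (s, i) * A (s, i + 1))
        * (\<Prod>t\<in>in_nbrs \<sigma> s. A (t, i) powi (- exchange_matrix d \<sigma> s t))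
        * (\<Prod>t\<in>out_nbrs \<sigma> s. A (t, i + 1) powi exchange_matrix d \<sigma> s t) / (f_A d \<sigma> A s * f_A d \<sigma> A s)"
      by (simp only:) (simp add: reflect_A_def mult_ac)
  qed
  also have "\<dots> = f_A d \<sigma> A s / (f_A d \<sigma> A s * f_A d \<sigma> A s)"
    unfolding sum_divide_distrib[symmetric] by (simp only: f_A_def[of d \<sigma> A s])
  also have "\<dots> = 1 / f_A d \<sigma> A s"
    using nzf by simp
  finally have fr: "f_A d \<sigma> (reflect_A d \<sigma> s A) s = 1 / f_A d \<sigma> A s" .
  show ?thesis
    unfolding fun_eq_iff
  proof
    fix w
    show "reflect_A d \<sigma> s (reflect_A d \<sigma> s A) w = A w"
      by (subst reflect_A_def) (simp add: fr, simp add: reflect_A_def nzf)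
  qed
qed

lemma reflect_A_order:
  fixes A :: "'s::finite \<times> 'm::nontriv mod_ring \<Rightarrow> 'g::field_char_0"
  assumes skew: "skew_symmetric \<sigma>" and P: "positive_part P" "\<And>w. A w \<in> P" and st: "s \<noteq> t"
    and n: "(\<bar>exchange_matrix d \<sigma> s t\<bar>, \<bar>exchange_matrix d \<sigma> t s\<bar>, n)
      \<in> {(0, 0, 2), (1, 1, 3), (1, 2, 4), (2, 1, 4), (1, 3, 6), (3, 1, 6)}"
  shows "((reflect_A d \<sigma> s \<circ> reflect_A d \<sigma> t) ^^ n) A = A"
proof -
  interpret positive_part P by fact
  let ?a = "\<bar>exchange_matrix d \<sigma> s t\<bar>" and ?b = "\<bar>exchange_matrix d \<sigma> t s\<bar>"
  define F where "F = f_A d \<sigma> A s"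
  define H where "H = f_A d \<sigma> A t"
  have nzFH: "F \<noteq> 0" "H \<noteq> 0"
    unfolding F_def H_def by (rule nz[OF f_A_P[OF P]])+
  \<comment> \<open>Only the exponents of \<open>F\<close> and \<open>H\<close> matter, and these evolve linearly.\<close>
  define st where "st e = (case e of (p, q, p', q') \<Rightarrow>
    scale2 s t A (F powi p * H powi q) (F powi p' * H powi q'))" for e
  \<comment> \<open>The reflection in \<open>t\<close> acts first, so its new exponents
    \<open>p2\<close>, \<open>q2\<close> enter those of \<open>s\<close>. The summands 1 record the
    fresh factor \<open>H\<close> in the first case and \<open>F\<close> in the second.\<close>
  define step where "step a b e = (case e of (p, q, p', q') \<Rightarrow>
    let p2 = b * p - p'; q2 = b * q - q' + 1 in (a * p2 - p + 1, a * q2 - q, p2, q2))"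
    for a b :: int and e :: "int \<times> int \<times> int \<times> int"
  have nzst: "F powi p * H powi q \<noteq> 0" for p q using nzFH by simp
  have quot: "F / (F powi p * H powi q) * (F powi p' * H powi q') = F powi (p' - p + 1) * H powi (q' - q)"
    "H / (F powi p * H powi q) * (F powi p' * H powi q') = F powi (p' - p) * H powi (q' - q + 1)"
    for p q p' q'
    using nzFH by (simp_all add: power_int_add power_int_diff)
  have pow: "(F powi p * H powi q) powi a = F powi (a * p) * H powi (a * q)" for p q a
    by (simp add: power_int_mult_distrib power_int_mult[symmetric] mult.commute[of a])
  have "(reflect_A d \<sigma> s \<circ> reflect_A d \<sigma> t) (st e) = st (step ?a ?b e)" for e
  proof -
    obtain p q p' q' where e: "e = (p, q, p', q')" by (cases e)
    let ?p2 = "?b * p - p'" and ?q2 = "?b * q - q' + 1"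
    have 1: "H / (F powi p' * H powi q') * (F powi p * H powi q) powi ?b = F powi ?p2 * H powi ?q2"
      by (simp only: pow quot)
    have 2: "F / (F powi p * H powi q) * (F powi ?p2 * H powi ?q2) powi ?a
        = F powi (?a * ?p2 - p + 1) * H powi (?a * ?q2 - q)"
      by (simp only: pow quot)
    show ?thesis
      unfolding e st_def step_def Let_def prod.case o_apply
      by (simp only: reflect_A_scale2[OF skew st nz[OF P(2)] nzst nzst] F_def[symmetric] H_def[symmetric] 1 2)
  qed
  then have "((reflect_A d \<sigma> s \<circ> reflect_A d \<sigma> t) ^^ k) (st e) = st ((step ?a ?b ^^ k) e)" for k e
    by (induction k) (simp_all only: funpow.simps id_apply o_apply)
  moreover have "(step ?a ?b ^^ n) (0, 0, 0, 0) = (0, 0, 0, 0)"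
    using n by (auto simp: step_def eval_nat_numeral)
  moreover have "st (0, 0, 0, 0) = A"
    by (auto simp: st_def scale2_def fun_eq_iff)
  ultimately show ?thesis by metis
qed

section \<open>Relations between the reflections of the \<open>X\<close>-variables\<close>

definition gauge_effect ::
    "('s \<Rightarrow> nat) \<Rightarrow> ('s \<Rightarrow> 's \<Rightarrow> int) \<Rightarrow> 's \<Rightarrow> 's
      \<Rightarrow> ('m::nontriv mod_ring \<Rightarrow> 'f::field_char_0) \<Rightarrow> 'm mod_ring \<Rightarrow> 'f" where
  "gauge_effect d \<sigma> u s Y j =
     (if u = s then 1 / (Y j * Y (j - 1))
      else if u \<in> out_nbrs \<sigma> s then Y (j - 1) powi \<bar>exchange_matrix d \<sigma> u s\<bar>
      else if u \<in> in_nbrs \<sigma> s then Y j powi \<bar>exchange_matrix d \<sigma> u s\<bar>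
      else 1)"

lemma reflect_X_gauge_effect:
  "reflect_X d \<sigma> s X = (\<lambda>(u, j). X (u, j) * gauge_effect d \<sigma> u s (gauge (\<lambda>j. X (s, j))) j)"
  by (auto simp: fun_eq_iff reflect_X_def gauge_effect_def Let_def)

text \<open>Multiplicativity lets repeated reflections at one node be recorded by a single
  accumulated gauge factor.\<close>

lemma gauge_effect_mult:
  "gauge_effect d \<sigma> u s (\<lambda>j. Y j * Z j) j = gauge_effect d \<sigma> u s Y j * gauge_effect d \<sigma> u s Z j"
  by (simp add: gauge_effect_def power_int_mult_distrib)

lemma gauge_effect_one: "gauge_effect d \<sigma> u s (\<lambda>_. 1) j = 1"
  by (simp add: gauge_effect_def)

text \<open>The variables reached from \<open>X\<close> when the accumulated gauge factors of \<open>s\<close> and \<open>t\<close> are \<open>Y\<close> and \<open>Z\<close>.\<close>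

definition transport ::
    "('s \<Rightarrow> nat) \<Rightarrow> ('s \<Rightarrow> 's \<Rightarrow> int) \<Rightarrow> 's \<Rightarrow> 's
      \<Rightarrow> ('s \<times> 'm::nontriv mod_ring \<Rightarrow> 'f::field_char_0)
      \<Rightarrow> ('m mod_ring \<Rightarrow> 'f) \<Rightarrow> ('m mod_ring \<Rightarrow> 'f) \<Rightarrow> 's \<times> 'm mod_ring \<Rightarrow> 'f" where
  "transport d \<sigma> s t X Y Z = (\<lambda>(u, j). X (u, j) * gauge_effect d \<sigma> u s Y j * gauge_effect d \<sigma> u t Z j)"

lemma transport_one: "transport d \<sigma> s t X (\<lambda>_. 1) (\<lambda>_. 1) = X"
  by (auto simp: transport_def gauge_effect_one)

lemma reflect_X_transport:
  "reflect_X d \<sigma> s (transport d \<sigma> s t X Y Z)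
    = transport d \<sigma> s t X (\<lambda>j. Y j * gauge (\<lambda>j. transport d \<sigma> s t X Y Z (s, j)) j) Z"
  "reflect_X d \<sigma> t (transport d \<sigma> s t X Y Z)
    = transport d \<sigma> s t X Y (\<lambda>j. Z j * gauge (\<lambda>j. transport d \<sigma> s t X Y Z (t, j)) j)"
  by (subst reflect_X_gauge_effect, auto simp: fun_eq_iff transport_def gauge_effect_mult mult_ac)+

lemma gauge_shift: "gauge (\<lambda>j. x (j - c)) j = gauge x (j - c)"
proof -
  have "wsum (\<lambda>j. x (j - c)) i = wsum x (i - c)" for i
  proof -
    have "i - of_nat l - c = i - c - of_nat l" for l :: nat
      by (simp add: algebra_simps)
    then show ?thesis unfolding wsum_def by (simp only:)
  qed
  moreover have "j - 1 - c = j - c - 1" by (simp add: algebra_simps)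
  ultimately show ?thesis unfolding gauge_def by (simp only:)
qed

lemma holonomy_generic:
  fixes X :: "'s::finite \<times> 'm::nontriv mod_ring \<Rightarrow> 'f::field_char_0"
  assumes "algebraically_independent X" "s \<noteq> t" "p + q \<noteq> 0"
  shows "holonomy (\<lambda>j. X (s, j)) ^ p * holonomy (\<lambda>j. X (t, j)) ^ q \<noteq> 1"
proof -
  let ?e = "\<lambda>w :: 's \<times> 'm mod_ring. if fst w = s then p else if fst w = t then q else 0"
  have "monom_eval X ?e = (\<Prod>u\<in>UNIV. \<Prod>j\<in>UNIV. X (u, j) ^ ?e (u, j))"
    unfolding monom_eval_def UNIV_Times_UNIV[symmetric]
    by (subst prod.cartesian_product) (auto intro!: prod.cong)
  also have "\<dots> = (\<Prod>u\<in>UNIV. (if u = s then holonomy (\<lambda>j. X (s, j)) ^ p else 1)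
      * (if u = t then holonomy (\<lambda>j. X (t, j)) ^ q else 1))"
    using assms(2) by (intro prod.cong) (auto simp: holonomy_def prod_power_distrib)
  also have "\<dots> = holonomy (\<lambda>j. X (s, j)) ^ p * holonomy (\<lambda>j. X (t, j)) ^ q"
    by (simp add: prod.distrib)
  finally have "monom_eval X ?e = holonomy (\<lambda>j. X (s, j)) ^ p * holonomy (\<lambda>j. X (t, j)) ^ q" .
  moreover have "monom_eval X ?e \<noteq> 1"
  proof (cases "p = 0")
    case True
    then have "?e (t, 0) \<noteq> 0" using assms(2,3) by simp
    then show ?thesis by (rule monom_eval_neq_1[OF assms(1)])
  next
    case False
    then have "?e (s, 0) \<noteq> 0" by simp
    then show ?thesis by (rule monom_eval_neq_1[OF assms(1)])
  qed
  ultimately show ?thesis by (simp only: not_False_eq_True)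
qed

lemma reflect_X_involution:
  fixes X :: "'s::finite \<times> 'm::nontriv mod_ring \<Rightarrow> 'f::field_char_0"
  assumes P: "positive_part P" "\<And>w. X w \<in> P"
  shows "reflect_X d \<sigma> s (reflect_X d \<sigma> s X) = X"
proof -
  interpret positive_part P by fact
  define x where "x = (\<lambda>j. X (s, j))"
  have xP: "x j \<in> P" for j using P by (simp add: x_def)
  have gP: "gauge x j \<in> P" for j using xP by auto
  have nzg: "gauge x j \<noteq> 0" for j by (rule nz[OF gP])
  have g: "gauge (\<lambda>j. x j / (gauge x j * gauge x (j - 1))) = (\<lambda>j. 1 / gauge x j)"
  proof (cases "holonomy x = 1")
    case True
    have "x i * wsum x (i - 1) = wsum x i" for i
      by (subst (2) wsum_rec) (simp add: True)
    then have "gauge x i = 1" for i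
      unfolding gauge_def using nz[OF wsum_P[of x i, OF xP]] by simp
    then have "gauge x = (\<lambda>_. 1)" by (simp add: fun_eq_iff)
    then show ?thesis by simp
  next
    case False
    with xP show ?thesis by (rule gauge_reflect)
  qed
  have "(\<lambda>j. reflect_X d \<sigma> s X (s, j)) = (\<lambda>j. x j / (gauge x j * gauge x (j - 1)))"
    by (simp add: reflect_X_def Let_def x_def)
  then have g2: "gauge (\<lambda>j. reflect_X d \<sigma> s X (s, j)) = (\<lambda>j. 1 / gauge x j)"
    using g by simp
  have r: "reflect_X d \<sigma> s X (u, j) = X (u, j) * gauge_effect d \<sigma> u s (gauge x) j" for u j
    by (simp add: reflect_X_gauge_effect x_def)
  have "reflect_X d \<sigma> s (reflect_X d \<sigma> s X)
      = (\<lambda>(u, j). X (u, j) * (gauge_effect d \<sigma> u s (gauge x) j * gauge_effect d \<sigma> u s (\<lambda>j. 1 / gauge x j) j))"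
    unfolding reflect_X_gauge_effect[of d \<sigma> s "reflect_X d \<sigma> s X"] g2
    unfolding r mult.assoc ..
  then show ?thesis
    unfolding gauge_effect_mult[symmetric] by (simp add: nzg gauge_effect_one)
qed

lemma reflect_X_commute:
  fixes X :: "'s::finite \<times> 'm::nontriv mod_ring \<Rightarrow> 'f::field_char_0"
  assumes "\<And>(Y :: 'm mod_ring \<Rightarrow> 'f) j. gauge_effect d \<sigma> s t Y j = 1"
    and "\<And>(Y :: 'm mod_ring \<Rightarrow> 'f) j. gauge_effect d \<sigma> t s Y j = 1"
  shows "reflect_X d \<sigma> s (reflect_X d \<sigma> t X) = reflect_X d \<sigma> t (reflect_X d \<sigma> s X)"
  by (subst (1 2 3 4) reflect_X_gauge_effect) (auto simp: fun_eq_iff assms mult_ac)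

text \<open>\<open>emb\<close> parametrizes the orbit by pairs of accumulated gauge factors and
  reduces the claim to \<open>pair_order\<close>. Node \<open>s\<close> is the centre, since it
  receives the factor of \<open>t\<close> with multiplicity \<open>r\<close>.\<close>

lemma reflect_X_order:
  fixes X :: "'s::finite \<times> 'm::nontriv mod_ring \<Rightarrow> 'f::field_char_0"
  assumes skew: "skew_symmetric \<sigma>" and P: "positive_part P" "\<And>w. X w \<in> P"
    and indep: "algebraically_independent X" and ct: "s \<noteq> t"
    and r: "\<bar>exchange_matrix d \<sigma> s t\<bar> = int r" "\<bar>exchange_matrix d \<sigma> t s\<bar> = 1"
    and rn: "(r, n) \<in> {(1, 3), (2, 4), (3, 6)}"
  shows "((reflect_X d \<sigma> s \<circ> reflect_X d \<sigma> t) ^^ n) X = X"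
proof -
  interpret positive_part P by fact
  \<comment> \<open>Shifting the indices of \<open>t\<close> by \<open>\<kappa>\<close> makes the arrows point from \<open>s\<close> to \<open>t\<close>.\<close>
  define \<kappa> :: "'m mod_ring" where "\<kappa> = (if t \<in> out_nbrs \<sigma> s then 0 else 1)"
  have nb: "t \<in> out_nbrs \<sigma> s \<or> t \<in> in_nbrs \<sigma> s"
  proof -
    have "exchange_matrix d \<sigma> s t \<noteq> 0" using r(1) rn by auto
    then show ?thesis using abs_exchange_matrix_nbrs(3)[OF skew, of t s d] by blast
  qed
  have ts: "gauge_effect d \<sigma> t s Y j = Y (j - 1 + \<kappa>)" for Y :: "'m mod_ring \<Rightarrow> 'f" and j
    using ct nb nbrs_disjoint[OF skew, of t s] by (auto simp: gauge_effect_def r \<kappa>_def)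
  have st: "gauge_effect d \<sigma> s t Z j = Z (j - \<kappa>) ^ r" for Z :: "'m mod_ring \<Rightarrow> 'f" and j
    using ct nb nbrs_disjoint[OF skew, of t s] nbrs_disjoint[OF skew, of s t]
      abs_exchange_matrix_nbrs(4)[OF skew, of t s] abs_exchange_matrix_nbrs(4)[OF skew, of s t]
    by (auto simp: gauge_effect_def r \<kappa>_def)
  define a where "a = (\<lambda>j. X (s, j))"
  define b where "b = (\<lambda>j. X (t, j - \<kappa>))"
  define emb where "emb p = transport d \<sigma> s t X (fst p) (\<lambda>j. snd p (j + \<kappa>))"
    for p :: "('m mod_ring \<Rightarrow> 'f) \<times> ('m mod_ring \<Rightarrow> 'f)"
  have center: "reflect_X d \<sigma> s (emb p) = emb (pair_center r a p)" for p
  proof -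
    have "transport d \<sigma> s t X (fst p) (\<lambda>j. snd p (j + \<kappa>)) (s, j)
        = a j / (fst p j * fst p (j - 1)) * snd p j ^ r" for j
      unfolding transport_def prod.case st by (simp add: a_def gauge_effect_def)
    then show ?thesis
      by (cases p) (simp add: emb_def reflect_X_transport pair_center_def)
  qed
  have leaf: "reflect_X d \<sigma> t (emb p) = emb (pair_leaf b p)" for p
  proof -
    let ?y = "\<lambda>j. b j / (snd p j * snd p (j - 1)) * fst p (j - 1)"
    have "transport d \<sigma> s t X (fst p) (\<lambda>j. snd p (j + \<kappa>)) (t, j) = ?y (j - (- \<kappa>))" for j
      unfolding transport_def prod.case ts by (simp add: b_def gauge_effect_def algebra_simps)
    then have "gauge (\<lambda>j. transport d \<sigma> s t X (fst p) (\<lambda>j. snd p (j + \<kappa>)) (t, j)) j = gauge ?y (j + \<kappa>)" for j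
      using gauge_shift[of ?y "- \<kappa>" j] by simp
    then show ?thesis
      by (cases p) (simp add: emb_def reflect_X_transport pair_leaf_def)
  qed
  have "((reflect_X d \<sigma> s \<circ> reflect_X d \<sigma> t) ^^ k) (emb p) = emb (((pair_center r a \<circ> pair_leaf b) ^^ k) p)" for k p
    by (induction k) (simp_all only: funpow.simps id_apply o_apply center leaf)
  moreover have "((pair_center r a \<circ> pair_leaf b) ^^ n) (\<lambda>_. 1, \<lambda>_. 1) = (\<lambda>_. 1, \<lambda>_. 1)"
  proof (rule pair_order[OF _ _ _ rn])
    show "holonomy a ^ p * holonomy b ^ q \<noteq> 1" if "p + q \<noteq> 0" for p q
      using holonomy_generic[OF indep ct that] holonomy_shift[of "\<lambda>j. X (t, j)" \<kappa>]
      by (simp add: a_def b_def)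
  qed (simp_all add: a_def b_def P)
  moreover have "emb (\<lambda>_. 1, \<lambda>_. 1) = X"
    by (simp add: emb_def transport_one)
  ultimately show ?thesis by metis
qed

text \<open>Where \<open>f\<close> and \<open>g\<close> are involutions, the two alternating words
  are inverse to each other. This covers pairs in which the second node has to be the centre of the
  star.\<close>

lemma funpow_order_swap:
  assumes closed: "\<And>x. x \<in> V \<Longrightarrow> f x \<in> V" "\<And>x. x \<in> V \<Longrightarrow> g x \<in> V"
    and inv: "\<And>x. x \<in> V \<Longrightarrow> f (f x) = x" "\<And>x. x \<in> V \<Longrightarrow> g (g x) = x"
    and x: "x \<in> V" and order: "((f \<circ> g) ^^ n) x = x"
  shows "((g \<circ> f) ^^ n) x = x"
proof -
  have V: "((f \<circ> g) ^^ n) x \<in> V" for n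
    by (induction n) (simp_all add: x closed)
  have "((g \<circ> f) ^^ n) (((f \<circ> g) ^^ n) x) = x" for n
  proof (induction n)
    case (Suc n)
    have "((g \<circ> f) ^^ Suc n) (((f \<circ> g) ^^ Suc n) x) = ((g \<circ> f) ^^ n) ((g \<circ> f) ((f \<circ> g) (((f \<circ> g) ^^ n) x)))"
      unfolding funpow_Suc_right[of n "g \<circ> f"] funpow.simps(2)[of n "f \<circ> g"] by (simp only: o_apply)
    also have "(g \<circ> f) ((f \<circ> g) (((f \<circ> g) ^^ n) x)) = ((f \<circ> g) ^^ n) x"
      using V[of n] by (simp add: inv closed)
    finally show ?case using Suc by (simp only:)
  qed simp
  from this[of n] show ?thesis by (simp only: order)
qed

lemma int_product_le_3:
  fixes a b :: int
  assumes "a \<ge> 0" "b \<ge> 0" "a * b \<in> {1, 2, 3}"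
  shows "(a, b) \<in> {(1, 1), (1, 2), (2, 1), (1, 3), (3, 1)}"
proof -
  have "a \<noteq> 0" "b \<noteq> 0" using assms(3) by auto
  with assms(1,2) have pos: "a \<ge> 1" "b \<ge> 1" by linarith+
  have "a * 1 \<le> a * b" by (rule mult_left_mono) (use pos in linarith)+
  moreover have "1 * b \<le> a * b" by (rule mult_right_mono) (use pos in linarith)+
  moreover have "a * b \<le> 3" using assms(3) by auto
  ultimately have "a \<le> 3" "b \<le> 3" by linarith+
  with pos have "a \<in> {1, 2, 3}" "b \<in> {1, 2, 3}" by auto
  then show ?thesis using assms(3) by auto
qed

lemma reflect_X_coxeter:
  fixes X :: "'s::finite \<times> 'm::nontriv mod_ring \<Rightarrow> 'f::field_char_0"
  assumes skew: "skew_symmetric \<sigma>" and P: "positive_part P" "\<And>w. X w \<in> P"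
    and indep: "algebraically_independent X" and ne: "s \<noteq> t"
    and n: "(\<bar>exchange_matrix d \<sigma> s t\<bar>, \<bar>exchange_matrix d \<sigma> t s\<bar>, n)
      \<in> {(0, 0, 2), (1, 1, 3), (1, 2, 4), (2, 1, 4), (1, 3, 6), (3, 1, 6)}"
  shows "((reflect_X d \<sigma> s \<circ> reflect_X d \<sigma> t) ^^ n) X = X"
proof -
  have closed: "reflect_X d \<sigma> u Y w \<in> P" if "\<And>w. Y w \<in> P" for u Y w
    by (rule reflect_X_P[OF P(1) that])
  have invol: "reflect_X d \<sigma> u (reflect_X d \<sigma> u Y) = Y" if "\<And>w. Y w \<in> P" for u Y
    by (rule reflect_X_involution[OF P(1) that])
  consider "\<bar>exchange_matrix d \<sigma> s t\<bar> = 0" "\<bar>exchange_matrix d \<sigma> t s\<bar> = 0" "n = 2"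
    | "\<bar>exchange_matrix d \<sigma> t s\<bar> = 1" "(nat \<bar>exchange_matrix d \<sigma> s t\<bar>, n) \<in> {(1, 3), (2, 4), (3, 6)}"
    | "\<bar>exchange_matrix d \<sigma> s t\<bar> = 1" "(nat \<bar>exchange_matrix d \<sigma> t s\<bar>, n) \<in> {(1, 3), (2, 4), (3, 6)}"
    using n by auto
  then show ?thesis
  proof cases
    case 1
    have e: "gauge_effect d \<sigma> s t Y j = 1" "gauge_effect d \<sigma> t s Y j = 1"
      for Y :: "'m mod_ring \<Rightarrow> 'f" and j
      using 1 ne by (auto simp: gauge_effect_def)
    have "((reflect_X d \<sigma> s \<circ> reflect_X d \<sigma> t) ^^ n) X
        = reflect_X d \<sigma> s (reflect_X d \<sigma> t (reflect_X d \<sigma> s (reflect_X d \<sigma> t X)))"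
      using 1 by (simp add: eval_nat_numeral)
    also have "\<dots> = X"
      unfolding reflect_X_commute[of d \<sigma> t s, OF e(2,1)]
      using closed[of X t] P(2) by (simp add: invol closed)
    finally show ?thesis .
  next
    case 2
    then show ?thesis
      by (intro reflect_X_order[OF skew P indep ne _ 2]) simp_all
  next
    case 3
    then have ts: "((reflect_X d \<sigma> t \<circ> reflect_X d \<sigma> s) ^^ n) X = X"
      by (intro reflect_X_order[OF skew P indep ne[symmetric] _ 3]) simp_all
    have V: "reflect_X d \<sigma> u Y \<in> {Y. \<forall>w. Y w \<in> P}" "reflect_X d \<sigma> u (reflect_X d \<sigma> u Y) = Y"
      if "Y \<in> {Y. \<forall>w. Y w \<in> P}" for u Y
    proof -
      have "Y w \<in> P" for w using that by blast
      from closed[of Y u, OF this] invol[of Y u, OF this]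
      show "reflect_X d \<sigma> u Y \<in> {Y. \<forall>w. Y w \<in> P}" "reflect_X d \<sigma> u (reflect_X d \<sigma> u Y) = Y"
        by blast+
    qed
    have "X \<in> {Y. \<forall>w. Y w \<in> P}"
      using P(2) by simp
    from funpow_order_swap[OF V(1) V(1) V(2) V(2) this ts] show ?thesis .
  qed
qed

text \<open>Reflections preserve positivity, so \<open>R_at_eq\<close> applies to every iterate and
  the two families of variables can be followed separately.\<close>

lemma R_funpow:
  fixes S :: "('s::finite, 'm::nontriv, 'f::field_char_0, 'g::field_char_0) Qm_seed"
  assumes d: "\<And>s. d s > 0" and skew: "skew_symmetric \<sigma>"
    and P: "positive_part P" "positive_part P'" and Q: "quiver S = Qm d \<sigma>"
    and X: "\<And>w. xvar S w \<in> P" and A: "\<And>w. avar S w \<in> P'"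
  shows "((R s \<circ> R t) ^^ n) S = \<lparr>quiver = Qm d \<sigma>,
      xvar = ((reflect_X d \<sigma> s \<circ> reflect_X d \<sigma> t) ^^ n) (xvar S),
      avar = ((reflect_A d \<sigma> s \<circ> reflect_A d \<sigma> t) ^^ n) (avar S)\<rparr>"
proof -
  have step: "R u T = \<lparr>quiver = Qm d \<sigma>, xvar = reflect_X d \<sigma> u (xvar T), avar = reflect_A d \<sigma> u (avar T)\<rparr>"
    if "quiver T = Qm d \<sigma>" "\<And>w. xvar T w \<in> P" "\<And>w. avar T w \<in> P'"
    for u and T :: "('s, 'm, 'f, 'g) Qm_seed"
    unfolding R_def by (rule R_at_eq[OF d skew P that])
  have X': "reflect_X d \<sigma> u Y w \<in> P" if "\<And>w. Y w \<in> P" for u Y w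
    by (rule reflect_X_P[OF P(1) that])
  have A': "reflect_A d \<sigma> u Y w \<in> P'" if "\<And>w. Y w \<in> P'" for u Y w
    by (rule reflect_A_P[OF P(2) that])
  let ?X = "\<lambda>n. ((reflect_X d \<sigma> s \<circ> reflect_X d \<sigma> t) ^^ n) (xvar S)"
  let ?A = "\<lambda>n. ((reflect_A d \<sigma> s \<circ> reflect_A d \<sigma> t) ^^ n) (avar S)"
  have XA: "?X n w \<in> P" "?A n w \<in> P'" for n w
  proof -
    show "?X n w \<in> P" by (induction n arbitrary: w) (simp_all add: X X')
    show "?A n w \<in> P'" by (induction n arbitrary: w) (simp_all add: A A')
  qed
  show ?thesis
  proof (induction n)
    case 0
    then show ?case using Q by simp
  next
    case (Suc n)
    have t: "R t \<lparr>quiver = Qm d \<sigma>, xvar = ?X n, avar = ?A n\<rparr>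
        = \<lparr>quiver = Qm d \<sigma>, xvar = reflect_X d \<sigma> t (?X n), avar = reflect_A d \<sigma> t (?A n)\<rparr>"
      by (subst step) (simp_all only: seed.select_convs XA)
    have s: "R s \<lparr>quiver = Qm d \<sigma>, xvar = reflect_X d \<sigma> t (?X n), avar = reflect_A d \<sigma> t (?A n)\<rparr>
        = \<lparr>quiver = Qm d \<sigma>, xvar = ?X (Suc n), avar = ?A (Suc n)\<rparr>"
      by (subst step) (simp_all only: seed.select_convs XA X' A' funpow.simps o_apply)
    have "((R s \<circ> R t) ^^ Suc n) S = R s (R t (((R s \<circ> R t) ^^ n) S))"
      by (simp only: funpow.simps o_apply)
    then show ?case
      by (simp only: Suc.IH t s)
  qed
qed

text \<open>The absolute values resolve because the exchange entry \<open>t s\<close> is not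
  positive for \<open>t\<close> in \<open>out_nbrs \<sigma> s\<close> and not negative for
  \<open>t\<close> in \<open>in_nbrs \<sigma> s\<close>.\<close>

lemma reflect_X_formula:
  fixes X :: "'s::finite \<times> 'm::nontriv mod_ring \<Rightarrow> 'f::field_char_0"
  assumes skew: "skew_symmetric \<sigma>" and P: "positive_part P" "\<And>w. X w \<in> P"
  shows "reflect_X d \<sigma> s X (t, j) =
    (let f = f_X X s; \<epsilon> = exchange_matrix d \<sigma> in
     if t = s then f j / (X (s, j - 1) * f (j - 2))
     else if t \<in> out_nbrs \<sigma> s then X (t, j) * ((X (s, j - 1) * f (j - 2)) / f (j - 1)) powi (- \<epsilon> t s)
     else if t \<in> in_nbrs \<sigma> s then X (t, j) * ((X (s, j) * f (j - 1)) / f j) powi \<epsilon> t s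
     else X (t, j))"
proof -
  interpret positive_part P by fact
  let ?x = "\<lambda>j. X (s, j)"
  have w: "wsum ?x i \<noteq> 0" for i
    by (rule nz) (simp add: wsum_P P(2))
  have x: "X v \<noteq> 0" for v by (rule nz[OF P(2)])
  have two: "j - 1 - 1 = j - 2" by simp
  have self: "X (s, j) / (gauge ?x j * gauge ?x (j - 1)) = wsum ?x j / (X (s, j - 1) * wsum ?x (j - 2))"
    using w x unfolding gauge_def two by simp
  have out: "\<bar>exchange_matrix d \<sigma> t s\<bar> = - exchange_matrix d \<sigma> t s" if "t \<in> out_nbrs \<sigma> s"
    using that unfolding abs_exchange_matrix_nbrs(4)[OF skew]
    by (rule abs_exchange_matrix_nbrs(1)[OF skew])
  have inn: "\<bar>exchange_matrix d \<sigma> t s\<bar> = exchange_matrix d \<sigma> t s" if "t \<in> in_nbrs \<sigma> s"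
    using that unfolding abs_exchange_matrix_nbrs(4)[OF skew, symmetric]
    by (rule abs_exchange_matrix_nbrs(2)[OF skew])
  consider "t = s" | "t \<noteq> s" "t \<in> out_nbrs \<sigma> s" | "t \<noteq> s" "t \<notin> out_nbrs \<sigma> s" "t \<in> in_nbrs \<sigma> s"
    | "t \<noteq> s" "t \<notin> out_nbrs \<sigma> s" "t \<notin> in_nbrs \<sigma> s"
    by blast
  then show ?thesis
  proof cases
    case 1
    then show ?thesis
      using self by (simp add: reflect_X_def f_X_eq_wsum Let_def)
  next
    case 2
    then show ?thesis
      by (simp add: reflect_X_def f_X_eq_wsum Let_def out) (simp add: gauge_def)
  next
    case 3
    then show ?thesis
      by (simp add: reflect_X_def f_X_eq_wsum Let_def inn) (simp add: gauge_def)
  next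
    case 4
    then show ?thesis
      by (simp add: reflect_X_def)
  qed
qed

theorem theorem3p10:
  fixes C :: "'s::finite \<Rightarrow> 's \<Rightarrow> int"
    and d :: "'s \<Rightarrow> nat"
    and \<sigma> :: "'s \<Rightarrow> 's \<Rightarrow> int"
    and S :: "('s, 'm::nontriv, 'f::field_char_0, 'g::field_char_0) Qm_seed"
  assumes "generalized_cartan_matrix C"
    and "symmetrizer C d"
    and "coxeter_quiver C d \<sigma>"
    and "is_seed S"
    and "quiver S = Qm d \<sigma>"
  shows
    "(\<forall>s. (\<forall>i j. R_at s i S = R_at s j S)
       \<and> quiver (R s S) = Qm d \<sigma>
       \<and> (\<forall>t j. avar (R s S) (t, j) =
            (if t = s then f_A d \<sigma> (avar S) s * avar S (s, j) else avar S (t, j)))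
       \<and> (\<forall>t j. xvar (R s S) (t, j) =
            (let X = xvar S; f = f_X X s; \<epsilon> = exchange_matrix d \<sigma> in
             if t = s then f j / (X (s, j - 1) * f (j - 2))
             else if t \<in> out_nbrs \<sigma> s then
               X (t, j) * ((X (s, j - 1) * f (j - 2)) / f (j - 1)) powi (- \<epsilon> t s)
             else if t \<in> in_nbrs \<sigma> s then
               X (t, j) * ((X (s, j) * f (j - 1)) / f j) powi \<epsilon> t s
             else X (t, j))))
     \<and> (\<forall>s t n. coxeter_number C s t = enat n \<longrightarrow> ((R s \<circ> R t) ^^ n) S = S)"
proof -
  note gcm = assms(1) and sym = assms(2) and cox = assms(3) and seed = assms(4) and Q = assms(5)
  have d: "d s > 0" for s
    using sym by (simp add: symmetrizer_def)
  have skew: "skew_symmetric \<sigma>"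
    using cox by (simp add: coxeter_quiver_def)
  have C: "\<bar>exchange_matrix d \<sigma> s t\<bar> = - C t s" if "s \<noteq> t" for s t
    using cox that by (simp add: coxeter_quiver_def)
  have indep: "algebraically_independent (xvar S)" "algebraically_independent (avar S)"
    using seed by (auto simp: is_seed_def)
  let ?P = "pos_ratfuns (xvar S)" and ?P' = "pos_ratfuns (avar S)"
  have P: "positive_part ?P" "positive_part ?P'"
    by (rule positive_part_pos_ratfuns; rule indep)+
  have X: "xvar S w \<in> ?P" and A: "avar S w \<in> ?P'" for w
    by (rule variable_in_pos_ratfuns)+
  note R_at = R_at_eq[OF d skew P Q X A]
  have R: "R s S = \<lparr>quiver = Qm d \<sigma>, xvar = reflect_X d \<sigma> s (xvar S), avar = reflect_A d \<sigma> s (avar S)\<rparr>" for s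
    unfolding R_def by (rule R_at)
  have order: "((R s \<circ> R t) ^^ n) S = S" if n: "coxeter_number C s t = enat n" for s t n
  proof (cases "s = t")
    case True
    then have "n = 1"
      using n by (simp add: coxeter_number_def one_enat_def)
    then show ?thesis
      unfolding R_funpow[OF d skew P Q X A, where s = s and t = t and n = n]
      using reflect_X_involution[where X = "xvar S", OF P(1) X] reflect_A_involution[where A = "avar S", OF skew P(2) A] Q
      by (simp add: True \<open>n = 1\<close>)
  next
    case False
    have le: "\<forall>s t. s \<noteq> t \<longrightarrow> C s t \<le> 0" and eq: "\<forall>s t. C s t = 0 \<longleftrightarrow> C t s = 0"
      using gcm unfolding generalized_cartan_matrix_def by blast+
    note nonpos = le[rule_format, OF False] le[rule_format, OF False[symmetric]]
    note zero = eq[rule_format, of s t]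
    \<comment> \<open>Products 1, 2, 3 of nonnegative integers leave only these pairs, a zero
      product forces both entries to vanish, and infinity is excluded because the Coxeter number is
      \<open>enat n\<close>.\<close>
    have "(- C t s, - C s t, n) \<in> {(0, 0, 2), (1, 1, 3), (1, 2, 4), (2, 1, 4), (1, 3, 6), (3, 1, 6)}"
    proof (cases "C s t * C t s = 0")
      case True
      then have "C s t = 0" "C t s = 0"
        using zero by (metis mult_eq_0_iff)+
      then show ?thesis
        using n \<open>s \<noteq> t\<close> by (simp add: coxeter_number_def numeral_eq_enat)
    next
      case False
      obtain a b where ab: "C t s = - a" "C s t = - b"
        by (metis minus_minus)
      have prod: "C s t * C t s = a * b"
        by (simp add: ab mult.commute)
      then have "a * b \<noteq> 0" using False by simp
      then have e: "enat n = (if a * b = 1 then 3 else if a * b = 2 then 4 else if a * b = 3 then 6 else \<infinity>)"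
        using n \<open>s \<noteq> t\<close> unfolding coxeter_number_def prod by simp
      then have "a * b \<in> {1, 2, 3}" by (auto split: if_splits)
      then have pairs: "(a, b) \<in> {(1, 1), (1, 2), (2, 1), (1, 3), (3, 1)}"
        using nonpos ab by (intro int_product_le_3) simp_all
      have n': "a * b = 1 \<Longrightarrow> n = 3" "a * b = 2 \<Longrightarrow> n = 4" "a * b = 3 \<Longrightarrow> n = 6"
        using e by (simp_all add: numeral_eq_enat)
      have "- C t s = a" "- C s t = b"
        by (simp_all add: ab)
      moreover have "(a, b, n) \<in> {(0, 0, 2), (1, 1, 3), (1, 2, 4), (2, 1, 4), (1, 3, 6), (3, 1, 6)}"
        using pairs n'(1) n'(2) n'(3)
        by (simp only: insert_iff empty_iff prod.inject) (elim disjE conjE; simp)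
      ultimately show ?thesis
        by (simp only:)
    qed
    then have ord: "(\<bar>exchange_matrix d \<sigma> s t\<bar>, \<bar>exchange_matrix d \<sigma> t s\<bar>, n)
        \<in> {(0, 0, 2), (1, 1, 3), (1, 2, 4), (2, 1, 4), (1, 3, 6), (3, 1, 6)}"
      using C[OF False] C[OF False[symmetric]] by (simp only:)
    show ?thesis
      unfolding R_funpow[OF d skew P Q X A, where s = s and t = t and n = n]
        reflect_X_coxeter[OF skew P(1) X indep(1) False ord] reflect_A_order[OF skew P(2) A False ord]
      using Q by simp
  qed
  show ?thesis
  proof (intro conjI allI impI)
    show "R_at s i S = R_at s j S" for s i j
      by (simp only: R_at)
    show "quiver (R s S) = Qm d \<sigma>" for s
      by (simp add: R)
    show "avar (R s S) (t, j) = (if t = s then f_A d \<sigma> (avar S) s * avar S (s, j) else avar S (t, j))" for s t j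
      by (simp add: R reflect_A_def)
    show "xvar (R s S) (t, j) =
            (let X = xvar S; f = f_X X s; \<epsilon> = exchange_matrix d \<sigma> in
             if t = s then f j / (X (s, j - 1) * f (j - 2))
             else if t \<in> out_nbrs \<sigma> s then
               X (t, j) * ((X (s, j - 1) * f (j - 2)) / f (j - 1)) powi (- \<epsilon> t s)
             else if t \<in> in_nbrs \<sigma> s then
               X (t, j) * ((X (s, j) * f (j - 1)) / f j) powi \<epsilon> t s
             else X (t, j))" for s t j
      unfolding R seed.select_convs reflect_X_formula[OF skew P(1) X] Let_def ..
    show "((R s \<circ> R t) ^^ n) S = S" if "coxeter_number C s t = enat n" for s t n
      by (rule order[OF that])
  qed
qed


end
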